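(* Suppose that the diffusion coefficient $a:[0,1]\to(0,\infty)$ and the function $f:\mathbb{R}\to\mathbb{R}$ in the problem $$u_t=(a(x)u_x)_x+f(u),\quad 0<x<1,\qquad u_x(0,t)=u_x(1,t)=0,$$ are analytic, and that $a$ has only two intervals of monotonicity in $[0,1]$ and is not even about the point $x=\tfrac12$. Then there exists a residual set $F$ in $\mathcal{C}^2_S(\mathbb{R})$ such that, if $f\in F$, all equilibria of this problem are hyperbolic.
   Context: $\mathcal{C}^2_S(\mathbb{R})$ denotes the space of $\mathcal{C}^2$ functions $f:\mathbb{R}\to\mathbb{R}$ with $f(0)=0$, endowed with the Whitney topology. A residual set is one containing a countable intersection of open dense sets. An equilibrium is a solution $u$ of $(a(x)u_x)_x+f(u)=0$ on $0\le x\le 1$ with $u_x(0)=u_x(1)=0$. An equilibrium $u$ is hyperbolic if and only if $0$ is not an eigenvalue of the linearized problem $(a w_x)_x+f'(u)w=\lambda w$, $w_x(0)=w_x(1)=0$; equivalently, the only solution of $(a\phi_x)_x+f'(u)\phi=0$, $\phi_x(0)=\phi_x(1)=0$ is $\phi\equiv 0$. The function $a$ is even about $x=\tfrac12$ if $a(x)=a(1-x)$ for all $x\in[0,1]$. A $\mathcal{C}^1$ function $a:[0,1]\to\mathbb{R}$ has $n$ intervals of monotonicity if there exists a partition $0=x_0<x_1<\cdots<x_n=1$ such that on each open subinterval $(x_{i-1},x_i)$ the derivative $a'$ is either strictly positive throughout or strictly negative throughout. *)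

theory Defs
  imports "HOL-Analysis.Analysis"
begin

section \<open>Functions on subsets of the real line\<close>

text \<open>At a point of \<open>S\<close> that is an end point of an interval, the power series is only required to
  represent \<open>f\<close> on the side belonging to \<open>S\<close>. Since it then converges on a full neighbourhood, this is
  the same as analyticity of an extension of \<open>f\<close> to an open set containing \<open>S\<close>, for an interval \<open>S\<close>.\<close>

definition real_analytic_on :: "(real \<Rightarrow> real) \<Rightarrow> real set \<Rightarrow> bool" where
  "real_analytic_on f S \<longleftrightarrow>
     (\<forall>x\<in>S. \<exists>r>0. \<exists>c::nat \<Rightarrow> real. \<forall>y\<in>S. \<bar>y - x\<bar> < r \<longrightarrow> (\<lambda>n. c n * (y - x) ^ n) sums f y)"

definition has_intervals_of_monotonicity :: "(real \<Rightarrow> real) \<Rightarrow> nat \<Rightarrow> bool" where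
  "has_intervals_of_monotonicity a n \<longleftrightarrow>
     (\<exists>a'. continuous_on {0..1} a' \<and>
           (\<forall>x\<in>{0..1}. (a has_real_derivative a' x) (at x within {0..1})) \<and>
           (\<exists>p::nat \<Rightarrow> real. p 0 = 0 \<and> p n = 1 \<and>
              (\<forall>i<n. p i < p (Suc i)) \<and>
              (\<forall>i<n. (\<forall>x\<in>{p i<..<p (Suc i)}. a' x > 0) \<or> (\<forall>x\<in>{p i<..<p (Suc i)}. a' x < 0))))"

definition even_about_half :: "(real \<Rightarrow> real) \<Rightarrow> bool" where
  "even_about_half a \<longleftrightarrow> (\<forall>x\<in>{0..1}. a x = a (1 - x))"


section \<open>The space of \<open>C\<^sup>2\<close> functions vanishing at the origin, with the Whitney topology\<close>

definition C2S :: "(real \<Rightarrow> real) set" where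
  "C2S = {f. f 0 = 0 \<and> (\<forall>x. f differentiable at x) \<and> (\<forall>x. deriv f differentiable at x) \<and>
             continuous_on UNIV (deriv (deriv f))}"

definition whitney_nbhd :: "(real \<Rightarrow> real) \<Rightarrow> (real \<Rightarrow> real) \<Rightarrow> (real \<Rightarrow> real) set" where
  "whitney_nbhd f \<epsilon> = {g \<in> C2S. \<forall>x. \<forall>k\<le>2. \<bar>(deriv ^^ k) g x - (deriv ^^ k) f x\<bar> < \<epsilon> x}"

text \<open>This is the strong (fine) topology: the tolerance \<open>\<epsilon>\<close> is an arbitrary positive continuous
  function on the line, so it may decay at infinity.\<close>

definition whitney_C2S :: "(real \<Rightarrow> real) topology" where
  "whitney_C2S = topology_generated_by
     {whitney_nbhd f \<epsilon> | f \<epsilon>. f \<in> C2S \<and> continuous_on UNIV \<epsilon> \<and> (\<forall>x. \<epsilon> x > 0)}"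

lemma whitney_nbhd_refl: "f \<in> C2S \<Longrightarrow> (\<And>x. \<epsilon> x > 0) \<Longrightarrow> f \<in> whitney_nbhd f \<epsilon>"
  by (simp add: whitney_nbhd_def)

lemma topspace_whitney_C2S [simp]: "topspace whitney_C2S = C2S"
proof
  show "topspace whitney_C2S \<subseteq> C2S"
    by (auto simp: whitney_C2S_def whitney_nbhd_def)
  show "C2S \<subseteq> topspace whitney_C2S"
  proof
    fix f assume f: "f \<in> C2S"
    then have "f \<in> whitney_nbhd f (\<lambda>_. 1)" by (simp add: whitney_nbhd_refl)
    moreover have "whitney_nbhd f (\<lambda>_. 1) \<in>
      {whitney_nbhd f \<epsilon> | f \<epsilon>. f \<in> C2S \<and> continuous_on UNIV \<epsilon> \<and> (\<forall>x. \<epsilon> x > 0)}"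
      unfolding mem_Collect_eq using f by (intro exI[of _ f] exI[of _ "\<lambda>_. 1"]) simp
    ultimately show "f \<in> topspace whitney_C2S"
      unfolding whitney_C2S_def topology_generated_by_topspace by (rule UnionI[rotated])
  qed
qed

lemma C2S_continuous_derivs:
  assumes "f \<in> C2S" "k \<le> 2"
  shows "continuous_on UNIV ((deriv ^^ k) f)"
proof -
  have "continuous_on UNIV f" "continuous_on UNIV (deriv f)" "continuous_on UNIV (deriv (deriv f))"
    using assms(1)
    by (simp_all add: C2S_def continuous_at_imp_continuous_on differentiable_imp_continuous_within)
  moreover have "k = 0 \<or> k = 1 \<or> k = 2" using assms(2) by linarith
  ultimately show ?thesis by (auto simp: numeral_2_eq_2)
qed

lemma whitney_nbhd_subset:
  assumes "f \<in> C2S" "continuous_on UNIV \<epsilon>" "g \<in> whitney_nbhd f \<epsilon>"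
  shows "\<exists>\<delta>. continuous_on UNIV \<delta> \<and> (\<forall>x. \<delta> x > 0) \<and> whitney_nbhd g \<delta> \<subseteq> whitney_nbhd f \<epsilon>"
proof -
  define D where "D k x = \<epsilon> x - \<bar>(deriv ^^ k) g x - (deriv ^^ k) f x\<bar>" for k x
  define \<delta> where "\<delta> x = min (D 0 x) (min (D 1 x) (D 2 x))" for x
  have g: "g \<in> C2S" and pos: "\<And>k x. k \<le> 2 \<Longrightarrow> D k x > 0"
    using assms(3) by (auto simp: whitney_nbhd_def D_def)
  have cont: "continuous_on UNIV (D k)" if "k \<le> 2" for k
    unfolding D_def
    by (intro continuous_intros assms C2S_continuous_derivs g that)
  have "continuous_on UNIV (\<lambda>x. min (D 0 x) (min (D 1 x) (D 2 x)))"
    by (intro continuous_on_min cont) auto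
  then have 1: "continuous_on UNIV \<delta>" by (simp add: \<delta>_def[abs_def])
  have 2: "\<delta> x > 0" for x using pos by (simp add: \<delta>_def)
  have le: "\<delta> x \<le> D k x" if "k \<le> 2" for k x
  proof -
    have "k = 0 \<or> k = 1 \<or> k = 2" using that by linarith
    then show ?thesis by (auto simp: \<delta>_def)
  qed
  have "whitney_nbhd g \<delta> \<subseteq> whitney_nbhd f \<epsilon>"
  proof
    fix h assume h: "h \<in> whitney_nbhd g \<delta>"
    have "\<bar>(deriv ^^ k) h x - (deriv ^^ k) f x\<bar> < \<epsilon> x" if k: "k \<le> 2" for k x
    proof -
      have "\<bar>(deriv ^^ k) h x - (deriv ^^ k) g x\<bar> < \<delta> x"
        using h k by (simp add: whitney_nbhd_def)
      with le[OF k, of x] show ?thesis unfolding D_def by linarith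
    qed
    with h show "h \<in> whitney_nbhd f \<epsilon>" by (simp add: whitney_nbhd_def)
  qed
  with 1 2 show ?thesis by blast
qed

lemma openin_whitney_C2S_iff:
  "openin whitney_C2S U \<longleftrightarrow>
     U \<subseteq> C2S \<and> (\<forall>f\<in>U. \<exists>\<epsilon>. continuous_on UNIV \<epsilon> \<and> (\<forall>x. \<epsilon> x > 0) \<and> whitney_nbhd f \<epsilon> \<subseteq> U)"
  (is "_ \<longleftrightarrow> ?P U")
proof
  assume U: "openin whitney_C2S U"
  have "\<forall>f\<in>U. \<exists>\<epsilon>. continuous_on UNIV \<epsilon> \<and> (\<forall>x. \<epsilon> x > 0) \<and> whitney_nbhd f \<epsilon> \<subseteq> U"
    using U unfolding whitney_C2S_def openin_topology_generated_by_iff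
  proof (induction rule: generate_topology_on.induct)
    case Empty
    then show ?case by simp
  next
    case (Int A B)
    show ?case
    proof
      fix f assume "f \<in> A \<inter> B"
      then have "f \<in> A" "f \<in> B" by auto
      from Int.IH(1)[rule_format, OF this(1)] obtain \<epsilon> where
        "continuous_on UNIV \<epsilon>" "\<forall>x. \<epsilon> x > 0" "whitney_nbhd f \<epsilon> \<subseteq> A"
        by blast
      moreover from Int.IH(2)[rule_format, OF \<open>f \<in> B\<close>] obtain \<delta> where
        "continuous_on UNIV \<delta>" "\<forall>x. \<delta> x > 0" "whitney_nbhd f \<delta> \<subseteq> B"
        by blast
      moreover have "whitney_nbhd f (\<lambda>x. min (\<epsilon> x) (\<delta> x)) \<subseteq> whitney_nbhd f \<epsilon> \<inter> whitney_nbhd f \<delta>"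
        by (auto simp: whitney_nbhd_def)
      ultimately show "\<exists>\<epsilon>. continuous_on UNIV \<epsilon> \<and> (\<forall>x. \<epsilon> x > 0) \<and> whitney_nbhd f \<epsilon> \<subseteq> A \<inter> B"
        by (intro exI[of _ "\<lambda>x. min (\<epsilon> x) (\<delta> x)"] conjI continuous_on_min) auto
    qed
  next
    case (UN K)
    show ?case
    proof
      fix f assume "f \<in> \<Union>K"
      then obtain V where V: "V \<in> K" "f \<in> V" by blast
      from UN.IH[OF V(1)] V(2) obtain \<epsilon> where
        "continuous_on UNIV \<epsilon>" "\<forall>x. \<epsilon> x > 0" "whitney_nbhd f \<epsilon> \<subseteq> V"
        by blast
      with V(1) show "\<exists>\<epsilon>. continuous_on UNIV \<epsilon> \<and> (\<forall>x. \<epsilon> x > 0) \<and> whitney_nbhd f \<epsilon> \<subseteq> \<Union>K"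
        by (intro exI[of _ \<epsilon>]) auto
    qed
  next
    case (Basis V)
    then obtain f \<epsilon> where "V = whitney_nbhd f \<epsilon>" "f \<in> C2S" "continuous_on UNIV \<epsilon>"
      by blast
    then show ?case using whitney_nbhd_subset[of f \<epsilon>] by simp
  qed
  moreover have "U \<subseteq> C2S" using openin_subset[OF U] by simp
  ultimately show "?P U" by simp
next
  assume P: "?P U"
  show "openin whitney_C2S U"
  proof (subst openin_subopen, intro ballI)
    fix f assume f: "f \<in> U"
    with P obtain \<epsilon> where e: "continuous_on UNIV \<epsilon>" "\<And>x. \<epsilon> x > 0" "whitney_nbhd f \<epsilon> \<subseteq> U"
      by blast
    have fC: "f \<in> C2S" using f P by blast
    have "openin whitney_C2S (whitney_nbhd f \<epsilon>)"
      unfolding whitney_C2S_def 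
      by (rule topology_generated_by_Basis, unfold mem_Collect_eq, rule exI[of _ f], rule exI[of _ \<epsilon>])
        (use fC e in simp)
    then show "\<exists>T. openin whitney_C2S T \<and> f \<in> T \<and> T \<subseteq> U"
      using e whitney_nbhd_refl[of f \<epsilon>, OF fC] by (intro exI[of _ "whitney_nbhd f \<epsilon>"]) simp
  qed
qed

definition residual_in :: "'a topology \<Rightarrow> 'a set \<Rightarrow> bool" where
  "residual_in X F \<longleftrightarrow> F \<subseteq> topspace X \<and>
     (\<exists>U::nat \<Rightarrow> 'a set. (\<forall>n. openin X (U n) \<and> X closure_of U n = topspace X) \<and> (\<Inter>n. U n) \<subseteq> F)"


section \<open>Equilibria of the reaction-diffusion problem and their hyperbolicity\<close>

text \<open>\<open>u\<close> is a classical solution of \<open>(a u\<^sub>x)\<^sub>x = g\<close> on \<open>[0,1]\<close> with \<open>u\<^sub>x(0) = u\<^sub>x(1) = 0\<close>.\<close>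

definition neumann_solution :: "(real \<Rightarrow> real) \<Rightarrow> (real \<Rightarrow> real) \<Rightarrow> (real \<Rightarrow> real) \<Rightarrow> bool" where
  "neumann_solution a g u \<longleftrightarrow>
     (\<exists>u'. (\<forall>x\<in>{0..1}. (u has_real_derivative u' x) (at x within {0..1})) \<and>
           (\<forall>x\<in>{0..1}. ((\<lambda>y. a y * u' y) has_real_derivative g x) (at x within {0..1})) \<and>
           u' 0 = 0 \<and> u' 1 = 0)"

definition equilibrium :: "(real \<Rightarrow> real) \<Rightarrow> (real \<Rightarrow> real) \<Rightarrow> (real \<Rightarrow> real) \<Rightarrow> bool" where
  "equilibrium a f u \<longleftrightarrow> neumann_solution a (\<lambda>x. - f (u x)) u"

text \<open>The linearized operator is self-adjoint, so real eigenvalues and eigenfunctions suffice.\<close>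

definition linearized_eigenvalue ::
    "(real \<Rightarrow> real) \<Rightarrow> (real \<Rightarrow> real) \<Rightarrow> (real \<Rightarrow> real) \<Rightarrow> real \<Rightarrow> bool" where
  "linearized_eigenvalue a f u \<mu> \<longleftrightarrow>
     (\<exists>w. (\<exists>x\<in>{0..1}. w x \<noteq> 0) \<and> neumann_solution a (\<lambda>x. \<mu> * w x - deriv f (u x) * w x) w)"

definition hyperbolic :: "(real \<Rightarrow> real) \<Rightarrow> (real \<Rightarrow> real) \<Rightarrow> (real \<Rightarrow> real) \<Rightarrow> bool" where
  "hyperbolic a f u \<longleftrightarrow> \<not> linearized_eigenvalue a f u 0"

end

theory Submission
  imports Defs "HOL-Complex_Analysis.Complex_Analysis"
begin

text \<open>
  Let \<open>v = a u'\<close> be the flux of an equilibrium \<open>u\<close>, and let \<open>\<phi>\<close> be in the kernel of its linearization, with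
  flux \<open>\<psi> = a \<phi>'\<close>.

  Genericity. The parameters \<open>t\<close> for which \<open>f + t h\<close> has a nonhyperbolic equilibrium near \<open>u\<close> are not parametrized
  by the implicit function theorem. Instead, if \<open>(u\<^sub>1, \<phi>\<^sub>1)\<close> and \<open>(u\<^sub>2, \<phi>\<^sub>2)\<close> are such pairs for \<open>t\<^sub>1\<close> and \<open>t\<^sub>2\<close>, then
  testing the equation of \<open>u\<^sub>2 - u\<^sub>1\<close> with \<open>\<phi>\<^sub>1\<close> gives \<open>\<bar>t\<^sub>1 - t\<^sub>2\<bar> \<le> C (u\<^sub>1(0) - u\<^sub>2(0))\<^sup>2\<close> as soon as \<open>\<integral> h(u) \<phi> \<noteq> 0\<close>.
  By the pigeonhole principle such \<open>t\<close> cannot fill an interval. Gronwall's inequality and compactness of the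
  range of \<open>u(0)\<close> turn this into open dense sets. Constant equilibria are treated first, by rescaling \<open>f\<close> so that the
  nonzero slopes at its zeros avoid the countable Neumann spectrum.

  Transversality. Suppose that \<open>\<integral> h(u) \<phi> = 0\<close> for all \<open>h\<close>, so that \<open>\<phi>\<close> has mean zero over every set \<open>\<bar>u - C\<bar> < r\<close>.
  If \<open>C\<close> is an extremum of \<open>u\<close> attained only at one end point, this forces \<open>\<phi> = 0\<close>. If two monotone branches of
  \<open>u\<close>, at \<open>y\<close> and \<open>Z y\<close> say, bound the set, then \<open>\<phi>(Z) Z' = \<phi>\<close>, and both \<open>\<psi>(Z) - \<psi>\<close> and \<open>v(Z) \<phi>(Z) - v \<phi>\<close> are
  constant, hence zero. It follows that \<open>v(Z) = Z' v\<close> and \<open>a(Z) = Z'\<^sup>2 a\<close> with \<open>Z'\<close> constant, and analyticity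
  extends this symmetry of \<open>a\<close>. Which points attain an extremum is controlled by the energy \<open>v\<^sup>2 / (2 a) + F(u)\<close> with
  \<open>F' = f\<close>, which is strictly decreasing where \<open>a\<close> increases and strictly increasing where \<open>a\<close> decreases.
\<close>

section \<open>Gronwall estimates\<close>

text \<open>An orthogonality relation only sees the sum of the contributions of all monotone
  branches of \<open>u\<close> near a level. It is informative only near a level attained by at most
  two branches, and the energy together with the two intervals of monotonicity is what supplies such
  a level. Admissible perturbations vanish at \<open>0\<close>, so no relation is available for sets
  \<open>\<bar>u - C\<bar> < r\<close> that contain points with \<open>u = 0\<close>. For a
  nonconstant equilibrium this costs nothing: critical levels are never \<open>0\<close>, since
  \<open>f 0 = 0\<close> would make \<open>u\<close> the constant \<open>0\<close> by uniqueness.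
  For the constant equilibrium \<open>0\<close> it is a true obstruction, and this is why the slope
  of \<open>f\<close> at \<open>0\<close> has to be moved off the spectrum beforehand. The quadratic
  estimate excludes an interval of parameters by counting: among about N parameters at spacing of
  order 1/N, two have values of \<open>u 0\<close> at distance of order 1/N, which would give 1/N
  \<le> C/N^2 up to constants. The value of \<open>u 0\<close> at a parameter is a mere choice, so
  counting replaces differentiation in the parameter.\<close>

lemma Icc_nonneg_derivative_mono:
  fixes f :: "real \<Rightarrow> real"
  assumes d: "\<And>x. x \<in> {s..t} \<Longrightarrow> (f has_real_derivative f' x) (at x within {s..t})"
    and nn: "\<And>x. x \<in> {s<..<t} \<Longrightarrow> 0 \<le> f' x"
    and xy: "s \<le> x" "x \<le> y" "y \<le> t"
  shows "f x \<le> f y"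
proof (rule DERIV_nonneg_imp_increasing_open[OF xy(2)])
  show "continuous_on {x..y} f"
    by (rule continuous_on_subset[OF DERIV_continuous_on[OF d]]) (use xy in auto)
  fix z assume z: "x < z" "z < y"
  then have "(f has_real_derivative f' z) (at z)"
    using d[of z] xy by (simp add: at_within_Icc_at)
  then show "\<exists>y. (f has_real_derivative y) (at z) \<and> 0 \<le> y"
    using nn z xy by force
qed

text \<open>The bound on \<open>\<bar>Q'\<bar>\<close> makes \<open>exp (- K * x) * Q x\<close>
  nonincreasing and \<open>exp (K * x) * Q x\<close> nondecreasing, so the estimate runs in both
  directions. Hence the base point may lie inside the interval.\<close>

lemma gronwall_two_sided:
  fixes Q :: "real \<Rightarrow> real"
  assumes d: "\<And>x. x \<in> {s..t} \<Longrightarrow> (Q has_real_derivative Q' x) (at x within {s..t})"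
    and b: "\<And>x. x \<in> {s..t} \<Longrightarrow> \<bar>Q' x\<bar> \<le> K * Q x"
    and x: "x \<in> {s..t}" and y: "y \<in> {s..t}"
  shows "Q y \<le> exp (K * \<bar>y - x\<bar>) * Q x"
proof (cases "x \<le> y")
  case True
  have "- (exp (- K * x) * Q x) \<le> - (exp (- K * y) * Q y)"
  proof (rule Icc_nonneg_derivative_mono[of s t "\<lambda>x. - (exp (- K * x) * Q x)"
        "\<lambda>x. - (exp (- K * x) * (Q' x - K * Q x))"])
    fix z assume "z \<in> {s..t}"
    then show "((\<lambda>x. - (exp (- K * x) * Q x)) has_real_derivative - (exp (- K * z) * (Q' z - K * Q z)))
        (at z within {s..t})"
      by (auto intro!: derivative_eq_intros d simp: algebra_simps)
  next
    fix z assume "z \<in> {s<..<t}"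
    then have "Q' z - K * Q z \<le> 0" using b[of z] by auto
    then show "0 \<le> - (exp (- K * z) * (Q' z - K * Q z))"
      by (simp add: mult_nonneg_nonpos)
  qed (use x y True in auto)
  then have "Q y / exp (K * y) \<le> Q x / exp (K * x)"
    by (simp add: exp_minus field_simps)
  then show ?thesis
    using True by (simp add: right_diff_distrib exp_diff field_simps)
next
  case False
  have "exp (K * y) * Q y \<le> exp (K * x) * Q x"
  proof (rule Icc_nonneg_derivative_mono[of s t "\<lambda>x. exp (K * x) * Q x"
        "\<lambda>x. exp (K * x) * (Q' x + K * Q x)"])
    fix z assume "z \<in> {s..t}"
    then show "((\<lambda>x. exp (K * x) * Q x) has_real_derivative exp (K * z) * (Q' z + K * Q z))
        (at z within {s..t})"
      by (auto intro!: derivative_eq_intros d simp: algebra_simps)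
  next
    fix z assume "z \<in> {s<..<t}"
    then have "Q' z + K * Q z \<ge> 0" using b[of z] by auto
    then show "0 \<le> exp (K * z) * (Q' z + K * Q z)" by simp
  qed (use x y False in auto)
  then show ?thesis
    using False by (simp add: right_diff_distrib exp_diff field_simps)
qed

lemma continuous_on_Icc_bounded:
  fixes g :: "real \<Rightarrow> real"
  assumes "continuous_on {s..t} g"
  obtains B where "B > 0" "\<And>x. x \<in> {s..t} \<Longrightarrow> \<bar>g x\<bar> \<le> B"
proof -
  have "bounded (g ` {s..t})"
    using assms by (intro compact_imp_bounded compact_continuous_image) auto
  then obtain B where "B > 0" "\<forall>y\<in>g ` {s..t}. norm y \<le> B" by (meson bounded_pos)
  then show ?thesis by (intro that[of B]) auto
qed

text \<open>Including \<open>\<epsilon>\<^sup>2\<close> in the quadratic form turns the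
  inhomogeneous system into a homogeneous estimate: the source contributes 2 |z| \<epsilon> \<le>
  z^2 + \<epsilon>^2, which accounts for the \<open>1\<close> in \<open>A + L + 1\<close>.\<close>

lemma gronwall_system:
  fixes w z r a :: "real \<Rightarrow> real"
  assumes w: "\<And>x. x \<in> {s..t} \<Longrightarrow> (w has_real_derivative z x / a x) (at x within {s..t})"
    and z: "\<And>x. x \<in> {s..t} \<Longrightarrow> (z has_real_derivative r x) (at x within {s..t})"
    and r: "\<And>x. x \<in> {s..t} \<Longrightarrow> \<bar>r x\<bar> \<le> L * \<bar>w x\<bar> + \<epsilon>"
    and a: "\<And>x. x \<in> {s..t} \<Longrightarrow> \<bar>1 / a x\<bar> \<le> A"
    and nn: "0 \<le> L" "0 \<le> \<epsilon>"
    and x: "x \<in> {s..t}" and y: "y \<in> {s..t}"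
  shows "(w y)\<^sup>2 + (z y)\<^sup>2 + \<epsilon>\<^sup>2 \<le> exp ((A + L + 1) * \<bar>y - x\<bar>) * ((w x)\<^sup>2 + (z x)\<^sup>2 + \<epsilon>\<^sup>2)"
proof (rule gronwall_two_sided[where Q = "\<lambda>x. (w x)\<^sup>2 + (z x)\<^sup>2 + \<epsilon>\<^sup>2" and s = s and t = t
      and Q' = "\<lambda>x. 2 * w x * (z x / a x) + 2 * z x * r x"])
  fix \<xi> assume \<xi>: "\<xi> \<in> {s..t}"
  show "((\<lambda>x. (w x)\<^sup>2 + (z x)\<^sup>2 + \<epsilon>\<^sup>2) has_real_derivative 2 * w \<xi> * (z \<xi> / a \<xi>) + 2 * z \<xi> * r \<xi>)
      (at \<xi> within {s..t})"
    using \<xi> by (auto intro!: derivative_eq_intros w z)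
  have A: "0 \<le> A" using a[OF \<xi>] by linarith
  have "\<bar>2 * w \<xi> * (z \<xi> / a \<xi>)\<bar> = \<bar>1 / a \<xi>\<bar> * (2 * \<bar>w \<xi>\<bar> * \<bar>z \<xi>\<bar>)"
    by (simp add: abs_mult)
  also have "\<dots> \<le> A * (2 * \<bar>w \<xi>\<bar> * \<bar>z \<xi>\<bar>)"
    by (rule mult_right_mono[OF a[OF \<xi>]]) simp
  also have "\<dots> \<le> A * ((w \<xi>)\<^sup>2 + (z \<xi>)\<^sup>2)"
    using sum_squares_bound[of "\<bar>w \<xi>\<bar>" "\<bar>z \<xi>\<bar>"] A by (intro mult_left_mono) auto
  finally have 1: "\<bar>2 * w \<xi> * (z \<xi> / a \<xi>)\<bar> \<le> A * ((w \<xi>)\<^sup>2 + (z \<xi>)\<^sup>2)" .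
  have "\<bar>2 * z \<xi> * r \<xi>\<bar> = 2 * \<bar>z \<xi>\<bar> * \<bar>r \<xi>\<bar>" by (simp add: abs_mult)
  also have "\<dots> \<le> 2 * \<bar>z \<xi>\<bar> * (L * \<bar>w \<xi>\<bar> + \<epsilon>)"
    by (rule mult_left_mono[OF r[OF \<xi>]]) simp
  also have "\<dots> = L * (2 * \<bar>w \<xi>\<bar> * \<bar>z \<xi>\<bar>) + 2 * \<bar>z \<xi>\<bar> * \<epsilon>" by (simp add: algebra_simps)
  also have "\<dots> \<le> L * ((w \<xi>)\<^sup>2 + (z \<xi>)\<^sup>2) + ((z \<xi>)\<^sup>2 + \<epsilon>\<^sup>2)"
    using sum_squares_bound[of "\<bar>w \<xi>\<bar>" "\<bar>z \<xi>\<bar>"] sum_squares_bound[of "\<bar>z \<xi>\<bar>" \<epsilon>] nn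
    by (intro add_mono mult_left_mono) auto
  finally have 2: "\<bar>2 * z \<xi> * r \<xi>\<bar> \<le> L * ((w \<xi>)\<^sup>2 + (z \<xi>)\<^sup>2) + ((z \<xi>)\<^sup>2 + \<epsilon>\<^sup>2)" .
  have 3: "0 \<le> (A + L) * \<epsilon>\<^sup>2" using A nn by simp
  show "\<bar>2 * w \<xi> * (z \<xi> / a \<xi>) + 2 * z \<xi> * r \<xi>\<bar> \<le> (A + L + 1) * ((w \<xi>)\<^sup>2 + (z \<xi>)\<^sup>2 + \<epsilon>\<^sup>2)"
  proof -
    have "(A + L + 1) * ((w \<xi>)\<^sup>2 + (z \<xi>)\<^sup>2 + \<epsilon>\<^sup>2) = A * ((w \<xi>)\<^sup>2 + (z \<xi>)\<^sup>2)
        + (L * ((w \<xi>)\<^sup>2 + (z \<xi>)\<^sup>2) + ((z \<xi>)\<^sup>2 + \<epsilon>\<^sup>2)) + (w \<xi>)\<^sup>2 + (A + L) * \<epsilon>\<^sup>2"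
      by (simp add: algebra_simps)
    moreover have "\<bar>2 * w \<xi> * (z \<xi> / a \<xi>) + 2 * z \<xi> * r \<xi>\<bar>
        \<le> A * ((w \<xi>)\<^sup>2 + (z \<xi>)\<^sup>2) + (L * ((w \<xi>)\<^sup>2 + (z \<xi>)\<^sup>2) + ((z \<xi>)\<^sup>2 + \<epsilon>\<^sup>2))"
      by (rule order_trans[OF abs_triangle_ineq add_mono[OF 1 2]])
    ultimately show ?thesis
      using 3 by (smt (verit) zero_le_power2)
  qed
qed (rule x, rule y)

lemma uniqueness_system:
  fixes w z r a :: "real \<Rightarrow> real"
  assumes w: "\<And>x. x \<in> {s..t} \<Longrightarrow> (w has_real_derivative z x / a x) (at x within {s..t})"
    and z: "\<And>x. x \<in> {s..t} \<Longrightarrow> (z has_real_derivative r x) (at x within {s..t})"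
    and r: "\<And>x. x \<in> {s..t} \<Longrightarrow> \<bar>r x\<bar> \<le> L * \<bar>w x\<bar>"
    and a: "\<And>x. x \<in> {s..t} \<Longrightarrow> 0 < a x" "continuous_on {s..t} a"
    and L: "0 \<le> L"
    and x: "x \<in> {s..t}" "w x = 0" "z x = 0" and y: "y \<in> {s..t}"
  shows "w y = 0 \<and> z y = 0"
proof -
  have "continuous_on {s..t} (\<lambda>x. 1 / a x)"
    using a by (intro continuous_intros) force+
  then obtain A where A: "\<And>x. x \<in> {s..t} \<Longrightarrow> \<bar>1 / a x\<bar> \<le> A"
    using continuous_on_Icc_bounded by blast
  have "(w y)\<^sup>2 + (z y)\<^sup>2 + 0\<^sup>2 \<le> exp ((A + L + 1) * \<bar>y - x\<bar>) * ((w x)\<^sup>2 + (z x)\<^sup>2 + 0\<^sup>2)"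
    by (rule gronwall_system[where s = s and t = t and a = a and r = r]) (use w z r A L x y in auto)
  then have "(w y)\<^sup>2 + (z y)\<^sup>2 \<le> 0" using x by simp
  then show ?thesis by (simp add: sum_power2_le_zero_iff)
qed

section \<open>Nonhyperbolic equilibria with a kernel orthogonal to the level sets\<close>

text \<open>The limit form of \<open>\<integral> h(u) \<phi> = 0\<close> for all admissible
  \<open>h\<close>. The radius stays below \<open>\<bar>C\<bar>\<close> so that a function supported
  in the window vanishes at \<open>0\<close>, and below \<open>1\<close> so that its support stays
  in a fixed enlargement of the range of \<open>u\<close>.\<close>

definition orthogonal_to_levels :: "(real \<Rightarrow> real) \<Rightarrow> (real \<Rightarrow> real) \<Rightarrow> bool" where
  "orthogonal_to_levels u \<phi> \<longleftrightarrow> (\<forall>C\<in>u ` {0..1}. \<forall>r. 0 < r \<and> r < \<bar>C\<bar> \<and> r < 1 \<longrightarrow>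
     ((\<lambda>x. if \<bar>u x - C\<bar> < r then \<phi> x else 0) has_integral 0) {0..1})"

text \<open>The situation to be refuted. It is a locale because both symmetries of the problem,
  \<open>x \<mapsto> 1 - x\<close> and \<open>u \<mapsto> - u\<close>, produce further instances, so
  that each argument is carried out at one end point and for maxima only.\<close>

locale kernel_pair =
  fixes a a' f f' u v \<phi> \<psi> :: "real \<Rightarrow> real"
  assumes a_pos: "\<And>x. x \<in> {0..1} \<Longrightarrow> 0 < a x"
    and a_deriv: "\<And>x. x \<in> {0..1} \<Longrightarrow> (a has_real_derivative a' x) (at x within {0..1})"
    and f_deriv: "\<And>s. (f has_real_derivative f' s) (at s)"
    and f'_cont: "continuous_on UNIV f'"
    and f_0: "f 0 = 0"
    and u_deriv: "\<And>x. x \<in> {0..1} \<Longrightarrow> (u has_real_derivative v x / a x) (at x within {0..1})"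
    and v_deriv: "\<And>x. x \<in> {0..1} \<Longrightarrow> (v has_real_derivative - f (u x)) (at x within {0..1})"
    and \<phi>_deriv: "\<And>x. x \<in> {0..1} \<Longrightarrow> (\<phi> has_real_derivative \<psi> x / a x) (at x within {0..1})"
    and \<psi>_deriv: "\<And>x. x \<in> {0..1} \<Longrightarrow> (\<psi> has_real_derivative - (f' (u x) * \<phi> x)) (at x within {0..1})"
    and v_bdry: "v 0 = 0" "v 1 = 0"
    and \<psi>_bdry: "\<psi> 0 = 0" "\<psi> 1 = 0"
    and \<phi>_nontrivial: "\<exists>x\<in>{0..1}. \<phi> x \<noteq> 0"
    and u_nonconst: "\<exists>x\<in>{0..1}. \<exists>y\<in>{0..1}. u x \<noteq> u y"
    and orth: "orthogonal_to_levels u \<phi>"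

section \<open>Symmetries of the problem: reflection of the interval and change of sign\<close>

lemma has_real_derivative_reflect:
  assumes "(g has_real_derivative D) (at (c - x) within {c - t..c - s})"
  shows "((\<lambda>x. g (c - x)) has_real_derivative - D) (at x within {s..t})"
proof -
  have "(\<lambda>x. c - x) ` {s..t} = {c - t..c - s}"
    by (simp add: image_diff_atLeastAtMost)
  then have "(g \<circ> (\<lambda>x. c - x) has_real_derivative D * (-1)) (at x within {s..t})"
    using assms by (intro DERIV_image_chain) (auto intro!: derivative_eq_intros)
  then show ?thesis by (simp add: o_def)
qed

text \<open>Exchanges the two end points. Fluxes and \<open>a'\<close> change sign, as they contain
  one derivative in \<open>x\<close>.\<close>

lemma (in kernel_pair) reflected:
  "kernel_pair (\<lambda>x. a (1 - x)) (\<lambda>x. - a' (1 - x)) f f' (\<lambda>x. u (1 - x)) (\<lambda>x. - v (1 - x))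
     (\<lambda>x. \<phi> (1 - x)) (\<lambda>x. - \<psi> (1 - x))"
proof
  fix x :: real assume x: "x \<in> {0..1}"
  then have x': "1 - x \<in> {0..1}" by auto
  have *: "((\<lambda>x. g (1 - x)) has_real_derivative - D) (at x within {0..1})"
    if "(g has_real_derivative D) (at (1 - x) within {0..1})" for g D
    using has_real_derivative_reflect[of g D 1 x 1 0] that by simp
  show "0 < a (1 - x)" using a_pos x' by blast
  show "((\<lambda>x. a (1 - x)) has_real_derivative - a' (1 - x)) (at x within {0..1})"
    by (intro * a_deriv x')
  show "((\<lambda>x. u (1 - x)) has_real_derivative - v (1 - x) / a (1 - x)) (at x within {0..1})"
    using *[OF u_deriv[OF x']] by simp
  show "((\<lambda>x. \<phi> (1 - x)) has_real_derivative - \<psi> (1 - x) / a (1 - x)) (at x within {0..1})"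
    using *[OF \<phi>_deriv[OF x']] by simp
  show "((\<lambda>x. - v (1 - x)) has_real_derivative - f (u (1 - x))) (at x within {0..1})"
    using DERIV_minus[OF *[OF v_deriv[OF x']]] by simp
  show "((\<lambda>x. - \<psi> (1 - x)) has_real_derivative - (f' (u (1 - x)) * \<phi> (1 - x))) (at x within {0..1})"
    using DERIV_minus[OF *[OF \<psi>_deriv[OF x']]] by simp
next
  show "\<exists>x\<in>{0..1}. \<phi> (1 - x) \<noteq> 0"
  proof -
    obtain x where "x \<in> {0..1}" "\<phi> x \<noteq> 0" using \<phi>_nontrivial by blast
    then show ?thesis by (intro bexI[of _ "1 - x"]) auto
  qed
  show "\<exists>x\<in>{0..1}. \<exists>y\<in>{0..1}. u (1 - x) \<noteq> u (1 - y)"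
  proof -
    obtain x y where "x \<in> {0..1}" "y \<in> {0..1}" "u x \<noteq> u y" using u_nonconst by blast
    then show ?thesis by (intro bexI[of _ "1 - x"] bexI[of _ "1 - y"]) auto
  qed
  show "orthogonal_to_levels (\<lambda>x. u (1 - x)) (\<lambda>x. \<phi> (1 - x))"
    unfolding orthogonal_to_levels_def
  proof safe
    fix x r :: real assume x: "x \<in> {0..1}" and r: "0 < r" "r < \<bar>u (1 - x)\<bar>" "r < 1"
    let ?C = "u (1 - x)"
    have "?C \<in> u ` {0..1}" using x by auto
    then have "((\<lambda>x. if \<bar>u x - ?C\<bar> < r then \<phi> x else 0) has_integral 0) {0..1}"
      using orth r unfolding orthogonal_to_levels_def by blast
    then have "((\<lambda>x. if \<bar>u x - ?C\<bar> < r then \<phi> x else 0) has_integral 0) (cbox 0 1)"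
      by simp
    from has_integral_affinity[where m = "-1" and c = 1, OF this]
    show "((\<lambda>x. if \<bar>u (1 - x) - ?C\<bar> < r then \<phi> (1 - x) else 0) has_integral 0) {0..1}"
      by (simp add: image_affinity_atLeastAtMost cong: if_cong)
  qed
qed (use v_bdry \<psi>_bdry f_deriv f'_cont f_0 in auto)

text \<open>Exchanges minima and maxima of \<open>u\<close>. The derivative of
  \<open>- f (- s)\<close> is \<open>f' (- s)\<close>, so the linearization, and with it
  \<open>\<phi>\<close> and \<open>\<psi>\<close>, is unchanged.\<close>

lemma (in kernel_pair) negated:
  "kernel_pair a a' (\<lambda>s. - f (- s)) (\<lambda>s. f' (- s)) (\<lambda>x. - u x) (\<lambda>x. - v x) \<phi> \<psi>"
proof
  show "((\<lambda>s. - f (- s)) has_real_derivative f' (- s)) (at s)" for s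
    by (auto intro!: derivative_eq_intros DERIV_chain2[OF f_deriv])
  show "continuous_on UNIV (\<lambda>s. f' (- s))"
    by (intro continuous_on_compose2[OF f'_cont] continuous_intros) auto
  show "orthogonal_to_levels (\<lambda>x. - u x) \<phi>"
    unfolding orthogonal_to_levels_def
  proof safe
    fix x r :: real assume x: "x \<in> {0..1}" and r: "0 < r" "r < \<bar>- u x\<bar>" "r < 1"
    have eq: "\<bar>- u y - - u x\<bar> = \<bar>u y - u x\<bar>" for y by linarith
    show "((\<lambda>y. if \<bar>- u y - - u x\<bar> < r then \<phi> y else 0) has_integral 0) {0..1}"
      unfolding eq using orth x r unfolding orthogonal_to_levels_def by auto
  qed
  fix x :: real assume x: "x \<in> {0..1}"
  show "((\<lambda>x. - u x) has_real_derivative - v x / a x) (at x within {0..1})"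
    using DERIV_minus[OF u_deriv[OF x]] by simp
  show "((\<lambda>x. - v x) has_real_derivative - (- f (- (- u x)))) (at x within {0..1})"
    using DERIV_minus[OF v_deriv[OF x]] by simp
qed (use a_pos a_deriv \<phi>_deriv \<psi>_deriv v_bdry \<psi>_bdry f_0 u_nonconst \<phi>_nontrivial in auto)

section \<open>Isolated zeros, the energy, and levels attained at one end point\<close>

context kernel_pair
begin

lemma continuous [continuous_intros]:
  "continuous_on {0..1} a" "continuous_on {0..1} u" "continuous_on {0..1} v"
  "continuous_on {0..1} \<phi>" "continuous_on {0..1} \<psi>"
  by (rule DERIV_continuous_on, fact a_deriv u_deriv v_deriv \<phi>_deriv \<psi>_deriv)+

lemma lipschitz:
  obtains L where "0 \<le> L"
    "\<And>x y. x \<in> {0..1} \<Longrightarrow> y \<in> {0..1} \<Longrightarrow> \<bar>f (u x) - f (u y)\<bar> \<le> L * \<bar>u x - u y\<bar>"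
    "\<And>x. x \<in> {0..1} \<Longrightarrow> \<bar>f' (u x)\<bar> \<le> L"
proof -
  obtain B where B: "B > 0" "\<And>x. x \<in> {0..1} \<Longrightarrow> \<bar>u x\<bar> \<le> B"
    using continuous_on_Icc_bounded[OF continuous(2)] by blast
  obtain L where L: "L > 0" "\<And>s. s \<in> {-B..B} \<Longrightarrow> \<bar>f' s\<bar> \<le> L"
    using continuous_on_Icc_bounded[OF continuous_on_subset[OF f'_cont]] by blast
  have "norm (f s - f t) \<le> L * norm (s - t)" if "s \<in> {-B..B}" "t \<in> {-B..B}" for s t
    using that L(2) by (intro field_differentiable_bound[of "{-B..B}" f f'])
      (auto intro: has_field_derivative_at_within[OF f_deriv])
  note f = this
  have u: "u x \<in> {-B..B}" if "x \<in> {0..1}" for x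
    using B(2)[OF that] by (simp add: abs_le_iff)
  show ?thesis
  proof (rule that)
    show "0 \<le> L" using L(1) by simp
    show "\<bar>f (u x) - f (u y)\<bar> \<le> L * \<bar>u x - u y\<bar>" if "x \<in> {0..1}" "y \<in> {0..1}" for x y
      using f[OF u[OF that(1)] u[OF that(2)]] by simp
    show "\<bar>f' (u x)\<bar> \<le> L" if "x \<in> {0..1}" for x
      by (rule L(2)[OF u[OF that]])
  qed
qed

text \<open>If \<open>f\<close> vanished at \<open>u x\<close>, the constant \<open>u x\<close>
  would solve the same initial value problem at \<open>x\<close>, and \<open>u\<close> would be
  constant. Since \<open>u x\<close> is nonzero, small windows about critical levels are admissible
  for the orthogonality relations.\<close>

lemma critical_value_nonzero:
  assumes x: "x \<in> {0..1}" and v: "v x = 0"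
  shows "f (u x) \<noteq> 0" "u x \<noteq> 0"
proof -
  show *: "f (u x) \<noteq> 0"
  proof
    assume f0: "f (u x) = 0"
    obtain L where L: "0 \<le> L"
      "\<And>x y. x \<in> {0..1} \<Longrightarrow> y \<in> {0..1} \<Longrightarrow> \<bar>f (u x) - f (u y)\<bar> \<le> L * \<bar>u x - u y\<bar>"
      "\<And>x. x \<in> {0..1} \<Longrightarrow> \<bar>f' (u x)\<bar> \<le> L"
      using lipschitz by metis
    have "u y - u x = 0 \<and> v y = 0" if "y \<in> {0..1}" for y
    proof (rule uniqueness_system[where w = "\<lambda>y. u y - u x" and s = 0 and t = 1 and x = x and L = L])
      fix y assume y: "y \<in> {0::real..1}"
      show "((\<lambda>y. u y - u x) has_real_derivative v y / a y) (at y within {0..1})"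
        using y by (auto intro!: derivative_eq_intros u_deriv)
      show "(v has_real_derivative - f (u y)) (at y within {0..1})" by (rule v_deriv[OF y])
      show "\<bar>- f (u y)\<bar> \<le> L * \<bar>u y - u x\<bar>" using L(2)[OF y x] f0 by simp
    qed (use a_pos continuous L(1) x v that in auto)
    then show False using u_nonconst by (metis eq_iff_diff_eq_0)
  qed
  then show "u x \<noteq> 0" using f_0 by auto
qed

lemma kernel_zero_simple:
  assumes x: "x \<in> {0..1}" and "\<phi> x = 0"
  shows "\<psi> x \<noteq> 0"
proof
  assume "\<psi> x = 0"
  obtain L where L: "0 \<le> L"
    "\<And>x y. x \<in> {0..1} \<Longrightarrow> y \<in> {0..1} \<Longrightarrow> \<bar>f (u x) - f (u y)\<bar> \<le> L * \<bar>u x - u y\<bar>"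
    "\<And>x. x \<in> {0..1} \<Longrightarrow> \<bar>f' (u x)\<bar> \<le> L"
    using lipschitz by metis
  have "\<phi> y = 0 \<and> \<psi> y = 0" if "y \<in> {0..1}" for y
  proof (rule uniqueness_system[OF \<phi>_deriv \<psi>_deriv])
    show "\<bar>- (f' (u z) * \<phi> z)\<bar> \<le> L * \<bar>\<phi> z\<bar>" if "z \<in> {0..1}" for z
      using L(3)[OF that] by (simp add: abs_mult mult_right_mono)
  qed (use a_pos continuous L(1) x assms that \<open>\<psi> x = 0\<close> in auto)
  then show False using \<phi>_nontrivial by blast
qed

end

lemma eventually_nonzero_near:
  fixes g :: "real \<Rightarrow> real"
  assumes g: "(g has_real_derivative D) (at x within S)" and nz: "g x \<noteq> 0 \<or> D \<noteq> 0"
  shows "eventually (\<lambda>y. g y \<noteq> 0) (at x within S)"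
proof (cases "g x = 0")
  case False
  have "(g \<longlongrightarrow> g x) (at x within S)"
    using DERIV_continuous[OF g] by (simp add: continuous_within)
  then show ?thesis using False by (rule tendsto_imp_eventually_ne)
next
  case True
  have "((\<lambda>y. (g y - g x) / (y - x)) \<longlongrightarrow> D) (at x within S)"
    using g by (simp add: has_field_derivative_iff)
  from tendsto_imp_eventually_ne[OF this, of 0] nz True show ?thesis
    by (auto elim!: eventually_mono)
qed

context kernel_pair
begin

text \<open>Zeros of \<open>v\<close> and of \<open>\<phi>\<close> are simple: at a zero of
  \<open>v\<close> the derivative is \<open>- f (u x)\<close>, at a zero of \<open>\<phi>\<close> it
  is \<open>\<psi> x / a x\<close>, and neither vanishes there.\<close>

lemma nonzero_near:
  assumes x: "x \<in> {0..1}"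
  obtains \<delta> where "\<delta> > 0" "\<And>y. y \<in> {0..1} \<Longrightarrow> y \<noteq> x \<Longrightarrow> \<bar>y - x\<bar> < \<delta> \<Longrightarrow> \<phi> y \<noteq> 0 \<and> v y \<noteq> 0"
proof -
  have "eventually (\<lambda>y. v y \<noteq> 0) (at x within {0..1})"
    using critical_value_nonzero[OF x] by (intro eventually_nonzero_near[OF v_deriv[OF x]]) auto
  moreover have "eventually (\<lambda>y. \<phi> y \<noteq> 0) (at x within {0..1})"
    using kernel_zero_simple[OF x] a_pos[OF x] by (intro eventually_nonzero_near[OF \<phi>_deriv[OF x]]) auto
  ultimately have "eventually (\<lambda>y. \<phi> y \<noteq> 0 \<and> v y \<noteq> 0) (at x within {0..1})"
    by eventually_elim simp
  then obtain d where "d > 0" "\<forall>y\<in>{0..1}. y \<noteq> x \<and> dist y x < d \<longrightarrow> \<phi> y \<noteq> 0 \<and> v y \<noteq> 0"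
    unfolding eventually_at by blast
  then show ?thesis by (intro that[of d]) (auto simp: dist_real_def)
qed

text \<open>In the derivative of \<open>v\<^sup>2 / (2 a) + F(u)\<close> the terms with
  \<open>f\<close> cancel, leaving \<open>- a' v\<^sup>2 / (2 a\<^sup>2)\<close>. The inequality
  \<open>F (u x) \<le> E x\<close>, an equality at critical points, is what later compares the
  energies of two points on one level.\<close>

lemma energy:
  "\<exists>E F :: real \<Rightarrow> real. (\<forall>x\<in>{0..1}. F (u x) \<le> E x) \<and> (\<forall>x\<in>{0..1}. v x = 0 \<longrightarrow> E x = F (u x)) \<and>
     (\<forall>s t. 0 \<le> s \<and> s < t \<and> t \<le> 1 \<and> (\<forall>x\<in>{s<..<t}. 0 < a' x) \<longrightarrow> E t < E s) \<and>
     (\<forall>s t. 0 \<le> s \<and> s < t \<and> t \<le> 1 \<and> (\<forall>x\<in>{s<..<t}. a' x < 0) \<longrightarrow> E s < E t)"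
proof -
  have "\<exists>F. \<forall>x::real. -\<infinity> < ereal x \<longrightarrow> ereal x < \<infinity> \<longrightarrow> (F has_vector_derivative f x) (at x)"
    by (rule einterval_antiderivative) (auto intro: DERIV_isCont f_deriv)
  then obtain F where F: "\<And>x. (F has_real_derivative f x) (at x)"
    by (auto simp: has_real_derivative_iff_has_vector_derivative)
  define E where "E x = (v x)\<^sup>2 / (2 * a x) + F (u x)" for x
  define E' where "E' x = - a' x * (v x)\<^sup>2 / (2 * (a x)\<^sup>2)" for x
  have E: "(E has_real_derivative E' x) (at x within {0..1})" if x: "x \<in> {0..1}" for x
    unfolding E_def E'_def using a_pos[OF x]
    by (auto intro!: derivative_eq_intros v_deriv a_deriv x DERIV_chain2[OF F u_deriv[OF x]]
        simp: field_simps power2_eq_square)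
  \<comment> \<open>The sign \<open>\<sigma>\<close>, later \<open>1\<close> or \<open>-1\<close>,
    handles increasing and decreasing \<open>a\<close> together.\<close>
  have strict: "\<sigma> * E t < \<sigma> * E s"
    if st: "0 \<le> s" "s < t" "t \<le> 1" and \<sigma>: "\<And>x. x \<in> {s<..<t} \<Longrightarrow> 0 < \<sigma> * a' x" for s t \<sigma> :: real
  proof -
    have mono: "\<sigma> * E y \<le> \<sigma> * E x" if "s \<le> x" "x \<le> y" "y \<le> t" for x y
    proof -
      have "- (\<sigma> * E x) \<le> - (\<sigma> * E y)"
      proof (rule Icc_nonneg_derivative_mono[of s t "\<lambda>x. - (\<sigma> * E x)" "\<lambda>x. - (\<sigma> * E' x)"])
        fix x assume "x \<in> {s..t}"
        then have "(E has_real_derivative E' x) (at x within {s..t})"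
          using st by (intro DERIV_subset[OF E]) auto
        then show "((\<lambda>x. - (\<sigma> * E x)) has_real_derivative - (\<sigma> * E' x)) (at x within {s..t})"
          by (auto intro!: derivative_eq_intros)
      next
        fix x assume "x \<in> {s<..<t}"
        from \<sigma>[OF this] show "0 \<le> - (\<sigma> * E' x)"
          by (simp add: E'_def divide_simps mult.assoc[symmetric])
      qed (use that in auto)
      then show ?thesis by simp
    qed
    have s: "s \<in> {0..1}" using st by auto
    obtain \<delta> where \<delta>: "\<delta> > 0" "\<And>y. y \<in> {0..1} \<Longrightarrow> y \<noteq> s \<Longrightarrow> \<bar>y - s\<bar> < \<delta> \<Longrightarrow> \<phi> y \<noteq> 0 \<and> v y \<noteq> 0"
      using nonzero_near[OF s] by metis
    \<comment> \<open>A point close to \<open>s\<close> with \<open>v x \<noteq> 0\<close>. There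
      the derivative of the energy is nonzero, which makes the monotonicity strict.\<close>
    define x where "x = s + min \<delta> (t - s) / 2"
    have x: "s < x" "x < t" "\<bar>x - s\<bar> < \<delta>"
      using st \<delta>(1) by (auto simp: x_def min_def field_simps)
    then have "v x \<noteq> 0" using \<delta>(2)[of x] st by auto
    then have neg: "\<sigma> * E' x < 0"
      using \<sigma>[of x] x a_pos[of x] st by (simp add: E'_def divide_simps mult.assoc[symmetric])
    have "((\<lambda>x. \<sigma> * E x) has_real_derivative \<sigma> * E' x) (at x)"
      using E[of x] x st by (auto intro!: derivative_eq_intros simp: at_within_Icc_at)
    from DERIV_neg_dec_right[OF this neg] obtain d
      where d: "d > 0" "\<And>h. h > 0 \<Longrightarrow> h < d \<Longrightarrow> \<sigma> * E (x + h) < \<sigma> * E x" by blast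
    define h where "h = min d (t - x) / 2"
    have h: "h > 0" "h < d" "x + h \<le> t" using d(1) x by (auto simp: h_def min_def field_simps)
    have "\<sigma> * E t \<le> \<sigma> * E (x + h)" using h x by (intro mono) auto
    also have "\<dots> < \<sigma> * E x" by (rule d(2)[OF h(1,2)])
    also have "\<dots> \<le> \<sigma> * E s" using x by (intro mono) auto
    finally show ?thesis .
  qed
  show ?thesis
  proof (rule exI[of _ E], rule exI[of _ F], intro conjI)
    show "\<forall>x\<in>{0..1}. F (u x) \<le> E x"
      using a_pos by (auto simp: E_def less_imp_le)
    show "\<forall>x\<in>{0..1}. v x = 0 \<longrightarrow> E x = F (u x)"
      by (simp add: E_def)
    show "\<forall>s t. 0 \<le> s \<and> s < t \<and> t \<le> 1 \<and> (\<forall>x\<in>{s<..<t}. 0 < a' x) \<longrightarrow> E t < E s"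
      using strict[of _ _ 1] by simp
    show "\<forall>s t. 0 \<le> s \<and> s < t \<and> t \<le> 1 \<and> (\<forall>x\<in>{s<..<t}. a' x < 0) \<longrightarrow> E s < E t"
      using strict[of _ _ "-1"] by simp
  qed
qed

text \<open>Since \<open>\<psi> \<alpha> = 0\<close>, \<open>\<phi>\<close> is nonzero at
  \<open>\<alpha>\<close> and keeps its sign nearby. If the level recurs nowhere, a thin enough
  window about it is confined to that neighbourhood, and \<open>\<phi>\<close> cannot have mean zero
  over it. A general \<open>\<alpha>\<close> is allowed, because an interior point with vanishing
  fluxes will serve as an end point.\<close>

lemma no_isolated_endpoint_level:
  assumes ab: "0 \<le> \<alpha>" "\<alpha> < \<beta>" "\<beta> \<le> 1" and crit: "v \<alpha> = 0" "\<psi> \<alpha> = 0"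
    and ne: "\<And>x. x \<in> {\<alpha><..\<beta>} \<Longrightarrow> u x \<noteq> u \<alpha>"
    and int: "\<And>r. 0 < r \<Longrightarrow> r < \<bar>u \<alpha>\<bar> \<Longrightarrow> r < 1 \<Longrightarrow>
      ((\<lambda>x. if \<bar>u x - u \<alpha>\<bar> < r then \<phi> x else 0) has_integral 0) {\<alpha>..\<beta>}"
  shows False
proof -
  have \<alpha>: "\<alpha> \<in> {0..1}" using ab by auto
  have u\<alpha>: "u \<alpha> \<noteq> 0" using critical_value_nonzero[OF \<alpha>] crit by auto
  have \<phi>\<alpha>: "\<phi> \<alpha> \<noteq> 0" using kernel_zero_simple[OF \<alpha>] crit by auto
  define m where "m = \<bar>\<phi> \<alpha>\<bar> / 2"
  have m: "m > 0" using \<phi>\<alpha> by (simp add: m_def)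
  have cont: "continuous_on {\<alpha>..\<beta>} \<phi>" "continuous_on {\<alpha>..\<beta>} u"
    by (rule continuous_on_subset[OF continuous(4)], use ab in force)
       (rule continuous_on_subset[OF continuous(2)], use ab in force)
  obtain \<delta>0 where \<delta>0: "\<delta>0 > 0" "\<And>x. x \<in> {\<alpha>..\<beta>} \<Longrightarrow> \<bar>x - \<alpha>\<bar> < \<delta>0 \<Longrightarrow> \<bar>\<phi> x - \<phi> \<alpha>\<bar> < m"
    using cont(1)[unfolded continuous_on_iff, rule_format, of \<alpha> m] ab m by (auto simp: dist_real_def)
  define \<delta> where "\<delta> = min \<delta>0 (\<beta> - \<alpha>) / 2"
  have \<delta>: "\<delta> > 0" "\<delta> < \<delta>0" "\<alpha> + \<delta> \<le> \<beta>" using \<delta>0 ab by (auto simp: \<delta>_def min_def field_simps)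
  have sgn: "m \<le> sgn (\<phi> \<alpha>) * \<phi> x" if "x \<in> {\<alpha>..\<alpha>+\<delta>}" for x
  proof -
    have "\<bar>\<phi> x - \<phi> \<alpha>\<bar> < m" using that \<delta> by (intro \<delta>0) auto
    then show ?thesis by (auto simp: m_def sgn_if abs_if split: if_splits)
  qed
  have "\<exists>y\<in>{\<alpha>+\<delta>..\<beta>}. \<forall>x\<in>{\<alpha>+\<delta>..\<beta>}. \<bar>u y - u \<alpha>\<bar> \<le> \<bar>u x - u \<alpha>\<bar>"
    using \<delta> by (intro continuous_attains_inf continuous_intros continuous_on_subset[OF cont(2)]) auto
  then obtain y where y: "y \<in> {\<alpha>+\<delta>..\<beta>}" "\<And>x. x \<in> {\<alpha>+\<delta>..\<beta>} \<Longrightarrow> \<bar>u y - u \<alpha>\<bar> \<le> \<bar>u x - u \<alpha>\<bar>"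
    by blast
  \<comment> \<open>The distance from the level kept by \<open>u\<close> beyond
    \<open>\<alpha> + \<delta>\<close>, capped by the bounds for admissible radii. The radius
    \<open>r\<close> is half of it.\<close>
  define q where "q = min \<bar>u y - u \<alpha>\<bar> (min \<bar>u \<alpha>\<bar> 1)"
  define r where "r = q / 2"
  have "u y \<noteq> u \<alpha>" using y(1) \<delta> by (intro ne) auto
  then have q: "0 < q" "q \<le> \<bar>u y - u \<alpha>\<bar>" "q \<le> \<bar>u \<alpha>\<bar>" "q \<le> 1"
    using u\<alpha> by (auto simp: q_def)
  then have r: "0 < r" "r < \<bar>u y - u \<alpha>\<bar>" "r < \<bar>u \<alpha>\<bar>" "r < 1"
    using u\<alpha> q by (auto simp: r_def)
  obtain \<eta>0 where \<eta>0: "\<eta>0 > 0" "\<And>x. x \<in> {\<alpha>..\<beta>} \<Longrightarrow> \<bar>x - \<alpha>\<bar> < \<eta>0 \<Longrightarrow> \<bar>u x - u \<alpha>\<bar> < r"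
    using cont(2)[unfolded continuous_on_iff, rule_format, of \<alpha> r] ab r by (auto simp: dist_real_def)
  define \<eta> where "\<eta> = min \<eta>0 \<delta> / 2"
  have \<eta>: "\<eta> > 0" "\<eta> < \<eta>0" "\<eta> \<le> \<delta>" using \<eta>0 \<delta> by (auto simp: \<eta>_def min_def)
  let ?g = "\<lambda>x. if \<bar>u x - u \<alpha>\<bar> < r then \<phi> x else 0"
  have 1: "((\<lambda>x. sgn (\<phi> \<alpha>) * ?g x) has_integral sgn (\<phi> \<alpha>) * 0) {\<alpha>..\<beta>}"
    by (intro has_integral_mult_right int r)
  have "((\<lambda>_. m) has_integral m * \<eta>) {\<alpha>..\<alpha>+\<eta>}"
    using has_integral_const_real[of m \<alpha> "\<alpha>+\<eta>"] \<eta> by (simp add: mult.commute)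
  then have 2: "((\<lambda>x. if x \<in> {\<alpha>..\<alpha>+\<eta>} then m else 0) has_integral m * \<eta>) {\<alpha>..\<beta>}"
    using \<eta> \<delta> by (subst has_integral_restrict) auto
  \<comment> \<open>After multiplication by the sign of \<open>\<phi> \<alpha>\<close> the integrand
    is at least \<open>m\<close> on an interval of length \<open>\<eta>\<close> and nonnegative
    elsewhere.\<close>
  have "m * \<eta> \<le> sgn (\<phi> \<alpha>) * 0"
  proof (rule has_integral_le[OF 2 1])
    fix x assume x: "x \<in> {\<alpha>..\<beta>}"
    show "(if x \<in> {\<alpha>..\<alpha>+\<eta>} then m else 0) \<le> sgn (\<phi> \<alpha>) * ?g x"
    proof (cases "x \<in> {\<alpha>..\<alpha>+\<eta>}")
      case True
      then have "\<bar>u x - u \<alpha>\<bar> < r" using \<eta> x by (intro \<eta>0) auto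
      then show ?thesis using True sgn[of x] \<eta> by auto
    next
      case False
      show ?thesis
      proof (cases "\<bar>u x - u \<alpha>\<bar> < r")
        case True
        then have "x < \<alpha> + \<delta>" using y(2)[of x] r x by force
        then show ?thesis using sgn[of x] x False m by auto
      qed (use False in auto)
    qed
  qed
  then show False using m \<eta> by (simp add: mult_le_0_iff)
qed

end

section \<open>The affine map between two branches of equal level\<close>

lemma constant_eq_limit:
  fixes h :: "real \<Rightarrow> real"
  assumes d: "\<And>y. y \<in> {l<..<r} \<Longrightarrow> (h has_real_derivative 0) (at y)"
    and F: "F \<noteq> bot" "eventually (\<lambda>y. y \<in> {l<..<r}) F" and lim: "(h \<longlongrightarrow> c) F"
    and y: "y \<in> {l<..<r}"
  shows "h y = c"
proof -
  have "h x = h y" if "x \<in> {l<..<r}" for x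
    using DERIV_isconst3[of l r x y h] d that y by auto
  then have "eventually (\<lambda>x. h x = h y) F"
    using F(2) by (auto elim: eventually_mono)
  then have "(h \<longlongrightarrow> h y) F" by (rule tendsto_eventually)
  then show ?thesis using tendsto_unique[OF F(1) _ lim] by blast
qed

context kernel_pair
begin

text \<open>The hypotheses on \<open>F\<close> stand for the approach to a common peak, which lies
  outside the open interval. There the fluxes of \<open>u\<close> vanish and those of
  \<open>\<phi>\<close> agree, so the two constants of integration are zero. Opposite signs of the
  fluxes of \<open>u\<close> make \<open>Z'\<close> negative, whence the form
  \<open>- \<kappa>\<close>.\<close>

lemma two_branches:
  assumes Z: "\<And>y. y \<in> {l<..<r} \<Longrightarrow> (Z has_real_derivative Z' y) (at y)"
    and in01: "\<And>y. y \<in> {l<..<r} \<Longrightarrow> y \<in> {0<..<1} \<and> Z y \<in> {0<..<1}"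
    and uZ: "\<And>y. y \<in> {l<..<r} \<Longrightarrow> u (Z y) = u y"
    and nz: "\<And>y. y \<in> {l<..<r} \<Longrightarrow> v y * v (Z y) < 0 \<and> \<phi> y \<noteq> 0"
    and \<Phi>: "\<And>x. x \<in> {0..1} \<Longrightarrow> (\<Phi> has_real_derivative \<phi> x) (at x within {0..1})"
    and \<Phi>Z: "\<And>y. y \<in> {l<..<r} \<Longrightarrow> \<Phi> (Z y) - \<Phi> y = k"
    and F: "F \<noteq> bot" "eventually (\<lambda>y. y \<in> {l<..<r}) F"
    and lim: "((\<lambda>y. \<psi> (Z y) - \<psi> y) \<longlongrightarrow> 0) F" "((\<lambda>y. v (Z y) * \<phi> (Z y) - v y * \<phi> y) \<longlongrightarrow> 0) F"
    and lr: "l < r"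
  obtains \<kappa> where "\<kappa> > 0"
    "\<And>y. y \<in> {l<..<r} \<Longrightarrow> a (Z y) = \<kappa>\<^sup>2 * a y \<and> (Z has_real_derivative - \<kappa>) (at y) \<and> \<phi> (Z y) * (- \<kappa>) = \<phi> y"
proof -
  define I where "I = {l<..<r}"
  have at: "(g has_real_derivative D) (at x)"
    if "(g has_real_derivative D) (at x within {0..1})" "x \<in> {0<..<1}" for g D x
    using that by (simp add: at_within_Icc_at)
  have d: "(g has_real_derivative D y) (at y)" and chain: "((\<lambda>y. g (Z y)) has_real_derivative D (Z y) * Z' y) (at y)"
    if y: "y \<in> I" and g: "\<And>x. x \<in> {0..1} \<Longrightarrow> (g has_real_derivative D x) (at x within {0..1})" for g D y
  proof -
    have y': "y \<in> {0<..<1}" "Z y \<in> {0<..<1}" "(Z has_real_derivative Z' y) (at y)"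
      using in01[of y] Z[of y] y unfolding I_def by auto
    show "(g has_real_derivative D y) (at y)" using y'(1) by (intro at g) auto
    have "(g has_real_derivative D (Z y)) (at (Z y))" using y'(2) by (intro at g) auto
    from DERIV_chain2[OF this y'(3)]
    show "((\<lambda>y. g (Z y)) has_real_derivative D (Z y) * Z' y) (at y)" .
  qed
  have const0: "(h has_real_derivative 0) (at y)" if "\<And>x. x \<in> I \<Longrightarrow> h x = c" "y \<in> I" for h c y
    by (rule has_field_derivative_transform_within_open[OF DERIV_const[of c] _ that(2)])
      (use that in \<open>auto simp: I_def\<close>)
  have eq1: "\<phi> (Z y) * Z' y = \<phi> y" if y: "y \<in> I" for y
  proof -
    have "((\<lambda>y. \<Phi> (Z y) - \<Phi> y) has_real_derivative \<phi> (Z y) * Z' y - \<phi> y) (at y)"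
      by (intro DERIV_diff chain[OF y] d[OF y] \<Phi>)
    moreover have "((\<lambda>y. \<Phi> (Z y) - \<Phi> y) has_real_derivative 0) (at y)"
      using \<Phi>Z by (intro const0[OF _ y]) (auto simp: I_def)
    ultimately show ?thesis using DERIV_unique by fastforce
  qed
  have eq2: "v (Z y) / a (Z y) * Z' y = v y / a y" if y: "y \<in> I" for y
  proof -
    have "((\<lambda>y. u (Z y) - u y) has_real_derivative v (Z y) / a (Z y) * Z' y - v y / a y) (at y)"
      by (intro DERIV_diff chain[OF y] d[OF y] u_deriv)
    moreover have "((\<lambda>y. u (Z y) - u y) has_real_derivative 0) (at y)"
      using uZ by (intro const0[OF _ y]) (auto simp: I_def)
    ultimately show ?thesis using DERIV_unique by fastforce
  qed
  \<comment> \<open>The derivative is \<open>f' (u y)\<close> times the defect of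
    \<open>eq1\<close>, because both branches see the same value of \<open>u\<close>.\<close>
  have eq3: "\<psi> (Z y) - \<psi> y = 0" if y: "y \<in> I" for y
  proof (rule constant_eq_limit[OF _ F lim(1) y[unfolded I_def]])
    fix y assume "y \<in> {l<..<r}" then have y: "y \<in> I" by (simp add: I_def)
    have "((\<lambda>y. \<psi> (Z y) - \<psi> y) has_real_derivative
        - (f' (u (Z y)) * \<phi> (Z y)) * Z' y - - (f' (u y) * \<phi> y)) (at y)"
      by (intro DERIV_diff chain[OF y] d[OF y] \<psi>_deriv)
    moreover have "- (f' (u (Z y)) * \<phi> (Z y)) * Z' y - - (f' (u y) * \<phi> y) = f' (u y) * (\<phi> y - \<phi> (Z y) * Z' y)"
      using uZ y by (simp add: I_def algebra_simps)
    ultimately show "((\<lambda>y. \<psi> (Z y) - \<psi> y) has_real_derivative 0) (at y)"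
      using eq1[OF y] by simp
  qed
  \<comment> \<open>With \<open>eq3\<close>, the derivative splits into multiples of the defects of
    \<open>eq1\<close> and \<open>eq2\<close>.\<close>
  have eq4: "v (Z y) * \<phi> (Z y) - v y * \<phi> y = 0" if y: "y \<in> I" for y
  proof (rule constant_eq_limit[OF _ F lim(2) y[unfolded I_def]])
    fix y assume "y \<in> {l<..<r}" then have y: "y \<in> I" by (simp add: I_def)
    have "((\<lambda>x. v x * \<phi> x) has_real_derivative - f (u x) * \<phi> x + v x * (\<psi> x / a x)) (at x within {0..1})"
      if "x \<in> {0..1}" for x
      by (auto intro!: derivative_eq_intros v_deriv \<phi>_deriv that)
    note D = this
    have "((\<lambda>y. v (Z y) * \<phi> (Z y) - v y * \<phi> y) has_real_derivative
        (- f (u (Z y)) * \<phi> (Z y) + v (Z y) * (\<psi> (Z y) / a (Z y))) * Z' y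
          - (- f (u y) * \<phi> y + v y * (\<psi> y / a y))) (at y)"
      by (intro DERIV_diff chain[OF y] d[OF y] D)
    moreover have "(- f (u (Z y)) * \<phi> (Z y) + v (Z y) * (\<psi> (Z y) / a (Z y))) * Z' y
          - (- f (u y) * \<phi> y + v y * (\<psi> y / a y))
        = - f (u y) * (\<phi> (Z y) * Z' y - \<phi> y) + \<psi> y * (v (Z y) / a (Z y) * Z' y - v y / a y)"
      using uZ y eq3[OF y] by (simp add: I_def algebra_simps)
    ultimately show "((\<lambda>y. v (Z y) * \<phi> (Z y) - v y * \<phi> y) has_real_derivative 0) (at y)"
      using eq1[OF y] eq2[OF y] by simp
  qed
  have nz': "v y \<noteq> 0" "v (Z y) \<noteq> 0" "\<phi> y \<noteq> 0" "v y * v (Z y) < 0" if "y \<in> I" for y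
    using nz[of y] that by (auto simp: I_def)
  have eq5: "v (Z y) = v y * Z' y" if y: "y \<in> I" for y
  proof -
    have "v (Z y) * \<phi> y = v (Z y) * \<phi> (Z y) * Z' y" using eq1[OF y] by (simp add: mult.assoc)
    also have "\<dots> = v y * Z' y * \<phi> y" using eq4[OF y] by (simp add: algebra_simps)
    finally show ?thesis using nz'[OF y] by simp
  qed
  have pos: "a y > 0" "a (Z y) > 0" if "y \<in> I" for y
    using in01[of y] that by (auto simp: I_def intro!: a_pos)
  have eq6: "a (Z y) = (Z' y)\<^sup>2 * a y" if y: "y \<in> I" for y
    using eq2[OF y] eq5[OF y] nz'[OF y] pos[OF y] by (simp add: field_simps power2_eq_square)
  define q where "q y = v (Z y) / v y" for y
  have qZ: "q y = Z' y" if "y \<in> I" for y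
    using eq5[OF that] nz'[OF that] by (simp add: q_def)
  \<comment> \<open>The numerator in the quotient rule is
    \<open>- f (u y) * (Z' y * v y - v (Z y))\<close>, which vanishes by \<open>eq5\<close>. As
    \<open>q = Z'\<close>, the slope of \<open>Z\<close> is constant.\<close>
  have dq: "(q has_real_derivative 0) (at y)" if y: "y \<in> I" for y
  proof -
    have "((\<lambda>y. v (Z y)) has_real_derivative - f (u (Z y)) * Z' y) (at y)"
      by (intro chain[OF y] v_deriv)
    moreover have "(v has_real_derivative - f (u y)) (at y)" by (intro d[OF y] v_deriv)
    ultimately have "(q has_real_derivative (- f (u (Z y)) * Z' y * v y - v (Z y) * - f (u y)) / (v y * v y)) (at y)"
      unfolding q_def using nz'[OF y] by (intro DERIV_divide)
    moreover have "- f (u (Z y)) * Z' y * v y - v (Z y) * - f (u y) = 0"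
      using uZ[of y] y eq5[OF y] by (simp add: I_def)
    ultimately show ?thesis by simp
  qed
  obtain y0 where y0: "y0 \<in> I" using lr dense unfolding I_def by force
  have const: "Z' y = Z' y0" if "y \<in> I" for y
    using DERIV_isconst3[of l r y y0 q] dq that y0 lr qZ unfolding I_def by auto
  have "Z' y0 < 0"
    using eq5[OF y0] nz'[OF y0] by (simp add: mult.assoc[symmetric] mult_less_0_iff)
  show ?thesis
  proof (rule that[of "- Z' y0"])
    show "- Z' y0 > 0" using \<open>Z' y0 < 0\<close> by simp
    fix y assume y: "y \<in> {l<..<r}"
    then have "y \<in> I" by (simp add: I_def)
    then show "a (Z y) = (- Z' y0)\<^sup>2 * a y \<and> (Z has_real_derivative - (- Z' y0)) (at y) \<and> \<phi> (Z y) * (- (- Z' y0)) = \<phi> y"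
      using eq6 const eq1 Z[OF y] by simp
  qed
qed

text \<open>The matching map is the inverse of \<open>u\<close> on the \<open>z\<close>-branch
  composed with \<open>u\<close> on the \<open>y\<close>-branch. The peaks may be either end of
  their intervals and need not coincide, which covers an interior maximum, where both branches share
  the peak, as well as two maxima at \<open>0\<close> and \<open>1\<close>.\<close>

lemma matched_branches:
  assumes yint: "0 \<le> yl" "yl < yr" "yr \<le> 1" and zint: "0 \<le> zl" "zl < zr" "zr \<le> 1"
    and peak: "yp \<in> {yl, yr}" "zp \<in> {zl, zr}" "u yp = C" "u zp = C"
    and crit: "v yp = 0" "v zp = 0" "\<psi> yp = \<psi> zp"
    and below: "\<And>y. y \<in> {yl<..<yr} \<Longrightarrow> u y < C \<and> \<phi> y \<noteq> 0" "\<And>z. z \<in> {zl<..<zr} \<Longrightarrow> u z < C"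
    and opp: "\<And>y z. y \<in> {yl<..<yr} \<Longrightarrow> z \<in> {zl<..<zr} \<Longrightarrow> v y * v z < 0"
    and \<Phi>: "\<And>x. x \<in> {0..1} \<Longrightarrow> (\<Phi> has_real_derivative \<phi> x) (at x within {0..1})"
    and r0: "r0 > 0"
    and level: "\<And>y z. y \<in> {yl<..<yr} \<Longrightarrow> z \<in> {zl<..<zr} \<Longrightarrow> u z = u y \<Longrightarrow> C - r0 < u y \<Longrightarrow> \<Phi> z - \<Phi> y = k"
  obtains \<kappa> \<epsilon> where "\<kappa> > 0" "\<epsilon> > 0"
    "\<And>y. y \<in> {yl<..<yr} \<Longrightarrow> \<bar>y - yp\<bar> < \<epsilon> \<Longrightarrow> zp - \<kappa> * (y - yp) \<in> {zl<..<zr} \<and>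
       a (zp - \<kappa> * (y - yp)) = \<kappa>\<^sup>2 * a y \<and> \<phi> (zp - \<kappa> * (y - yp)) * (- \<kappa>) = \<phi> y"
proof -
  have cz: "continuous_on {zl..zr} u" and cy: "continuous_on {yl..yr} u"
    using yint zint by (auto intro!: continuous_on_subset[OF continuous(2)])
  have vz: "v z \<noteq> 0" if "z \<in> {zl<..<zr}" for z
    using opp[of "(yl+yr)/2" z] that yint by auto
  have du: "(u has_real_derivative v x / a x) (at x)" if "x \<in> {0<..<1}" for x
    using u_deriv[of x] that by (simp add: at_within_Icc_at)
  have inj: "inj_on u {zl..zr}"
  proof (rule linorder_inj_onI')
    fix x y assume xy: "x \<in> {zl..zr}" "y \<in> {zl..zr}" "x < y"
    show "u x \<noteq> u y"
    proof
      assume eq: "u x = u y"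
      have "\<exists>z. x < z \<and> z < y \<and> (\<exists>l. l = 0 \<and> (u has_real_derivative l) (at z))"
      proof -
        have "\<exists>z>x. z < y \<and> (\<lambda>h. v z / a z * h) = (\<lambda>v. 0)"
        proof (rule Rolle_deriv[OF xy(3) eq continuous_on_subset[OF cz]])
          fix z assume z: "x < z" "z < y"
          then have "z \<in> {0<..<1}" using xy zint by auto
          from du[OF this] show "(u has_derivative (\<lambda>h. v z / a z * h)) (at z)"
            unfolding has_field_derivative_def .
        qed (use xy in auto)
        then obtain z where z: "x < z" "z < y" "(\<lambda>h. v z / a z * h) = (\<lambda>v. 0)" by blast
        then have "v z / a z = 0" by (metis mult.right_neutral)
        then have "(u has_real_derivative 0) (at z)" using du[of z] z xy zint by auto
        then show ?thesis using z by blast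
      qed
      then obtain z where z: "x < z" "z < y" "(u has_real_derivative 0) (at z)" by blast
      then have z': "z \<in> {zl<..<zr}" "z \<in> {0<..<1}" using xy zint by auto
      have "v z / a z = 0" using DERIV_unique[OF z(3) du[OF z'(2)]] by simp
      then show False using vz[OF z'(1)] a_pos[of z] z' by auto
    qed
  qed
  \<comment> \<open>The inverse is taken on the closed branch. Compactness then makes it continuous
    up to the peak, which yields the limit of \<open>Z\<close> there.\<close>
  define g where "g = the_inv_into {zl..zr} u"
  have gu: "g (u z) = z" if "z \<in> {zl..zr}" for z
    unfolding g_def by (rule the_inv_into_f_f[OF inj that])
  have cg: "continuous_on (u ` {zl..zr}) g"
    by (rule continuous_on_inv[OF cz]) (use gu in auto)
  define z1 where "z1 = (zl + zr) / 2"
  have z1: "z1 \<in> {zl<..<zr}" using zint by (auto simp: z1_def)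
  \<comment> \<open>Levels between \<open>c1\<close> and \<open>C\<close> are attained on the
    \<open>z\<close>-branch, by the intermediate value theorem between \<open>z1\<close> and the
    peak, and lie in the range in which \<open>level\<close> applies.\<close>
  define c1 where "c1 = max (u z1) (C - r0)"
  have c1: "c1 < C" "u z1 \<le> c1" "C - r0 \<le> c1" using below(2)[OF z1] r0 by (auto simp: c1_def)
  have pre: "\<exists>z\<in>{zl<..<zr}. u z = c" if c: "c1 < c" "c < C" for c
  proof (cases "zp = zr")
    case True
    have "\<exists>x\<ge>z1. x \<le> zr \<and> u x = c"
      by (rule IVT') (use c c1 True peak z1 continuous_on_subset[OF cz] in auto)
    then obtain x where x: "z1 \<le> x" "x \<le> zr" "u x = c" by blast
    then have "x \<noteq> zr" using c peak True by auto
    then show ?thesis using x z1 by (intro bexI[of _ x]) auto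
  next
    case False
    then have zp: "zp = zl" using peak by auto
    have "\<exists>x\<ge>zl. x \<le> z1 \<and> u x = c"
      by (rule IVT2') (use c c1 zp peak z1 continuous_on_subset[OF cz] in auto)
    then obtain x where x: "zl \<le> x" "x \<le> z1" "u x = c" by blast
    then have "x \<noteq> zl" using c peak zp by auto
    then show ?thesis using x z1 by (intro bexI[of _ x]) auto
  qed
  have g: "g c \<in> {zl<..<zr}" "u (g c) = c" if c: "c1 < c" "c < C" for c
    using pre[OF c] gu by auto
  have sub: "{c1<..<C} \<subseteq> u ` {zl..zr}"
  proof
    fix c assume "c \<in> {c1<..<C}"
    then obtain z where "z \<in> {zl<..<zr}" "u z = c" using pre[of c] by auto
    then show "c \<in> u ` {zl..zr}" by force
  qed
  have icg: "isCont g c" if "c1 < c" "c < C" for c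
    using continuous_on_subset[OF cg sub] that by (simp add: continuous_on_eq_continuous_at)
  have dg: "(g has_real_derivative inverse (v (g c) / a (g c))) (at c)" if c: "c1 < c" "c < C" for c
  proof (rule DERIV_inverse_function[OF _ _ c])
    have gc: "g c \<in> {0<..<1}" using g(1)[OF c] zint by auto
    show "(u has_real_derivative v (g c) / a (g c)) (at (g c))" by (rule du[OF gc])
    show "v (g c) / a (g c) \<noteq> 0" using vz[OF g(1)[OF c]] a_pos[of "g c"] gc by auto
  qed (use g icg c in auto)
  have ypin: "yp \<in> {yl..yr}" and zpin: "zp \<in> {zl..zr}" using peak yint zint by auto
  obtain \<epsilon> where \<epsilon>: "\<epsilon> > 0" "\<And>y. y \<in> {yl..yr} \<Longrightarrow> \<bar>y - yp\<bar> < \<epsilon> \<Longrightarrow> \<bar>u y - C\<bar> < C - c1"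
    using cy[unfolded continuous_on_iff, rule_format, OF ypin, of "C - c1"] c1 peak
    by (auto simp: dist_real_def)
  define l where "l = max yl (yp - \<epsilon>)"
  define r where "r = min yr (yp + \<epsilon>)"
  have lr: "l < r" using peak yint \<epsilon>(1) by (auto simp: l_def r_def)
  have yI: "y \<in> {yl<..<yr}" "\<bar>y - yp\<bar> < \<epsilon>" "c1 < u y" "u y < C" "y \<in> {0<..<1}" if "y \<in> {l<..<r}" for y
  proof -
    show 1: "y \<in> {yl<..<yr}" "\<bar>y - yp\<bar> < \<epsilon>" using that by (auto simp: l_def r_def)
    show "c1 < u y" using \<epsilon>(2)[of y] 1 by auto
    show "u y < C" using below(1) 1 by blast
    show "y \<in> {0<..<1}" using 1 yint by auto
  qed
  define Z where "Z y = g (u y)" for y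
  \<comment> \<open>The one-sided approach to the peak, which is an end point of the interval
    \<open>{l<..<r}\<close>.\<close>
  define F where "F = at yp within {l<..<r}"
  have F: "F \<noteq> bot"
  proof -
    have "yp islimpt {l<..<r}"
    proof (cases "yp = yl")
      case True
      then have "l = yp" using \<epsilon>(1) by (simp add: l_def)
      then show ?thesis using islimpt_greaterThanLessThan1[OF lr] by simp
    next
      case False
      then have "r = yp" using \<epsilon>(1) peak by (simp add: r_def)
      then show ?thesis using islimpt_greaterThanLessThan2[OF lr] by simp
    qed
    then show ?thesis by (simp add: F_def trivial_limit_within)
  qed
  have evF: "eventually (\<lambda>y. y \<in> {l<..<r}) F"
    by (simp add: F_def eventually_at_filter)
  have lim_id: "((\<lambda>y. y) \<longlongrightarrow> yp) F" by (simp add: F_def tendsto_ident_at)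
  have ev01: "eventually (\<lambda>y. y \<in> {0..1}) F"
    using evF by eventually_elim (use yI(5) in force)
  have lim01: "((\<lambda>y. h y) \<longlongrightarrow> h yp) F" if "continuous_on {0..1} h" for h :: "real \<Rightarrow> real"
    by (rule continuous_on_tendsto_compose[OF that lim_id _ ev01]) (use ypin yint in auto)
  have limZ: "(Z \<longlongrightarrow> zp) F"
  proof -
    have "((\<lambda>y. g (u y)) \<longlongrightarrow> g (u yp)) F"
    proof (rule continuous_on_tendsto_compose[OF cg lim01[OF continuous(2)]])
      show "u yp \<in> u ` {zl..zr}" using peak zpin by (metis imageI)
      show "eventually (\<lambda>y. u y \<in> u ` {zl..zr}) F"
        using evF by eventually_elim (use sub yI in auto)
    qed
    moreover have "g (u yp) = zp" using gu[OF zpin] peak by simp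
    ultimately show ?thesis by (simp add: Z_def[abs_def])
  qed
  have evZ: "eventually (\<lambda>y. Z y \<in> {0..1}) F"
    using evF
  proof eventually_elim
    case (elim y)
    then have "Z y \<in> {zl<..<zr}" unfolding Z_def using yI by (intro g) auto
    then show ?case using zint by auto
  qed
  have limZ01: "((\<lambda>y. h (Z y)) \<longlongrightarrow> h zp) F" if "continuous_on {0..1} h" for h :: "real \<Rightarrow> real"
    by (rule continuous_on_tendsto_compose[OF that limZ _ evZ]) (use zpin zint in auto)
  have Zin: "Z y \<in> {zl<..<zr}" "u (Z y) = u y" if "y \<in> {l<..<r}" for y
    unfolding Z_def using yI[OF that] g by auto
  obtain \<kappa> where \<kappa>: "\<kappa> > 0"
    "\<And>y. y \<in> {l<..<r} \<Longrightarrow> a (Z y) = \<kappa>\<^sup>2 * a y \<and> (Z has_real_derivative - \<kappa>) (at y) \<and> \<phi> (Z y) * (- \<kappa>) = \<phi> y"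
  proof (rule two_branches[where Z = Z and F = F and l = l and r = r and \<Phi> = \<Phi> and k = k
      and Z' = "\<lambda>y. inverse (v (g (u y)) / a (g (u y))) * (v y / a y)"])
    fix y assume y: "y \<in> {l<..<r}"
    show "(Z has_real_derivative inverse (v (g (u y)) / a (g (u y))) * (v y / a y)) (at y)"
      unfolding Z_def[abs_def] using yI[OF y] by (intro DERIV_chain2[OF dg] du) auto
    show "y \<in> {0<..<1} \<and> Z y \<in> {0<..<1}" using yI[OF y] Zin[OF y] zint by auto
    show "u (Z y) = u y" by (rule Zin[OF y])
    show "v y * v (Z y) < 0 \<and> \<phi> y \<noteq> 0" using opp below yI[OF y] Zin[OF y] by blast
    show "\<Phi> (Z y) - \<Phi> y = k" using yI[OF y] Zin[OF y] c1 by (intro level) auto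
  next
    show "((\<lambda>y. \<psi> (Z y) - \<psi> y) \<longlongrightarrow> 0) F"
      using tendsto_diff[OF limZ01[OF continuous(5)] lim01[OF continuous(5)]] crit by simp
    show "((\<lambda>y. v (Z y) * \<phi> (Z y) - v y * \<phi> y) \<longlongrightarrow> 0) F"
      using tendsto_diff[OF tendsto_mult[OF limZ01[OF continuous(3)] limZ01[OF continuous(4)]]
          tendsto_mult[OF lim01[OF continuous(3)] lim01[OF continuous(4)]]] crit by simp
  qed (use \<Phi> F evF lr in auto)
  \<comment> \<open>A map of constant slope \<open>- \<kappa>\<close> that tends to
    \<open>zp\<close> at \<open>yp\<close>.\<close>
  have Zeq: "Z y = zp - \<kappa> * (y - yp)" if y: "y \<in> {l<..<r}" for y
  proof -
    have "Z y + \<kappa> * y = zp + \<kappa> * yp"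
    proof (rule constant_eq_limit[OF _ F evF _ y])
      show "((\<lambda>y. Z y + \<kappa> * y) has_real_derivative 0) (at y)" if "y \<in> {l<..<r}" for y
        using \<kappa>(2)[OF that] by (auto intro!: derivative_eq_intros)
      show "((\<lambda>y. Z y + \<kappa> * y) \<longlongrightarrow> zp + \<kappa> * yp) F"
        by (intro tendsto_intros limZ lim_id)
    qed
    then show ?thesis by (simp add: algebra_simps)
  qed
  show ?thesis
  proof (rule that[OF \<kappa>(1) \<epsilon>(1)])
    fix y assume y: "y \<in> {yl<..<yr}" "\<bar>y - yp\<bar> < \<epsilon>"
    then have y': "y \<in> {l<..<r}" by (auto simp: l_def r_def)
    show "zp - \<kappa> * (y - yp) \<in> {zl<..<zr} \<and>
       a (zp - \<kappa> * (y - yp)) = \<kappa>\<^sup>2 * a y \<and> \<phi> (zp - \<kappa> * (y - yp)) * (- \<kappa>) = \<phi> y"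
      using \<kappa>(2)[OF y'] Zin[OF y'] Zeq[OF y'] by simp
  qed
qed

end

section \<open>Extremal levels attained at one interior point or at both end points\<close>

context kernel_pair
begin

lemma antiderivative:
  obtains \<Phi> where "\<And>x. x \<in> {0..1} \<Longrightarrow> (\<Phi> has_real_derivative \<phi> x) (at x within {0..1})"
    "\<And>x y. 0 \<le> x \<Longrightarrow> x \<le> y \<Longrightarrow> y \<le> 1 \<Longrightarrow> (\<phi> has_integral (\<Phi> y - \<Phi> x)) {x..y}"
proof -
  define \<Phi> where "\<Phi> x = integral {0..x} \<phi>" for x
  have d: "(\<Phi> has_real_derivative \<phi> x) (at x within {0..1})" if "x \<in> {0..1}" for x
    unfolding \<Phi>_def by (rule integral_has_real_derivative[OF continuous(4) that])
  have "(\<phi> has_integral (\<Phi> y - \<Phi> x)) {x..y}" if "0 \<le> x" "x \<le> y" "y \<le> 1" for x y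
    using that by (intro fundamental_theorem_of_calculus)
      (auto simp: has_real_derivative_iff_has_vector_derivative[symmetric] intro: DERIV_subset[OF d])
  with d show ?thesis by (rule that)
qed

lemma strict_mono_if_flux_pos:
  assumes "0 \<le> s" "t \<le> 1" "\<And>x. x \<in> {s<..<t} \<Longrightarrow> v x > 0" "s \<le> x" "x < y" "y \<le> t"
  shows "u x < u y"
proof (rule DERIV_pos_imp_increasing_open[OF assms(5)])
  show "continuous_on {x..y} u"
    by (rule continuous_on_subset[OF continuous(2)]) (use assms in auto)
  fix z assume z: "x < z" "z < y"
  then have "(u has_real_derivative v z / a z) (at z)" "0 < v z / a z"
    using u_deriv[of z] a_pos[of z] assms(3)[of z] assms by (auto simp: at_within_Icc_at)
  then show "\<exists>D. (u has_real_derivative D) (at z) \<and> 0 < D" by blast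
qed

lemma strict_antimono_if_flux_neg:
  assumes "0 \<le> s" "t \<le> 1" "\<And>x. x \<in> {s<..<t} \<Longrightarrow> v x < 0" "s \<le> x" "x < y" "y \<le> t"
  shows "u y < u x"
proof (rule DERIV_neg_imp_decreasing_open[OF assms(5)])
  show "continuous_on {x..y} u"
    by (rule continuous_on_subset[OF continuous(2)]) (use assms in auto)
  fix z assume z: "x < z" "z < y"
  then have "(u has_real_derivative v z / a z) (at z)" "v z / a z < 0"
    using u_deriv[of z] a_pos[of z] assms(3)[of z] assms by (auto simp: at_within_Icc_at divide_less_0_iff)
  then show "\<exists>D. (u has_real_derivative D) (at z) \<and> D < 0" by blast
qed

lemma flux_sign_near_max:
  assumes x: "x \<in> {0..1}" and "v x = 0" "f (u x) > 0"
  obtains \<delta> where "\<delta> > 0" "\<And>y. y \<in> {0..1} \<Longrightarrow> x < y \<Longrightarrow> y < x + \<delta> \<Longrightarrow> v y < 0"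
    "\<And>y. y \<in> {0..1} \<Longrightarrow> x - \<delta> < y \<Longrightarrow> y < x \<Longrightarrow> v y > 0"
    "\<And>y. y \<in> {0..1} \<Longrightarrow> y \<noteq> x \<Longrightarrow> \<bar>y - x\<bar> < \<delta> \<Longrightarrow> \<phi> y \<noteq> 0"
proof -
  have neg: "- f (u x) < 0" using assms by simp
  obtain d1 where d1: "d1 > 0" "\<forall>h>0. x + h \<in> {0..1} \<longrightarrow> h < d1 \<longrightarrow> v (x + h) < v x"
    using has_real_derivative_neg_dec_right[OF v_deriv[OF x] neg] by blast
  obtain d2 where d2: "d2 > 0" "\<forall>h>0. x - h \<in> {0..1} \<longrightarrow> h < d2 \<longrightarrow> v x < v (x - h)"
    using has_real_derivative_neg_dec_left[OF v_deriv[OF x] neg] by blast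
  obtain d3 where d3: "d3 > 0" "\<And>y. y \<in> {0..1} \<Longrightarrow> y \<noteq> x \<Longrightarrow> \<bar>y - x\<bar> < d3 \<Longrightarrow> \<phi> y \<noteq> 0 \<and> v y \<noteq> 0"
    using nonzero_near[OF x] by metis
  show ?thesis
  proof (rule that[of "min d1 (min d2 d3)"])
    show "min d1 (min d2 d3) > 0" using d1 d2 d3 by simp
    show "v y < 0" if "y \<in> {0..1}" "x < y" "y < x + min d1 (min d2 d3)" for y
      using d1(2)[rule_format, of "y - x"] that assms by auto
    show "v y > 0" if "y \<in> {0..1}" "x - min d1 (min d2 d3) < y" "y < x" for y
      using d2(2)[rule_format, of "x - y"] that assms by auto
    show "\<phi> y \<noteq> 0" if "y \<in> {0..1}" "y \<noteq> x" "\<bar>y - x\<bar> < min d1 (min d2 d3)" for y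
      using d3(2)[of y] that by auto
  qed
qed

text \<open>Windows of radius below \<open>r\<close> miss the compact set \<open>S\<close>. The caps
  \<open>\<bar>C\<bar>\<close> and \<open>1\<close> keep all smaller radii admissible for the
  orthogonality relations.\<close>

lemma level_gap:
  assumes S: "compact S" "S \<subseteq> {0..1}" and C: "C \<noteq> 0" and ne: "\<And>x. x \<in> S \<Longrightarrow> u x \<noteq> C"
  obtains r where "r > 0" "r \<le> \<bar>C\<bar>" "r \<le> 1" "\<And>x. x \<in> S \<Longrightarrow> r \<le> \<bar>u x - C\<bar>"
proof (cases "S = {}")
  case True
  then show ?thesis using C by (intro that[of "min \<bar>C\<bar> 1"]) auto
next
  case False
  have "\<exists>y\<in>S. \<forall>x\<in>S. \<bar>u y - C\<bar> \<le> \<bar>u x - C\<bar>"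
    by (intro continuous_attains_inf S False continuous_intros continuous_on_subset[OF continuous(2)])
  then obtain y where y: "y \<in> S" "\<And>x. x \<in> S \<Longrightarrow> \<bar>u y - C\<bar> \<le> \<bar>u x - C\<bar>" by blast
  show ?thesis
  proof (rule that[of "min \<bar>u y - C\<bar> (min \<bar>C\<bar> 1)"])
    show "min \<bar>u y - C\<bar> (min \<bar>C\<bar> 1) > 0" using ne[OF y(1)] C by simp
    show "min \<bar>u y - C\<bar> (min \<bar>C\<bar> 1) \<le> \<bar>u x - C\<bar>" if "x \<in> S" for x
      using y(2)[OF that] by linarith
  qed auto
qed

text \<open>A thin window about the maximal level is an interval between two points of equal level
  on the two sides of \<open>x0\<close>, so \<open>\<Phi>\<close> agrees at them. The branches are
  therefore matched with \<open>k = 0\<close> and with \<open>x0\<close> as common peak.\<close>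

lemma unique_interior_max:
  assumes x0: "x0 \<in> {0<..<1}" and crit: "v x0 = 0" "f (u x0) > 0"
    and ne: "\<And>x. x \<in> {0..1} \<Longrightarrow> x \<noteq> x0 \<Longrightarrow> u x \<noteq> u x0"
  shows "(\<exists>\<delta>>0. \<forall>s. \<bar>s\<bar> < \<delta> \<longrightarrow> x0 + s \<in> {0..1} \<and> a (x0 + s) = a (x0 - s)) \<and> \<phi> x0 = 0"
proof -
  define C where "C = u x0"
  have x01: "x0 \<in> {0..1}" using x0 by auto
  have C0: "C \<noteq> 0" unfolding C_def by (rule critical_value_nonzero(2)[OF x01 crit(1)])
  obtain d where d: "d > 0" "\<And>y. y \<in> {0..1} \<Longrightarrow> x0 < y \<Longrightarrow> y < x0 + d \<Longrightarrow> v y < 0"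
    "\<And>y. y \<in> {0..1} \<Longrightarrow> x0 - d < y \<Longrightarrow> y < x0 \<Longrightarrow> v y > 0"
    "\<And>y. y \<in> {0..1} \<Longrightarrow> y \<noteq> x0 \<Longrightarrow> \<bar>y - x0\<bar> < d \<Longrightarrow> \<phi> y \<noteq> 0"
    by (rule flux_sign_near_max[OF x01 crit], rule that)
  define \<delta> where "\<delta> = min d (min x0 (1 - x0))"
  have \<delta>: "\<delta> > 0" "\<delta> \<le> d" "0 \<le> x0 - \<delta>" "x0 + \<delta> \<le> 1" using d(1) x0 by (auto simp: \<delta>_def)
  have inc: "u x < u y" if "x0 - \<delta> \<le> x" "x < y" "y \<le> x0" for x y
    by (rule strict_mono_if_flux_pos[of "x0 - \<delta>" x0]) (use that \<delta> x0 d(3) in auto)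
  have dec: "u y < u x" if "x0 \<le> x" "x < y" "y \<le> x0 + \<delta>" for x y
    by (rule strict_antimono_if_flux_neg[of x0 "x0 + \<delta>"]) (use that \<delta> x0 d(2) in auto)
  have "compact ({0..x0-\<delta>} \<union> {x0+\<delta>..1})" by (intro compact_Un) auto
  then obtain r0 where r0: "r0 > 0" "r0 \<le> \<bar>C\<bar>" "r0 \<le> 1"
    "\<And>x. x \<in> {0..x0-\<delta>} \<union> {x0+\<delta>..1} \<Longrightarrow> r0 \<le> \<bar>u x - C\<bar>"
  proof (rule level_gap[of "{0..x0-\<delta>} \<union> {x0+\<delta>..1}" C])
    show "u x \<noteq> C" if "x \<in> {0..x0-\<delta>} \<union> {x0+\<delta>..1}" for x
      unfolding C_def using that \<delta> x0 by (intro ne) auto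
  qed (use C0 \<delta> x0 in auto)
  obtain \<Phi> where \<Phi>: "\<And>x. x \<in> {0..1} \<Longrightarrow> (\<Phi> has_real_derivative \<phi> x) (at x within {0..1})"
    "\<And>x y. 0 \<le> x \<Longrightarrow> x \<le> y \<Longrightarrow> y \<le> 1 \<Longrightarrow> (\<phi> has_integral (\<Phi> y - \<Phi> x)) {x..y}"
    using antiderivative by metis
  obtain \<kappa> \<epsilon> where \<kappa>: "\<kappa> > 0" "\<epsilon> > 0"
    "\<And>y. y \<in> {x0-\<delta><..<x0} \<Longrightarrow> \<bar>y - x0\<bar> < \<epsilon> \<Longrightarrow> x0 - \<kappa> * (y - x0) \<in> {x0<..<x0+\<delta>} \<and>
       a (x0 - \<kappa> * (y - x0)) = \<kappa>\<^sup>2 * a y \<and> \<phi> (x0 - \<kappa> * (y - x0)) * (- \<kappa>) = \<phi> y"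
  proof (rule matched_branches[where yl = "x0 - \<delta>" and yr = x0 and zl = x0 and zr = "x0 + \<delta>" and yp = x0
        and zp = x0 and C = C and \<Phi> = \<Phi> and k = 0 and ?r0.0 = r0])
    show "u y < C \<and> \<phi> y \<noteq> 0" if "y \<in> {x0 - \<delta><..<x0}" for y
      using inc[of y x0] d(4)[of y] that \<delta> x0 by (auto simp: C_def)
    show "u z < C" if "z \<in> {x0<..<x0 + \<delta>}" for z
      using dec[of x0 z] that by (auto simp: C_def)
    show "v y * v z < 0" if "y \<in> {x0 - \<delta><..<x0}" "z \<in> {x0<..<x0 + \<delta>}" for y z
      using d(3)[of y] d(2)[of z] that \<delta> x0 by (intro mult_pos_neg) auto
    fix y z assume y: "y \<in> {x0 - \<delta><..<x0}" and z: "z \<in> {x0<..<x0 + \<delta>}"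
      and uzy: "u z = u y" and uy: "C - r0 < u y"
    define r where "r = C - u y"
    have r: "0 < r" "r < r0" using uy inc[of y x0] y by (auto simp: r_def C_def)
    have int: "((\<lambda>x. if \<bar>u x - C\<bar> < r then \<phi> x else 0) has_integral 0) {0..1}"
      using orth r r0 x01 unfolding orthogonal_to_levels_def C_def by force
    \<comment> \<open>Away from \<open>x0\<close> the gap \<open>r0\<close> decides, and near
      \<open>x0\<close> the monotonicity of the two branches.\<close>
    have lev: "\<bar>u x - C\<bar> < r \<longleftrightarrow> x \<in> {y<..<z}" if x: "x \<in> {0..1}" for x
    proof -
      consider "x \<in> {0..x0-\<delta>} \<union> {x0+\<delta>..1}" | "x0 - \<delta> < x" "x \<le> x0" | "x0 < x" "x < x0 + \<delta>"
        using x by fastforce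
      then show ?thesis
      proof cases
        case 1
        then show ?thesis using r0(4)[OF 1] r y z by auto
      next
        case 2
        have "u x \<le> C" using inc[of x x0] 2 by (cases "x = x0") (auto simp: C_def)
        moreover have "u y < u x \<longleftrightarrow> y < x"
          using inc[of y x] inc[of x y] 2 y by (cases x y rule: linorder_cases) auto
        ultimately show ?thesis using 2 z by (auto simp: r_def)
      next
        case 3
        have "u x \<le> C" using dec[of x0 x] 3 by (auto simp: C_def)
        moreover have "u z < u x \<longleftrightarrow> x < z"
          using dec[of z x] dec[of x z] 3 z by (cases x z rule: linorder_cases) auto
        ultimately show ?thesis using 3 y uzy by (auto simp: r_def)
      qed
    qed
    have "((\<lambda>x. if x \<in> {y<..<z} then \<phi> x else 0) has_integral 0) {0..1}"
      by (rule has_integral_eq[OF _ int]) (use lev in auto)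
    then have "(\<phi> has_integral 0) {y<..<z}"
      using y z \<delta> by (subst (asm) has_integral_restrict) auto
    then have "(\<phi> has_integral 0) {y..z}" by (simp add: has_integral_Icc_iff_Ioo)
    moreover have "(\<phi> has_integral (\<Phi> z - \<Phi> y)) {y..z}" using y z \<delta> by (intro \<Phi>(2)) auto
    ultimately show "\<Phi> z - \<Phi> y = 0" by (metis has_integral_unique)
  qed (use \<delta> x0 crit \<Phi>(1) r0(1) in \<open>auto simp: C_def\<close>)
  \<comment> \<open>In the limit at the peak, \<open>a (Z y) = \<kappa>\<^sup>2 * a y\<close>
    becomes \<open>a x0 = \<kappa>\<^sup>2 * a x0\<close>, so \<open>\<kappa> = 1\<close>. The
    relation for \<open>\<phi>\<close> then reads \<open>- \<phi> x0 = \<phi> x0\<close>.\<close>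
  define F where "F = at_left x0"
  have ev: "eventually (\<lambda>y. y \<in> {x0-\<delta><..<x0} \<and> \<bar>y - x0\<bar> < \<epsilon>) F"
    unfolding F_def eventually_at_left_field
    by (intro exI[of _ "max (x0 - \<delta>) (x0 - \<epsilon>)"]) (use \<delta> \<kappa> in auto)
  have lim: "((\<lambda>y. y) \<longlongrightarrow> x0) F" by (simp add: F_def tendsto_ident_at)
  have lim': "((\<lambda>y. x0 - \<kappa> * (y - x0)) \<longlongrightarrow> x0) F"
    using lim by (auto intro!: tendsto_eq_intros)
  have cont: "isCont a x0" "isCont \<phi> x0"
    using continuous_on_interior[OF continuous(1), of x0] continuous_on_interior[OF continuous(4), of x0] x0 by auto
  have F: "F \<noteq> bot" by (simp add: F_def)
  have "((\<lambda>y. a (x0 - \<kappa> * (y - x0)) - \<kappa>\<^sup>2 * a y) \<longlongrightarrow> a x0 - \<kappa>\<^sup>2 * a x0) F"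
    by (intro tendsto_intros isCont_tendsto_compose[OF cont(1)] lim lim')
  moreover have "((\<lambda>y. a (x0 - \<kappa> * (y - x0)) - \<kappa>\<^sup>2 * a y) \<longlongrightarrow> 0) F"
    by (rule tendsto_eventually) (use ev in eventually_elim, use \<kappa>(3) in auto)
  ultimately have "a x0 - \<kappa>\<^sup>2 * a x0 = 0" by (rule tendsto_unique[OF F])
  then have \<kappa>1: "\<kappa> = 1" using a_pos[OF x01] \<kappa>(1) by (simp add: power2_eq_1_iff)
  have "((\<lambda>y. \<phi> (x0 - \<kappa> * (y - x0)) * (- \<kappa>) - \<phi> y) \<longlongrightarrow> \<phi> x0 * (- \<kappa>) - \<phi> x0) F"
    by (intro tendsto_intros isCont_tendsto_compose[OF cont(2)] lim lim')
  moreover have "((\<lambda>y. \<phi> (x0 - \<kappa> * (y - x0)) * (- \<kappa>) - \<phi> y) \<longlongrightarrow> 0) F"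
    by (rule tendsto_eventually) (use ev in eventually_elim, use \<kappa>(3) in auto)
  ultimately have "\<phi> x0 * (- \<kappa>) - \<phi> x0 = 0" by (rule tendsto_unique[OF F])
  then have \<phi>0: "\<phi> x0 = 0" using \<kappa>1 by simp
  have half: "a (x0 + s) = a (x0 - s)" if "0 < s" "s < min \<delta> \<epsilon>" for s
    using \<kappa>(3)[of "x0 - s"] that \<kappa>1 by auto
  have "x0 + s \<in> {0..1} \<and> a (x0 + s) = a (x0 - s)" if s: "\<bar>s\<bar> < min \<delta> \<epsilon>" for s
    using half[of s] half[of "- s"] s \<delta> by (cases s "0::real" rule: linorder_cases) auto
  then show ?thesis using \<phi>0 \<delta>(1) \<kappa>(2) by (intro conjI exI[of _ "min \<delta> \<epsilon>"]) auto
qed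

text \<open>Here a thin window is the complement of the interval between two points of equal level,
  so \<open>k\<close> is the full integral of \<open>\<phi>\<close>. The peaks differ, and the limit
  \<open>y \<rightarrow> 0\<close> only relates \<open>a 1\<close> to \<open>a 0\<close>; thus
  \<open>\<kappa>\<close> remains free at this stage.\<close>

lemma equal_end_max:
  assumes ends: "u 1 = u 0" "f (u 0) > 0"
    and ne: "\<And>x. x \<in> {0<..<1} \<Longrightarrow> u x \<noteq> u 0"
  shows "\<exists>\<kappa>>0. \<exists>\<epsilon>>0. \<forall>y. 0 < y \<and> y < \<epsilon> \<longrightarrow> 1 - \<kappa> * y \<in> {0..1} \<and> a (1 - \<kappa> * y) = \<kappa>\<^sup>2 * a y"
proof -
  define C where "C = u 0"
  have mem: "(0::real) \<in> {0..1}" "(1::real) \<in> {0..1}" by auto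
  have C0: "C \<noteq> 0" unfolding C_def by (rule critical_value_nonzero(2)[OF mem(1) v_bdry(1)])
  obtain d1 where d1: "d1 > 0" "\<And>y. y \<in> {0..1} \<Longrightarrow> 0 < y \<Longrightarrow> y < 0 + d1 \<Longrightarrow> v y < 0"
    "\<And>y. y \<in> {0..1} \<Longrightarrow> y \<noteq> 0 \<Longrightarrow> \<bar>y - 0\<bar> < d1 \<Longrightarrow> \<phi> y \<noteq> 0"
    using flux_sign_near_max[OF mem(1) v_bdry(1) ends(2)] by metis
  have "f (u 1) > 0" using ends by simp
  then obtain d2 where d2: "d2 > 0" "\<And>y. y \<in> {0..1} \<Longrightarrow> 1 - d2 < y \<Longrightarrow> y < 1 \<Longrightarrow> v y > 0"
    using flux_sign_near_max[OF mem(2) v_bdry(2)] by metis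
  define \<delta> where "\<delta> = min (min d1 d2) (1/2)"
  have \<delta>: "\<delta> > 0" "\<delta> \<le> d1" "\<delta> \<le> d2" "\<delta> \<le> 1/2" using d1(1) d2(1) by (auto simp: \<delta>_def)
  have dec: "u y < u x" if "0 \<le> x" "x < y" "y \<le> \<delta>" for x y
    by (rule strict_antimono_if_flux_neg[of 0 \<delta>]) (use that \<delta> d1(2) in auto)
  have inc: "u x < u y" if "1 - \<delta> \<le> x" "x < y" "y \<le> 1" for x y
    by (rule strict_mono_if_flux_pos[of "1 - \<delta>" 1]) (use that \<delta> d2(2) in auto)
  obtain r0 where r0: "r0 > 0" "r0 \<le> \<bar>C\<bar>" "r0 \<le> 1" "\<And>x. x \<in> {\<delta>..1-\<delta>} \<Longrightarrow> r0 \<le> \<bar>u x - C\<bar>"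
  proof (rule level_gap[of "{\<delta>..1-\<delta>}" C])
    show "u x \<noteq> C" if "x \<in> {\<delta>..1-\<delta>}" for x unfolding C_def using that \<delta> by (intro ne) auto
  qed (use C0 \<delta> in auto)
  obtain \<Phi> where \<Phi>: "\<And>x. x \<in> {0..1} \<Longrightarrow> (\<Phi> has_real_derivative \<phi> x) (at x within {0..1})"
    "\<And>x y. 0 \<le> x \<Longrightarrow> x \<le> y \<Longrightarrow> y \<le> 1 \<Longrightarrow> (\<phi> has_integral (\<Phi> y - \<Phi> x)) {x..y}"
    using antiderivative by metis
  obtain \<kappa> \<epsilon> where \<kappa>: "\<kappa> > 0" "\<epsilon> > 0"
    "\<And>y. y \<in> {0<..<\<delta>} \<Longrightarrow> \<bar>y - 0\<bar> < \<epsilon> \<Longrightarrow> 1 - \<kappa> * (y - 0) \<in> {1-\<delta><..<1} \<and>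
       a (1 - \<kappa> * (y - 0)) = \<kappa>\<^sup>2 * a y \<and> \<phi> (1 - \<kappa> * (y - 0)) * (- \<kappa>) = \<phi> y"
  proof (rule matched_branches[where yl = 0 and yr = \<delta> and zl = "1 - \<delta>" and zr = 1 and yp = 0
        and zp = 1 and C = C and \<Phi> = \<Phi> and k = "\<Phi> 1 - \<Phi> 0" and ?r0.0 = r0])
    show "u y < C \<and> \<phi> y \<noteq> 0" if "y \<in> {0<..<\<delta>}" for y
      using dec[of 0 y] d1(3)[of y] that \<delta> by (auto simp: C_def)
    show "u z < C" if "z \<in> {1-\<delta><..<1}" for z
      using inc[of z 1] that ends by (auto simp: C_def)
    show "v y * v z < 0" if "y \<in> {0<..<\<delta>}" "z \<in> {1-\<delta><..<1}" for y z
      using d1(2)[of y] d2(2)[of z] that \<delta> by (intro mult_neg_pos) auto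
    fix y z assume y: "y \<in> {0<..<\<delta>}" and z: "z \<in> {1-\<delta><..<1}"
      and uzy: "u z = u y" and uy: "C - r0 < u y"
    define r where "r = C - u y"
    have r: "0 < r" "r < r0" using uy dec[of 0 y] y by (auto simp: r_def C_def)
    have int: "((\<lambda>x. if \<bar>u x - C\<bar> < r then \<phi> x else 0) has_integral 0) {0..1}"
      using orth r r0 mem unfolding orthogonal_to_levels_def C_def by force
    have lev: "\<bar>u x - C\<bar> < r \<longleftrightarrow> x \<notin> {y..z}" if x: "x \<in> {0..1}" for x
    proof -
      consider "x \<in> {\<delta>..1-\<delta>}" | "0 \<le> x" "x < \<delta>" | "1 - \<delta> < x" "x \<le> 1"
        using x by fastforce
      then show ?thesis
      proof cases
        case 1
        then show ?thesis using r0(4)[OF 1] r y z by auto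
      next
        case 2
        have "u x \<le> C" using dec[of 0 x] 2 by (cases "x = 0") (auto simp: C_def)
        moreover have "u y < u x \<longleftrightarrow> x < y"
          using dec[of y x] dec[of x y] 2 y by (cases x y rule: linorder_cases) auto
        ultimately show ?thesis using 2 z \<delta> by (auto simp: r_def)
      next
        case 3
        have "u x \<le> C" using inc[of x 1] 3 ends by (cases "x = 1") (auto simp: C_def)
        moreover have "u z < u x \<longleftrightarrow> z < x"
          using inc[of z x] inc[of x z] 3 z by (cases x z rule: linorder_cases) auto
        ultimately show ?thesis using 3 y uzy \<delta> by (auto simp: r_def)
      qed
    qed
    have "(\<phi> has_integral (\<Phi> z - \<Phi> y)) {y..z}" using y z \<delta> by (intro \<Phi>(2)) auto
    then have "((\<lambda>x. if x \<in> {y..z} then \<phi> x else 0) has_integral (\<Phi> z - \<Phi> y)) {0..1}"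
      using y z \<delta> by (subst has_integral_restrict) auto
    from has_integral_add[OF int this]
    have "(\<phi> has_integral (0 + (\<Phi> z - \<Phi> y))) {0..1}"
      by (rule has_integral_eq[rotated]) (use lev in auto)
    moreover have "(\<phi> has_integral (\<Phi> 1 - \<Phi> 0)) {0..1}" by (intro \<Phi>(2)) auto
    ultimately show "\<Phi> z - \<Phi> y = \<Phi> 1 - \<Phi> 0" by (metis add_0 has_integral_unique)
  qed (use \<delta> ends v_bdry \<psi>_bdry \<Phi>(1) r0(1) in \<open>auto simp: C_def\<close>)
  have "1 - \<kappa> * y \<in> {0..1} \<and> a (1 - \<kappa> * y) = \<kappa>\<^sup>2 * a y" if "0 < y" "y < min \<delta> \<epsilon>" for y
    using \<kappa>(3)[of y] that \<delta> by auto
  then show ?thesis using \<kappa>(1,2) \<delta>(1) by (intro exI[of _ \<kappa>] conjI exI[of _ "min \<delta> \<epsilon>"]) auto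
qed

end

text \<open>At a critical point \<open>f (u x0)\<close> is nonzero, so \<open>u\<close> has a strict
  local maximum there, or its negative has one.\<close>

lemma (in kernel_pair) unique_interior_level:
  assumes x0: "x0 \<in> {0<..<1}" and crit: "v x0 = 0"
    and ne: "\<And>x. x \<in> {0..1} \<Longrightarrow> x \<noteq> x0 \<Longrightarrow> u x \<noteq> u x0"
  shows "(\<exists>\<delta>>0. \<forall>s. \<bar>s\<bar> < \<delta> \<longrightarrow> x0 + s \<in> {0..1} \<and> a (x0 + s) = a (x0 - s)) \<and> \<phi> x0 = 0"
proof (cases "f (u x0) > 0")
  case True
  then show ?thesis using unique_interior_max[OF x0 crit] ne by blast
next
  case False
  then have "- f (- (- u x0)) > 0" using critical_value_nonzero(1)[of x0] crit x0 by auto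
  then show ?thesis
    using kernel_pair.unique_interior_max[OF negated x0] crit ne by simp
qed

lemma (in kernel_pair) equal_end_levels:
  assumes ends: "u 1 = u 0" and ne: "\<And>x. x \<in> {0<..<1} \<Longrightarrow> u x \<noteq> u 0"
  shows "\<exists>\<kappa>>0. \<exists>\<epsilon>>0. \<forall>y. 0 < y \<and> y < \<epsilon> \<longrightarrow> 1 - \<kappa> * y \<in> {0..1} \<and> a (1 - \<kappa> * y) = \<kappa>\<^sup>2 * a y"
proof (cases "f (u 0) > 0")
  case True
  then show ?thesis using equal_end_max[OF ends] ne by blast
next
  case False
  then have "- f (- (- u 0)) > 0" using critical_value_nonzero(1)[of 0] v_bdry by auto
  then show ?thesis
    using kernel_pair.equal_end_max[OF negated] ends ne by simp
qed

section \<open>Analytic symmetries of the diffusion coefficient\<close>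

lemma real_analytic_on_affine:
  assumes "real_analytic_on b T" and "\<And>y. y \<in> S \<Longrightarrow> k + l * y \<in> T"
  shows "real_analytic_on (\<lambda>y. b (k + l * y)) S"
  unfolding real_analytic_on_def
proof
  fix x assume x: "x \<in> S"
  obtain r c where r: "r > 0" and c: "\<And>y. y \<in> T \<Longrightarrow> \<bar>y - (k + l * x)\<bar> < r \<Longrightarrow> (\<lambda>n. c n * (y - (k + l * x)) ^ n) sums b y"
    using assms(1)[unfolded real_analytic_on_def, rule_format, OF assms(2)[OF x]] by blast
  show "\<exists>r>0. \<exists>c. \<forall>y\<in>S. \<bar>y - x\<bar> < r \<longrightarrow> (\<lambda>n. c n * (y - x) ^ n) sums b (k + l * y)"
  \<comment> \<open>The summand \<open>1\<close> keeps the radius meaningful when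
    \<open>l = 0\<close>.\<close>
  proof (intro exI[of _ "r / (\<bar>l\<bar> + 1)"] conjI exI[of _ "\<lambda>n. c n * l ^ n"] ballI impI)
    show "r / (\<bar>l\<bar> + 1) > 0" using r by simp
    fix y assume y: "y \<in> S" "\<bar>y - x\<bar> < r / (\<bar>l\<bar> + 1)"
    have eq: "k + l * y - (k + l * x) = l * (y - x)" by (simp add: algebra_simps)
    have "\<bar>l\<bar> * \<bar>y - x\<bar> \<le> (\<bar>l\<bar> + 1) * \<bar>y - x\<bar>" by (simp add: mult_right_mono)
    also have "\<dots> < r" using y(2) by (simp add: field_simps)
    finally have "\<bar>k + l * y - (k + l * x)\<bar> < r" unfolding eq by (simp add: abs_mult)
    from c[OF assms(2)[OF y(1)] this] show "(\<lambda>n. c n * l ^ n * (y - x) ^ n) sums b (k + l * y)"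
      unfolding eq by (simp add: power_mult_distrib mult.assoc)
  qed
qed

lemma real_analytic_on_diff_scaled:
  assumes "real_analytic_on b S" "real_analytic_on d S"
  shows "real_analytic_on (\<lambda>y. b y - m * d y) S"
  unfolding real_analytic_on_def
proof
  fix x assume x: "x \<in> S"
  obtain r c where r: "r > 0" and c: "\<And>y. y \<in> S \<Longrightarrow> \<bar>y - x\<bar> < r \<Longrightarrow> (\<lambda>n. c n * (y - x) ^ n) sums b y"
    using assms(1)[unfolded real_analytic_on_def, rule_format, OF x] by blast
  obtain r' c' where r': "r' > 0" and c': "\<And>y. y \<in> S \<Longrightarrow> \<bar>y - x\<bar> < r' \<Longrightarrow> (\<lambda>n. c' n * (y - x) ^ n) sums d y"
    using assms(2)[unfolded real_analytic_on_def, rule_format, OF x] by blast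
  show "\<exists>r>0. \<exists>c. \<forall>y\<in>S. \<bar>y - x\<bar> < r \<longrightarrow> (\<lambda>n. c n * (y - x) ^ n) sums (b y - m * d y)"
  proof (intro exI[of _ "min r r'"] conjI exI[of _ "\<lambda>n. c n - m * c' n"] ballI impI)
    show "min r r' > 0" using r r' by simp
    fix y assume y: "y \<in> S" "\<bar>y - x\<bar> < min r r'"
    have "(\<lambda>n. c n * (y - x) ^ n - m * (c' n * (y - x) ^ n)) sums (b y - m * d y)"
      using y by (intro sums_diff sums_mult c c') auto
    then show "(\<lambda>n. (c n - m * c' n) * (y - x) ^ n) sums (b y - m * d y)"
      by (simp add: algebra_simps)
  qed
qed

text \<open>Either all coefficients of the local series vanish, or its zero at the centre is
  isolated. At an end point the series is known to represent \<open>b\<close> on one side only, so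
  the argument is applied to the sum \<open>B\<close> of the series on a full neighbourhood.\<close>

lemma real_analytic_local_dichotomy:
  assumes an: "real_analytic_on b {s..t}" and st: "s < t" and x: "x \<in> {s..t}"
  shows "\<exists>\<delta>>0. (\<forall>y\<in>{s..t}. \<bar>y - x\<bar> < \<delta> \<longrightarrow> b y = 0) \<or> (\<forall>y\<in>{s..t}. y \<noteq> x \<and> \<bar>y - x\<bar> < \<delta> \<longrightarrow> b y \<noteq> 0)"
proof -
  obtain r c where r: "r > 0" and c: "\<And>y. y \<in> {s..t} \<Longrightarrow> \<bar>y - x\<bar> < r \<Longrightarrow> (\<lambda>n. c n * (y - x) ^ n) sums b y"
    using an[unfolded real_analytic_on_def, rule_format, OF x] by blast
  \<comment> \<open>Convergence at this one point gives convergence for all arguments of smaller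
    modulus, on both sides of the centre.\<close>
  obtain y0 where y0: "y0 \<in> {s..t}" "y0 \<noteq> x" "\<bar>y0 - x\<bar> < r"
  proof (cases "x < t")
    case True
    then show ?thesis using r x by (intro that[of "x + min r (t - x) / 2"]) (auto simp: min_def field_simps)
  next
    case False
    then show ?thesis using r x st by (intro that[of "x - min r (x - s) / 2"]) (auto simp: min_def field_simps)
  qed
  define \<rho> where "\<rho> = \<bar>y0 - x\<bar>"
  have \<rho>: "\<rho> > 0" "\<rho> < r" using y0 by (auto simp: \<rho>_def)
  define B where "B z = (\<Sum>n. c n * z ^ n)" for z
  have summ: "summable (\<lambda>n. c n * (y0 - x) ^ n)" using c[OF y0(1,3)] by (simp add: sums_iff)
  have B: "(\<lambda>n. c n * (z - 0) ^ n) sums B z" if "norm (z - 0) < \<rho>" for z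
  proof -
    have "summable (\<lambda>n. c n * z ^ n)"
      by (rule powser_inside[OF summ]) (use that in \<open>simp add: \<rho>_def\<close>)
    then show ?thesis by (simp add: B_def summable_sums)
  qed
  have bB: "b y = B (y - x)" if "y \<in> {s..t}" "\<bar>y - x\<bar> < r" for y
    using c[OF that] by (simp add: B_def sums_iff)
  have B0: "B 0 = c 0" by (simp add: B_def)
  show ?thesis
  proof (cases "\<forall>n. c n = 0")
    case True
    then show ?thesis using bB r by (intro exI[of _ r]) (auto simp: B_def)
  next
    case False
    have "\<exists>\<delta>>0. \<forall>z. z \<noteq> 0 \<and> \<bar>z\<bar> < \<delta> \<longrightarrow> B z \<noteq> 0"
    proof (cases "c 0 = 0")
      case True
      with False obtain m where m: "c m \<noteq> 0" "m > 0" by (metis gr0I)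
      have "B 0 = 0" using B0 True by simp
      obtain \<sigma> where "\<sigma> > 0" "\<And>z. z \<in> cball 0 \<sigma> - {0} \<Longrightarrow> B z \<noteq> 0"
        using powser_0_nonzero[OF \<rho>(1) B \<open>B 0 = 0\<close> m] by blast
      then show ?thesis by (intro exI[of _ \<sigma>]) auto
    next
      case nz: False
      have "(B \<longlongrightarrow> c 0) (at 0)"
        by (rule powser_limit_0[OF \<rho>(1)]) (use B in auto)
      from tendsto_imp_eventually_ne[OF this nz] show ?thesis
        by (auto simp: eventually_at dist_real_def)
    qed
    then obtain \<delta> where \<delta>: "\<delta> > 0" "\<And>z. z \<noteq> 0 \<Longrightarrow> \<bar>z\<bar> < \<delta> \<Longrightarrow> B z \<noteq> 0" by blast
    show ?thesis
      using \<delta> r bB by (intro exI[of _ "min \<delta> r"]) auto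
  qed
qed

text \<open>Vanishing near a point is locally constant in the point by the local dichotomy, and an
  interval is connected.\<close>

lemma real_analytic_identity:
  assumes an: "real_analytic_on b {s..t}" and pq: "s \<le> p" "p < q" "q \<le> t"
    and zero: "\<And>y. y \<in> {p<..<q} \<Longrightarrow> b y = 0" and y: "y \<in> {s..t}"
  shows "b y = 0"
proof -
  have st: "s < t" using pq by auto
  define P where "P x \<longleftrightarrow> (\<exists>\<epsilon>>0. \<forall>y\<in>{s..t}. \<bar>y - x\<bar> < \<epsilon> \<longrightarrow> b y = 0)" for x
  have "P y"
  proof (rule connected_induction_simple[where S = "{s..t}" and P = P and a = "(p + q) / 2" and b = y])
    show "P ((p + q) / 2)" unfolding P_def
    proof (intro exI[of _ "(q - p) / 2"] conjI ballI impI)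
      fix y assume "\<bar>y - (p + q) / 2\<bar> < (q - p) / 2"
      then have "y \<in> {p<..<q}" by (auto simp: abs_if field_simps split: if_splits)
      then show "b y = 0" by (rule zero)
    qed (use pq in auto)
    fix x assume x: "x \<in> {s..t}"
    obtain \<delta> where \<delta>: "\<delta> > 0"
      "(\<forall>y\<in>{s..t}. \<bar>y - x\<bar> < \<delta> \<longrightarrow> b y = 0) \<or> (\<forall>y\<in>{s..t}. y \<noteq> x \<and> \<bar>y - x\<bar> < \<delta> \<longrightarrow> b y \<noteq> 0)"
      using real_analytic_local_dichotomy[OF an st x] by blast
    define T where "T = {s..t} \<inter> ball x \<delta>"
    have "openin (top_of_set {s..t}) T" unfolding T_def by (rule openin_open_Int) simp
    moreover have "x \<in> T" using x \<delta> by (simp add: T_def)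
    moreover have "P z'" if z: "z \<in> T" "z' \<in> T" "P z" for z z'
    proof -
      have "\<not> (\<forall>y\<in>{s..t}. y \<noteq> x \<and> \<bar>y - x\<bar> < \<delta> \<longrightarrow> b y \<noteq> 0)"
      proof
        assume nz: "\<forall>y\<in>{s..t}. y \<noteq> x \<and> \<bar>y - x\<bar> < \<delta> \<longrightarrow> b y \<noteq> 0"
        obtain \<epsilon> where \<epsilon>: "\<epsilon> > 0" "\<forall>y\<in>{s..t}. \<bar>y - z\<bar> < \<epsilon> \<longrightarrow> b y = 0" using z(3) P_def by blast
        \<comment> \<open>Near \<open>z\<close> there are infinitely many zeros of \<open>b\<close>,
          hence one different from \<open>x\<close>. This excludes the second alternative of the
          dichotomy.\<close>
        have "z islimpt {s..t}" using z(1) st by (auto simp: T_def intro: islimpt_Icc)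
        then have "infinite ({s..t} \<inter> ball z (min \<epsilon> (\<delta> - \<bar>z - x\<bar>)))"
          using z(1) \<epsilon>(1) by (auto simp: islimpt_eq_infinite_ball T_def dist_real_def abs_minus_commute)
        then obtain w where w: "w \<in> {s..t}" "w \<in> ball z (min \<epsilon> (\<delta> - \<bar>z - x\<bar>))" "w \<noteq> x"
          by (metis (no_types, lifting) IntE finite.emptyI finite_insert infinite_super insertCI subsetI)
        then have "\<bar>w - z\<bar> < \<epsilon>" "\<bar>w - z\<bar> < \<delta> - \<bar>z - x\<bar>" by (auto simp: dist_real_def abs_minus_commute)
        then show False using nz \<epsilon>(2) w by force
      qed
      then have z0: "\<forall>y\<in>{s..t}. \<bar>y - x\<bar> < \<delta> \<longrightarrow> b y = 0" using \<delta>(2) by blast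
      have "\<bar>z' - x\<bar> < \<delta>" using z(2) by (auto simp: T_def dist_real_def abs_minus_commute)
      then show ?thesis unfolding P_def
        by (intro exI[of _ "\<delta> - \<bar>z' - x\<bar>"]) (use z0 in auto)
    qed
    ultimately show "\<exists>T. openin (top_of_set {s..t}) T \<and> x \<in> T \<and> (\<forall>x\<in>T. \<forall>y\<in>T. P x \<longrightarrow> P y)"
      by blast
  qed (use pq y in auto)
  then show ?thesis using y by (force simp: P_def)
qed

text \<open>The identity theorem for \<open>a (k - l * y) - m * a y\<close>, on an interval where
  both arguments stay in \<open>{0..1}\<close>.\<close>

lemma analytic_affine_symmetry:
  assumes an: "real_analytic_on a {0..1}" and pq: "s \<le> p" "p < q" "q \<le> t"
    and dom: "\<And>y. y \<in> {s..t} \<Longrightarrow> y \<in> {0..1} \<and> k - l * y \<in> {0..1}"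
    and eq: "\<And>y. y \<in> {p<..<q} \<Longrightarrow> a (k - l * y) = m * a y" and y: "y \<in> {s..t}"
  shows "a (k - l * y) = m * a y"
proof -
  have "real_analytic_on (\<lambda>y. a (k + (- l) * y) - m * a (0 + 1 * y)) {s..t}"
    by (intro real_analytic_on_diff_scaled real_analytic_on_affine[OF an]) (use dom in auto)
  then have "a (k + (- l) * y) - m * a (0 + 1 * y) = 0"
    by (rule real_analytic_identity[OF _ pq _ y]) (use eq in auto)
  then show ?thesis by simp
qed

section \<open>Consequences of the symmetries for end points and for an even left part\<close>

context kernel_pair
begin

lemma orth_at: "x \<in> {0..1} \<Longrightarrow> 0 < r \<Longrightarrow> r < \<bar>u x\<bar> \<Longrightarrow> r < 1 \<Longrightarrow>
    ((\<lambda>y. if \<bar>u y - u x\<bar> < r then \<phi> y else 0) has_integral 0) {0..1}"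
  using orth unfolding orthogonal_to_levels_def by blast

lemma no_isolated_left_end_level: "(\<And>x. x \<in> {0<..1} \<Longrightarrow> u x \<noteq> u 0) \<Longrightarrow> False"
  using no_isolated_endpoint_level[of 0 1] orth_at v_bdry \<psi>_bdry by auto

text \<open>If \<open>u\<close> attains the level \<open>u 0\<close> at both ends, then \<open>a (1 - \<kappa> * y) = \<kappa>\<^sup>2 * a y\<close> on a domain that contains
  the fixed point of \<open>y \<mapsto> 1 - \<kappa> * y\<close>, whence \<open>\<kappa> = 1\<close>.\<close>

lemma no_separated_left_end_level:
  assumes an: "real_analytic_on a {0..1}" and odd: "\<not> even_about_half a"
    and ne: "\<And>x. x \<in> {0<..<1} \<Longrightarrow> u x \<noteq> u 0"
  shows False
proof (cases "u 1 = u 0")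
  case False
  have "u x \<noteq> u 0" if "x \<in> {0<..1}" for x
    using ne[of x] False that by (cases "x = 1") auto
  then show False by (rule no_isolated_left_end_level)
next
  case True
  obtain \<kappa> \<epsilon> where \<kappa>: "\<kappa> > 0" "\<epsilon> > 0"
    "\<And>y. 0 < y \<Longrightarrow> y < \<epsilon> \<Longrightarrow> 1 - \<kappa> * y \<in> {0..1} \<and> a (1 - \<kappa> * y) = \<kappa>\<^sup>2 * a y"
    using equal_end_levels[OF True] ne by metis
  \<comment> \<open>The largest \<open>t\<close> for which \<open>y\<close> and
    \<open>1 - \<kappa> * y\<close> both stay in \<open>{0..1}\<close> on \<open>{0..t}\<close>. For
    \<open>\<kappa> = 1\<close> it is \<open>1\<close>, which yields evenness on the whole
    interval.\<close>
  define t where "t = min 1 (1 / \<kappa>)"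
  have t: "t > 0" using \<kappa>(1) by (simp add: t_def)
  have sym: "a (1 - \<kappa> * y) = \<kappa>\<^sup>2 * a y" if y: "y \<in> {0..t}" for y
  proof (rule analytic_affine_symmetry[OF an _ _ _ _ _ y, of 0 "min \<epsilon> t"])
    show "y \<in> {0..1} \<and> 1 - \<kappa> * y \<in> {0..1}" if "y \<in> {0..t}" for y
      using that \<kappa>(1) by (auto simp: t_def field_simps)
  qed (use \<kappa> t in auto)
  define y where "y = 1 / (1 + \<kappa>)"
  have y: "y \<in> {0..t}" "1 - \<kappa> * y = y" using \<kappa>(1) by (auto simp: y_def t_def field_simps)
  have "a y > 0" using y(1) by (intro a_pos) (auto simp: t_def)
  then have "\<kappa>\<^sup>2 = 1" using sym[OF y(1)] y(2) by simp
  then have "\<kappa> = 1" using \<kappa>(1) by (simp add: power2_eq_1_iff)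
  then have "a x = a (1 - x)" if "x \<in> {0..1}" for x
    using sym[of x] that by (simp add: t_def)
  then show False using odd unfolding even_about_half_def by blast
qed

text \<open>On \<open>{0..2 * p}\<close> the equilibrium is even and the kernel odd about \<open>p\<close>, so this part drops out of the
  orthogonality relations, and \<open>2 * p\<close> plays the role of the left end point for the rest.\<close>

lemma no_even_left_part:
  assumes p: "0 < p" "p < 1/2" and inc: "\<And>x. x \<in> {p<..<1} \<Longrightarrow> a' x > 0"
    and even: "\<And>y. y \<in> {0..2*p} \<Longrightarrow> a (2 * p - y) = a y"
    and crit: "v p = 0" "\<phi> p = 0"
  shows False
proof -
  define q where "q = 2 * p"
  have q: "0 < q" "q < 1" "p < q" "p \<in> {0..q}" using p by (auto simp: q_def)
  have sub: "(g has_real_derivative D) (at x within {0..q})"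
    if "(g has_real_derivative D) (at x within {0..1})" for g D x
    using that by (rule DERIV_subset) (use q in auto)
  have refl: "((\<lambda>x. g (q - x)) has_real_derivative - D (q - x)) (at x within {0..q})"
    if "\<And>x. x \<in> {0..1} \<Longrightarrow> (g has_real_derivative D x) (at x within {0..1})" "x \<in> {0..q}" for g D x
    using that q by (intro has_real_derivative_reflect) (auto intro!: sub)
  have aq: "a (q - x) = a x" if "x \<in> {0..q}" for x
    using even[of x] that by (simp add: q_def)
  have x01: "x \<in> {0..1}" "q - x \<in> {0..1}" if "x \<in> {0..q}" for x using that q by auto
  have apos: "\<And>x. x \<in> {0..q} \<Longrightarrow> 0 < a x" using x01 a_pos by blast
  have acont: "continuous_on {0..q} a" by (rule continuous_on_subset[OF continuous(1)]) (use q in auto)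
  obtain L where L: "0 \<le> L"
      "\<And>x y. x \<in> {0..1} \<Longrightarrow> y \<in> {0..1} \<Longrightarrow> \<bar>f (u x) - f (u y)\<bar> \<le> L * \<bar>u x - u y\<bar>"
      "\<And>x. x \<in> {0..1} \<Longrightarrow> \<bar>f' (u x)\<bar> \<le> L"
    using lipschitz by metis
  \<comment> \<open>Uniqueness is used from the midpoint \<open>p\<close> of \<open>{0..q}\<close>,
    where \<open>u (q - p) = u p\<close> trivially and \<open>v p = 0\<close> by hypothesis. For
    \<open>\<phi>\<close> below, the sum vanishes at \<open>p\<close> by hypothesis and the
    difference of fluxes trivially.\<close>
  have uv: "u x - u (q - x) = 0 \<and> v x + v (q - x) = 0" if "x \<in> {0..q}" for x
  proof (rule uniqueness_system[where w = "\<lambda>x. u x - u (q - x)" and z = "\<lambda>x. v x + v (q - x)" and s = 0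
        and t = q and a = a and L = L and x = p and r = "\<lambda>x. - f (u x) - - f (u (q - x))"])
    fix x assume x: "x \<in> {0..q}"
    show "((\<lambda>x. u x - u (q - x)) has_real_derivative (v x + v (q - x)) / a x) (at x within {0..q})"
      using DERIV_diff[OF sub[OF u_deriv[OF x01(1)[OF x]]] refl[OF u_deriv x]] aq[OF x]
      by (simp add: add_divide_distrib)
    show "((\<lambda>x. v x + v (q - x)) has_real_derivative - f (u x) - - f (u (q - x))) (at x within {0..q})"
      using DERIV_add[OF sub[OF v_deriv[OF x01(1)[OF x]]] refl[OF v_deriv x]] by simp
    show "\<bar>- f (u x) - - f (u (q - x))\<bar> \<le> L * \<bar>u x - u (q - x)\<bar>"
      using L(2)[OF x01(1)[OF x] x01(2)[OF x]] by (simp add: abs_minus_commute)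
  qed (use apos acont L(1) q crit that in \<open>auto simp: q_def\<close>)
  have uq: "u (q - x) = u x" "v (q - x) = - v x" if "x \<in> {0..q}" for x using uv[OF that] by auto
  have \<phi>\<psi>: "\<phi> x + \<phi> (q - x) = 0 \<and> \<psi> x - \<psi> (q - x) = 0" if "x \<in> {0..q}" for x
  proof (rule uniqueness_system[where w = "\<lambda>x. \<phi> x + \<phi> (q - x)" and z = "\<lambda>x. \<psi> x - \<psi> (q - x)" and s = 0
        and t = q and a = a and L = L and x = p and r = "\<lambda>x. - (f' (u x) * \<phi> x) - (f' (u (q - x)) * \<phi> (q - x))"])
    fix x assume x: "x \<in> {0..q}"
    show "((\<lambda>x. \<phi> x + \<phi> (q - x)) has_real_derivative (\<psi> x - \<psi> (q - x)) / a x) (at x within {0..q})"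
      using DERIV_add[OF sub[OF \<phi>_deriv[OF x01(1)[OF x]]] refl[OF \<phi>_deriv x]] aq[OF x]
      by (simp add: diff_divide_distrib)
    show "((\<lambda>x. \<psi> x - \<psi> (q - x)) has_real_derivative
        - (f' (u x) * \<phi> x) - (f' (u (q - x)) * \<phi> (q - x))) (at x within {0..q})"
      using DERIV_diff[OF sub[OF \<psi>_deriv[OF x01(1)[OF x]]] refl[OF \<psi>_deriv x]] by simp
    have eq: "- (f' (u x) * \<phi> x) - (f' (u (q - x)) * \<phi> (q - x)) = - f' (u x) * (\<phi> x + \<phi> (q - x))"
      using uq[OF x] by (simp add: algebra_simps)
    show "\<bar>- (f' (u x) * \<phi> x) - (f' (u (q - x)) * \<phi> (q - x))\<bar> \<le> L * \<bar>\<phi> x + \<phi> (q - x)\<bar>"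
      unfolding eq using L(3)[OF x01(1)[OF x]] by (simp add: abs_mult mult_right_mono)
  qed (use apos acont L(1) q crit that in \<open>auto simp: q_def\<close>)
  \<comment> \<open>The boundary conditions at \<open>0\<close> are reflected to
    \<open>q\<close>.\<close>
  have vq: "v q = 0" "\<psi> q = 0" using uq(2)[of q] \<phi>\<psi>[of q] v_bdry \<psi>_bdry q by auto
  obtain E F :: "real \<Rightarrow> real" where EF: "\<forall>x\<in>{0..1}. F (u x) \<le> E x" "\<forall>x\<in>{0..1}. v x = 0 \<longrightarrow> E x = F (u x)"
    "\<forall>s t. 0 \<le> s \<and> s < t \<and> t \<le> 1 \<and> (\<forall>x\<in>{s<..<t}. 0 < a' x) \<longrightarrow> E t < E s"
    using energy by blast
  show False
  proof (rule no_isolated_endpoint_level[of q 1])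
    fix x assume x: "x \<in> {q<..1}"
    have "E x < E q" using EF(3) x q inc by auto
    moreover have "E q = F (u q)" "F (u x) \<le> E x" using EF x q vq by auto
    ultimately show "u x \<noteq> u q" by auto
  next
    fix r :: real assume r: "0 < r" "r < \<bar>u q\<bar>" "r < 1"
    define h where "h x = (if \<bar>u x - u q\<bar> < r then \<phi> x else 0)" for x
    have int: "(h has_integral 0) {0..1}" unfolding h_def using orth_at[of q] r q by auto
    then have "h integrable_on {0..q}" "h integrable_on {q..1}"
      using q by (auto intro: integrable_on_subinterval[of h "{0..1}"])
    then obtain I J where IJ: "(h has_integral I) {0..q}" "(h has_integral J) {q..1}" by auto
    have "(h has_integral I) (cbox 0 q)" using IJ by simp
    from has_integral_affinity[where m = "-1" and c = q, OF this]
    have "((\<lambda>x. h (q - x)) has_integral I) {0..q}" by (simp add: image_affinity_atLeastAtMost)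
    \<comment> \<open>Both points lie in the same window since \<open>u\<close> takes equal values,
      while \<open>\<phi>\<close> changes sign.\<close>
    moreover have "h (q - x) = - h x" if "x \<in> {0..q}" for x
      using uq[OF that] \<phi>\<psi>[OF that] by (auto simp: h_def)
    ultimately have "((\<lambda>x. - h x) has_integral I) {0..q}"
      by (rule has_integral_eq[rotated]) auto
    then have "I = - I" using has_integral_neg[OF IJ(1)] by (metis has_integral_unique)
    then have "I = 0" by simp
    moreover have "(h has_integral (I + J)) {0..1}"
      using has_integral_combine[OF _ _ IJ] q by auto
    ultimately have "J = 0" using int by (metis add_0 has_integral_unique)
    then show "((\<lambda>x. if \<bar>u x - u q\<bar> < r then \<phi> x else 0) has_integral 0) {q..1}"
      using IJ unfolding h_def by simp
  qed (use q vq in auto)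
qed

end

section \<open>Excluding orthogonal kernels\<close>

context kernel_pair
begin

text \<open>The energy is strictly decreasing, on the two intervals separately and hence across
  \<open>p\<close>. So F(u(x)) \<le> E(x) < E(0) = F(u(0)) for x > 0, and the level at
  \<open>0\<close> never recurs.\<close>

lemma no_increasing_diffusion:
  assumes p: "0 < p" "p < 1" and "\<And>x. x \<in> {0<..<p} \<Longrightarrow> a' x > 0" "\<And>x. x \<in> {p<..<1} \<Longrightarrow> a' x > 0"
  shows False
proof -
  obtain E F :: "real \<Rightarrow> real" where EF: "\<forall>x\<in>{0..1}. F (u x) \<le> E x" "\<forall>x\<in>{0..1}. v x = 0 \<longrightarrow> E x = F (u x)"
    "\<forall>s t. 0 \<le> s \<and> s < t \<and> t \<le> 1 \<and> (\<forall>x\<in>{s<..<t}. 0 < a' x) \<longrightarrow> E t < E s"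
    using energy by blast
  show False
  proof (rule no_isolated_left_end_level)
    fix x :: real assume x: "x \<in> {0<..1}"
    have "E x < E 0"
    proof (cases "x \<le> p")
      case True
      then show ?thesis using EF(3) x assms by auto
    next
      case False
      then have "E x < E p" "E p < E 0" using EF(3) x assms by auto
      then show ?thesis by simp
    qed
    moreover have "E 0 = F (u 0)" "F (u x) \<le> E x" using EF x v_bdry by auto
    ultimately show "u x \<noteq> u 0" by auto
  qed
qed

text \<open>The energy decreases and then increases, so its interior values lie below the larger of
  the two end values. The level of that end is not attained inside.\<close>

lemma separated_end_level:
  assumes p: "0 < p" "p < 1" and inc: "\<And>x. x \<in> {0<..<p} \<Longrightarrow> a' x > 0" and dec: "\<And>x. x \<in> {p<..<1} \<Longrightarrow> a' x < 0"
  shows "(\<forall>x\<in>{0<..<1}. u x \<noteq> u 0) \<or> (\<forall>x\<in>{0<..<1}. u x \<noteq> u 1)"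
proof -
  obtain E F :: "real \<Rightarrow> real" where EF: "\<forall>x\<in>{0..1}. F (u x) \<le> E x" "\<forall>x\<in>{0..1}. v x = 0 \<longrightarrow> E x = F (u x)"
    "\<forall>s t. 0 \<le> s \<and> s < t \<and> t \<le> 1 \<and> (\<forall>x\<in>{s<..<t}. 0 < a' x) \<longrightarrow> E t < E s"
    "\<forall>s t. 0 \<le> s \<and> s < t \<and> t \<le> 1 \<and> (\<forall>x\<in>{s<..<t}. a' x < 0) \<longrightarrow> E s < E t"
    using energy by blast
  have "E x < max (E 0) (E 1)" if x: "x \<in> {0<..<1}" for x
  proof (cases "x \<le> p")
    case True
    then have "E x < E 0" using EF(3) x inc by auto
    then show ?thesis by simp
  next
    case False
    then have "E x < E 1" using EF(4) x dec by auto
    then show ?thesis by simp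
  qed
  moreover have "E 0 = F (u 0)" "E 1 = F (u 1)" using EF(2) v_bdry by auto
  moreover have "F (u x) \<le> E x" if "x \<in> {0<..<1}" for x using EF(1) that by auto
  ultimately show ?thesis by (smt (verit))
qed

text \<open>Between \<open>y1\<close> and \<open>y2\<close> there is a critical point \<open>q\<close>, say \<open>q \<le> p\<close>. The level \<open>u q\<close> is attained once more
  between \<open>x1\<close> and \<open>y1\<close>, where the energy is smaller than at \<open>q\<close>, although at a critical point the energy is minimal
  for its level.\<close>

lemma nested_levels_impossible:
  fixes E F :: "real \<Rightarrow> real"
  assumes p: "0 < p" "p < 1" and dec: "\<And>x. x \<in> {0<..<p} \<Longrightarrow> a' x < 0" and inc: "\<And>x. x \<in> {p<..<1} \<Longrightarrow> a' x > 0"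
    and EF: "\<And>x. x \<in> {0..1} \<Longrightarrow> F (u x) \<le> E x" "\<And>x. x \<in> {0..1} \<Longrightarrow> v x = 0 \<Longrightarrow> E x = F (u x)"
      "\<And>s t. 0 \<le> s \<Longrightarrow> s < t \<Longrightarrow> t \<le> p \<Longrightarrow> E s < E t"
      "\<And>s t. p \<le> s \<Longrightarrow> s < t \<Longrightarrow> t \<le> 1 \<Longrightarrow> E t < E s"
    and x: "0 \<le> x1" "x1 < p" "p < x2" "x2 \<le> 1" "u x1 = P" "u x2 = P" "v x1 = 0" "v x2 = 0"
    and y: "0 \<le> y1" "y1 < p" "p < y2" "y2 \<le> 1" "u y1 = Q" "u y2 = Q" "v y1 = 0" "v y2 = 0"
    and less: "F P < F Q"
    and range: "\<And>x. x \<in> {0..1} \<Longrightarrow> u x \<in> closed_segment P Q"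
  shows False
proof -
  have E: "E x1 = F P" "E x2 = F P" "E y1 = F Q" "E y2 = F Q" using EF(2) x y by auto
  \<comment> \<open>At critical points the energy is the value of \<open>F\<close> at the level, and
    on \<open>{0..p}\<close> it increases. The level with the smaller value of \<open>F\<close>
    therefore lies farther out.\<close>
  have x1y1: "x1 < y1"
  proof (rule ccontr)
    assume "\<not> x1 < y1"
    then have "E y1 \<le> E x1" using EF(3)[of y1 x1] x y by (cases "x1 = y1") auto
    then show False using E less by simp
  qed
  have y2x2: "y2 < x2"
  proof (rule ccontr)
    assume "\<not> y2 < x2"
    then have "E y2 \<le> E x2" using EF(4)[of x2 y2] x y by (cases "x2 = y2") auto
    then show False using E less by simp
  qed
  have IVT: "\<exists>x\<in>{s..t}. u x = c" if "0 \<le> s" "s \<le> t" "t \<le> 1" "c \<in> closed_segment (u s) (u t)" for s t c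
  proof -
    have "continuous_on {s..t} u" by (rule continuous_on_subset[OF continuous(2)]) (use that in auto)
    then have "connected (u ` {s..t})" by (rule connected_continuous_image) simp
    then have "closed_segment (u s) (u t) \<subseteq> u ` {s..t}"
      using that by (intro closed_segment_subset) (auto simp: is_interval_connected_1 is_interval_convex_1[symmetric])
    then show ?thesis using that by blast
  qed
  have "\<exists>q>y1. q < y2 \<and> (\<lambda>h. v q / a q * h) = (\<lambda>v. 0)"
  proof (rule Rolle_deriv)
    show "continuous_on {y1..y2} u" by (rule continuous_on_subset[OF continuous(2)]) (use y in auto)
    fix z assume "y1 < z" "z < y2"
    then have "z \<in> {0<..<1}" using y by auto
    then have "(u has_real_derivative v z / a z) (at z)"
      using u_deriv[of z] by (simp add: at_within_Icc_at)
    then show "(u has_derivative (\<lambda>h. v z / a z * h)) (at z)" unfolding has_field_derivative_def .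
  qed (use y in auto)
  then obtain q where q: "y1 < q" "q < y2" "(\<lambda>h. v q / a q * h) = (\<lambda>v. 0)" by blast
  then have "v q / a q = 0" by (metis mult.right_neutral)
  then have vq: "v q = 0" using a_pos[of q] q y by auto
  have q01: "q \<in> {0..1}" using q y by auto
  have Eq: "E q = F (u q)" using EF(2)[OF q01 vq] .
  show False
  proof (cases "q \<le> p")
    case True
    have "\<exists>x\<in>{x1..y1}. u x = u q"
      using x y x1y1 range[OF q01] by (intro IVT) auto
    then obtain z where z: "z \<in> {x1..y1}" "u z = u q" by blast
    have "E z < E q" using EF(3)[of z q] z x q True by auto
    moreover have "F (u z) \<le> E z" using EF(1)[of z] z x y by auto
    ultimately show False using z Eq by simp
  next
    case False
    have "\<exists>x\<in>{y2..x2}. u x = u q"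
      using x y y2x2 range[OF q01] by (intro IVT) (auto simp: closed_segment_commute)
    then obtain z where z: "z \<in> {y2..x2}" "u z = u q" by blast
    have "E z < E q" using EF(4)[of q z] z x q False by auto
    moreover have "F (u z) \<le> E z" using EF(1)[of z] z x y by auto
    ultimately show False using z Eq by simp
  qed
qed

lemma extremum_critical:
  assumes x: "x \<in> {0..1}" and "(\<forall>y\<in>{0..1}. u y \<le> u x) \<or> (\<forall>y\<in>{0..1}. u x \<le> u y)"
  shows "v x = 0"
proof (cases "x \<in> {0<..<1}")
  case True
  then have d: "(u has_real_derivative v x / a x) (at x)"
    using u_deriv[of x] by (simp add: at_within_Icc_at)
  define e where "e = min x (1 - x)"
  have e: "e > 0" "\<And>y. \<bar>x - y\<bar> < e \<Longrightarrow> y \<in> {0..1}" using True by (auto simp: e_def)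
  from assms(2) have "v x / a x = 0"
  proof
    assume "\<forall>y\<in>{0..1}. u y \<le> u x"
    then show ?thesis using e by (intro DERIV_local_max[OF d e(1)]) auto
  next
    assume "\<forall>y\<in>{0..1}. u x \<le> u y"
    then show ?thesis using e by (intro DERIV_local_min[OF d e(1)]) auto
  qed
  then show ?thesis using a_pos[OF x] by auto
next
  case False
  then have "x = 0 \<or> x = 1" using x by auto
  then show ?thesis using v_bdry by auto
qed

text \<open>Otherwise the maximal and the minimal level are both attained twice. On each of them two
  points straddle \<open>p\<close>, so that the two pairs are nested.\<close>

lemma unique_extremum:
  assumes p: "0 < p" "p < 1" and dec: "\<And>x. x \<in> {0<..<p} \<Longrightarrow> a' x < 0" and inc: "\<And>x. x \<in> {p<..<1} \<Longrightarrow> a' x > 0"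
  shows "\<exists>x0\<in>{0..1}. v x0 = 0 \<and> (\<forall>x\<in>{0..1}. x \<noteq> x0 \<longrightarrow> u x \<noteq> u x0)"
proof (rule ccontr)
  assume neg: "\<not> ?thesis"
  obtain E F :: "real \<Rightarrow> real" where EF: "\<forall>x\<in>{0..1}. F (u x) \<le> E x" "\<forall>x\<in>{0..1}. v x = 0 \<longrightarrow> E x = F (u x)"
    "\<forall>s t. 0 \<le> s \<and> s < t \<and> t \<le> 1 \<and> (\<forall>x\<in>{s<..<t}. 0 < a' x) \<longrightarrow> E t < E s"
    "\<forall>s t. 0 \<le> s \<and> s < t \<and> t \<le> 1 \<and> (\<forall>x\<in>{s<..<t}. a' x < 0) \<longrightarrow> E s < E t"
    using energy by blast
  have Einc: "E s < E t" if "0 \<le> s" "s < t" "t \<le> p" for s t using EF(4) that p dec by auto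
  have Edec: "E t < E s" if "p \<le> s" "s < t" "t \<le> 1" for s t using EF(3) that p inc by auto
  have "\<exists>x\<in>{0..1}. \<forall>y\<in>{0..1}. u y \<le> u x" by (rule continuous_attains_sup) (use continuous in auto)
  then obtain xM where xM: "xM \<in> {0..1}" "\<And>y. y \<in> {0..1} \<Longrightarrow> u y \<le> u xM" by blast
  have "\<exists>x\<in>{0..1}. \<forall>y\<in>{0..1}. u x \<le> u y" by (rule continuous_attains_inf) (use continuous in auto)
  then obtain xm where xm: "xm \<in> {0..1}" "\<And>y. y \<in> {0..1} \<Longrightarrow> u xm \<le> u y" by blast
  \<comment> \<open>Two critical points on one level have equal energy, but the energy is injective
    on each side of \<open>p\<close>.\<close>
  have pair: "\<exists>x1 x2. 0 \<le> x1 \<and> x1 < p \<and> p < x2 \<and> x2 \<le> 1 \<and> u x1 = P \<and> u x2 = P \<and> v x1 = 0 \<and> v x2 = 0"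
    if z: "z \<in> {0..1}" "u z = P" and crit: "\<And>x. x \<in> {0..1} \<Longrightarrow> u x = P \<Longrightarrow> v x = 0" for z P
  proof -
    obtain w where w: "w \<in> {0..1}" "w \<noteq> z" "u w = P" using neg crit[OF z] z by blast
    define x1 where "x1 = min z w"
    define x2 where "x2 = max z w"
    have x: "x1 < x2" "x1 \<in> {0..1}" "x2 \<in> {0..1}" "u x1 = P" "u x2 = P"
      using w z by (auto simp: x1_def x2_def min_def max_def)
    have v: "v x1 = 0" "v x2 = 0" using crit x by auto
    have "E x1 = E x2" using EF(2) x v by auto
    then have "x1 < p" "p < x2" using Einc[of x1 x2] Edec[of x1 x2] x by (cases "x1 < p"; cases "p < x2"; force)+
    then show ?thesis using x v by auto
  qed
  have critM: "v x = 0" if "x \<in> {0..1}" "u x = u xM" for x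
    using extremum_critical[of x] that xM by auto
  have critm: "v x = 0" if "x \<in> {0..1}" "u x = u xm" for x
    using extremum_critical[of x] that xm by auto
  obtain x1 x2 where x: "0 \<le> x1" "x1 < p" "p < x2" "x2 \<le> 1" "u x1 = u xM" "u x2 = u xM" "v x1 = 0" "v x2 = 0"
    using pair[OF xM(1) refl critM] by blast
  obtain y1 y2 where y: "0 \<le> y1" "y1 < p" "p < y2" "y2 \<le> 1" "u y1 = u xm" "u y2 = u xm" "v y1 = 0" "v y2 = 0"
    using pair[OF xm(1) refl critm] by blast
  have EF': "\<And>x. x \<in> {0..1} \<Longrightarrow> F (u x) \<le> E x" "\<And>x. x \<in> {0..1} \<Longrightarrow> v x = 0 \<Longrightarrow> E x = F (u x)" using EF by auto
  have r: "u x \<in> closed_segment (u xM) (u xm)" "u x \<in> closed_segment (u xm) (u xM)" if "x \<in> {0..1}" for x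
    using xM(2)[OF that] xm(2)[OF that] by (simp_all add: closed_segment_eq_real_ivl)
  consider "F (u xM) < F (u xm)" | "F (u xm) < F (u xM)" | "F (u xM) = F (u xm)" by linarith
  then show False
  proof cases
    case 1
    show False by (rule nested_levels_impossible[OF p dec inc EF' Einc Edec x y 1 r(1)])
  next
    case 2
    show False by (rule nested_levels_impossible[OF p dec inc EF' Einc Edec y x 2 r(2)])
  next
    \<comment> \<open>Equal energies to the left of \<open>p\<close> force the same point, so
      maximum and minimum of \<open>u\<close> coincide.\<close>
    case 3
    have "E x1 = E y1" using EF'(2) x y 3 by auto
    then have "x1 = y1" using Einc[of x1 y1] Einc[of y1 x1] x y by (cases x1 y1 rule: linorder_cases) auto
    then have "u xM = u xm" using x y by simp
    then have "u x = u xM" if "x \<in> {0..1}" for x using xM(2)[OF that] xm(2)[OF that] by simp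
    then show False using u_nonconst by metis
  qed
qed

text \<open>Analyticity extends the local evenness about \<open>p\<close> to
  \<open>{0..2*p}\<close>, the largest interval symmetric about \<open>p\<close>. For
  \<open>p = 1/2\<close> this is the excluded evenness of \<open>a\<close>; for smaller
  \<open>p\<close> the even part is split off.\<close>

lemma no_even_extremum_in_left_half:
  assumes p: "0 < p" "p < 1" and an: "real_analytic_on a {0..1}" and odd: "\<not> even_about_half a"
    and dec: "\<And>x. x \<in> {0<..<p} \<Longrightarrow> a' x < 0" and inc: "\<And>x. x \<in> {p<..<1} \<Longrightarrow> a' x > 0"
    and crit: "v p = 0" "\<phi> p = 0" and loc: "\<delta> > 0" "\<And>s. \<bar>s\<bar> < \<delta> \<Longrightarrow> a (p + s) = a (p - s)"
    and half: "p \<le> 1/2"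
  shows False
proof -
  have even: "a (2 * p - 1 * y) = 1 * a y" if y: "y \<in> {0..2*p}" for y
  proof (rule analytic_affine_symmetry[OF an _ _ _ _ _ y, of p "min (p + \<delta>) (2 * p)"])
    fix y assume "y \<in> {p<..<min (p + \<delta>) (2 * p)}"
    then show "a (2 * p - 1 * y) = 1 * a y" using loc(2)[of "y - p"] by simp
  qed (use p half loc(1) in auto)
  show False
  proof (cases "p = 1/2")
    case True
    have "a x = a (1 - x)" if "x \<in> {0..1}" for x
      using even[of x] that True by simp
    then show False using odd unfolding even_about_half_def by blast
  next
    case False
    then show False using no_even_left_part[of p] p half inc even crit by simp
  qed
qed

end

lemma real_analytic_on_reflected: "real_analytic_on a {0..1} \<Longrightarrow> real_analytic_on (\<lambda>x. a (1 - x)) {0..1}"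
  using real_analytic_on_affine[of a "{0..1}" "{0..1}" 1 "-1"] by simp

lemma even_about_half_reflected: "even_about_half (\<lambda>x. a (1 - x)) \<longleftrightarrow> even_about_half a"
  by (auto simp: even_about_half_def)

theorem (in kernel_pair) no_orthogonal_kernel:
  assumes p: "0 < p" "p < 1" and an: "real_analytic_on a {0..1}" and odd: "\<not> even_about_half a"
    and left: "(\<forall>x\<in>{0<..<p}. a' x > 0) \<or> (\<forall>x\<in>{0<..<p}. a' x < 0)"
    and right: "(\<forall>x\<in>{p<..<1}. a' x > 0) \<or> (\<forall>x\<in>{p<..<1}. a' x < 0)"
  shows False
proof -
  interpret R: kernel_pair "\<lambda>x. a (1 - x)" "\<lambda>x. - a' (1 - x)" f f' "\<lambda>x. u (1 - x)" "\<lambda>x. - v (1 - x)"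
     "\<lambda>x. \<phi> (1 - x)" "\<lambda>x. - \<psi> (1 - x)" by (rule reflected)
  have an': "real_analytic_on (\<lambda>x. a (1 - x)) {0..1}" by (rule real_analytic_on_reflected[OF an])
  have odd': "\<not> even_about_half (\<lambda>x. a (1 - x))" using odd by (simp add: even_about_half_reflected)
  consider (pp) "\<forall>x\<in>{0<..<p}. a' x > 0" "\<forall>x\<in>{p<..<1}. a' x > 0"
    | (nn) "\<forall>x\<in>{0<..<p}. a' x < 0" "\<forall>x\<in>{p<..<1}. a' x < 0"
    | (pn) "\<forall>x\<in>{0<..<p}. a' x > 0" "\<forall>x\<in>{p<..<1}. a' x < 0"
    | (np) "\<forall>x\<in>{0<..<p}. a' x < 0" "\<forall>x\<in>{p<..<1}. a' x > 0"
    using left right by blast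
  then show False
  proof cases
    case pp
    then show False using no_increasing_diffusion[OF p] by blast
  next
    case nn
    show False by (rule R.no_increasing_diffusion[of "1 - p"]) (use nn p in auto)
  next
    case pn
    have "(\<forall>x\<in>{0<..<1}. u x \<noteq> u 0) \<or> (\<forall>x\<in>{0<..<1}. u x \<noteq> u 1)"
      using separated_end_level[OF p] pn by blast
    then show False
    proof
      assume "\<forall>x\<in>{0<..<1}. u x \<noteq> u 0"
      then show False using no_separated_left_end_level[OF an odd] by blast
    next
      assume "\<forall>x\<in>{0<..<1}. u x \<noteq> u 1"
      then show False by (intro R.no_separated_left_end_level[OF an' odd']) auto
    qed
  next
    case np
    obtain x0 where x0: "x0 \<in> {0..1}" "v x0 = 0" "\<And>x. x \<in> {0..1} \<Longrightarrow> x \<noteq> x0 \<Longrightarrow> u x \<noteq> u x0"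
      using unique_extremum[OF p] np by blast
    consider "x0 = 0" | "x0 = 1" | "x0 \<in> {0<..<1}" using x0(1) by force
    then show False
    proof cases
      case 1
      show False by (rule no_isolated_left_end_level) (use x0 1 in auto)
    next
      case 2
      show False by (rule R.no_isolated_left_end_level) (use x0 2 in auto)
    next
      case 3
      obtain \<delta> where \<delta>: "\<delta> > 0" "\<And>s. \<bar>s\<bar> < \<delta> \<Longrightarrow> x0 + s \<in> {0..1} \<and> a (x0 + s) = a (x0 - s)"
        and \<phi>0: "\<phi> x0 = 0"
        using unique_interior_level[OF 3 x0(2,3)] by metis
      \<comment> \<open>A function even about \<open>x0\<close> is not strictly monotone around
        \<open>x0\<close>, so the extremum can only sit at the turning point
        \<open>p\<close>.\<close>
      have strict: "\<not> ((\<forall>x\<in>{x0-s<..<x0+s}. a' x < 0) \<or> (\<forall>x\<in>{x0-s<..<x0+s}. a' x > 0))"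
        if s: "0 < s" "s < \<delta>" for s
      proof -
        have in01: "x0 + s \<in> {0..1}" "x0 - s \<in> {0..1}" using \<delta>(2)[of s] \<delta>(2)[of "- s"] s by auto
        have d: "(a has_real_derivative a' z) (at z)" if "x0 - s < z" "z < x0 + s" for z
          using a_deriv[of z] that in01 by (simp add: at_within_Icc_at)
        have c: "continuous_on {x0-s..x0+s} a"
          by (rule continuous_on_subset[OF continuous(1)]) (use in01 in auto)
        have eq: "a (x0 + s) = a (x0 - s)" using \<delta>(2)[of s] s by simp
        show ?thesis
        proof
          assume "(\<forall>x\<in>{x0-s<..<x0+s}. a' x < 0) \<or> (\<forall>x\<in>{x0-s<..<x0+s}. a' x > 0)"
          then show False
          proof
            assume "\<forall>x\<in>{x0-s<..<x0+s}. a' x < 0"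
            then have "a (x0 + s) < a (x0 - s)"
              by (intro DERIV_neg_imp_decreasing_open[OF _ _ c]) (use d s in \<open>force+\<close>)
            then show False using eq by simp
          next
            assume "\<forall>x\<in>{x0-s<..<x0+s}. a' x > 0"
            then have "a (x0 - s) < a (x0 + s)"
              by (intro DERIV_pos_imp_increasing_open[OF _ _ c]) (use d s in \<open>force+\<close>)
            then show False using eq by simp
          qed
        qed
      qed
      have x0p: "x0 = p"
      proof (rule ccontr)
        assume ne: "x0 \<noteq> p"
        define s where "s = min \<delta> (min (min x0 (1 - x0)) \<bar>x0 - p\<bar>) / 2"
        have s: "0 < s" "s < \<delta>" "s < x0" "s < 1 - x0" "s < \<bar>x0 - p\<bar>"
          using \<delta>(1) 3 ne by (auto simp: s_def min_def)
        show False
          using strict[OF s(1,2)] np s by (cases "x0 < p") (auto simp: abs_if split: if_splits)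
      qed
      show False
      proof (cases "p \<le> 1/2")
        case True
        show False
          by (rule no_even_extremum_in_left_half[OF p an odd _ _ _ _ \<delta>(1) _ True])
            (use np x0 x0p \<phi>0 \<delta> in auto)
      next
        case False
        show False
        proof (rule R.no_even_extremum_in_left_half[OF _ _ an' odd' _ _ _ _ \<delta>(1), of "1 - p"])
          show "a (1 - (1 - p + s)) = a (1 - (1 - p - s))" if "\<bar>s\<bar> < \<delta>" for s
            using \<delta>(2)[OF that] x0p by (simp add: algebra_simps)
        qed (use np x0 x0p \<phi>0 p False in auto)
      qed
    qed
  qed
qed

section \<open>Continuous dependence of degenerate equilibria\<close>

lemma C2S_iff:
  "f \<in> C2S \<longleftrightarrow> f 0 = 0 \<and> (\<exists>f' f''. (\<forall>x. (f has_real_derivative f' x) (at x)) \<and>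
     (\<forall>x. (f' has_real_derivative f'' x) (at x)) \<and> continuous_on UNIV f'')"
  (is "_ \<longleftrightarrow> ?R")
proof
  assume f: "f \<in> C2S"
  then show ?R unfolding C2S_def
    by (intro conjI exI[where x = "deriv f"] exI[where x = "deriv (deriv f)"])
      (simp_all add: DERIV_deriv_iff_real_differentiable)
next
  assume ?R
  then obtain f' f'' where f: "f 0 = 0" "\<And>x. (f has_real_derivative f' x) (at x)"
     "\<And>x. (f' has_real_derivative f'' x) (at x)" "continuous_on UNIV f''" by blast
  have "deriv f = f'" "deriv f' = f''" using f by (auto intro: DERIV_imp_deriv)
  then show "f \<in> C2S" using f unfolding C2S_def
    by (auto simp: real_differentiable_def)
qed

lemma C2S_derivs:
  assumes "f \<in> C2S"
  shows "(f has_real_derivative deriv f x) (at x)" "(deriv f has_real_derivative deriv (deriv f) x) (at x)"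
    "continuous_on S f" "continuous_on S (deriv f)" "continuous_on S (deriv (deriv f))" "f 0 = 0"
proof -
  show 1: "(f has_real_derivative deriv f x) (at x)" "(deriv f has_real_derivative deriv (deriv f) x) (at x)" for x
    using assms by (auto simp: C2S_def DERIV_deriv_iff_real_differentiable)
  show "continuous_on S f" "continuous_on S (deriv f)"
    by (rule DERIV_continuous_on, rule has_field_derivative_at_within, rule 1)+
  show "continuous_on S (deriv (deriv f))" "f 0 = 0"
    using assms continuous_on_subset by (auto simp: C2S_def)
qed

lemma C2S_add_scaled:
  assumes "f \<in> C2S" "h \<in> C2S"
  shows "(\<lambda>x. f x + t * h x) \<in> C2S" "deriv (\<lambda>x. f x + t * h x) = (\<lambda>x. deriv f x + t * deriv h x)"
    "deriv (deriv (\<lambda>x. f x + t * h x)) = (\<lambda>x. deriv (deriv f) x + t * deriv (deriv h) x)"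
proof -
  have 1: "((\<lambda>x. f x + t * h x) has_real_derivative deriv f x + t * deriv h x) (at x)" for x
    using C2S_derivs[OF assms(1)] C2S_derivs[OF assms(2)] by (auto intro!: derivative_eq_intros)
  have 2: "((\<lambda>x. deriv f x + t * deriv h x) has_real_derivative deriv (deriv f) x + t * deriv (deriv h) x) (at x)" for x
    using C2S_derivs[OF assms(1)] C2S_derivs[OF assms(2)] by (auto intro!: derivative_eq_intros)
  have 3: "continuous_on UNIV (\<lambda>x. deriv (deriv f) x + t * deriv (deriv h) x)"
    by (intro continuous_intros C2S_derivs assms)
  show "(\<lambda>x. f x + t * h x) \<in> C2S"
    unfolding C2S_iff using 1 2 3 C2S_derivs(6)[OF assms(1)] C2S_derivs(6)[OF assms(2)]
    by (intro conjI exI[of _ "\<lambda>x. deriv f x + t * deriv h x"] exI[of _ "\<lambda>x. deriv (deriv f) x + t * deriv (deriv h) x"]) auto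
  show d: "deriv (\<lambda>x. f x + t * h x) = (\<lambda>x. deriv f x + t * deriv h x)"
    using 1 by (auto intro: DERIV_imp_deriv)
  show "deriv (deriv (\<lambda>x. f x + t * h x)) = (\<lambda>x. deriv (deriv f) x + t * deriv (deriv h) x)"
    unfolding d using 2 by (auto intro: DERIV_imp_deriv)
qed

lemma abs_diff_le_of_deriv:
  fixes g :: "real \<Rightarrow> real"
  assumes "\<And>x. (g has_real_derivative g' x) (at x)" "\<And>x. \<bar>x\<bar> \<le> n \<Longrightarrow> \<bar>g' x\<bar> \<le> L" "\<bar>s\<bar> \<le> n" "\<bar>t\<bar> \<le> n"
  shows "\<bar>g s - g t\<bar> \<le> L * \<bar>s - t\<bar>"
proof -
  have "norm (g s - g t) \<le> L * norm (s - t)"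
    by (rule field_differentiable_bound[of "{-n..n}" g g'])
      (use assms in \<open>auto simp: abs_le_iff intro: has_field_derivative_at_within\<close>)
  then show ?thesis by simp
qed

text \<open>The mean value inequality is used twice, for \<open>g'\<close> and for \<open>g\<close>
  minus its tangent; this is the origin of the factor \<open>L\<close>.\<close>

lemma quadratic_taylor_bound:
  fixes g :: "real \<Rightarrow> real"
  assumes g: "\<And>x. (g has_real_derivative g' x) (at x)" "\<And>x. (g' has_real_derivative g'' x) (at x)"
    and b: "\<And>x. \<bar>x\<bar> \<le> n \<Longrightarrow> \<bar>g'' x\<bar> \<le> L" and st: "\<bar>s\<bar> \<le> n" "\<bar>t\<bar> \<le> n"
  shows "\<bar>g t - g s - g' s * (t - s)\<bar> \<le> L * (t - s)\<^sup>2"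
proof -
  have L: "0 \<le> L" using b[of 0] st by force
  let ?k = "\<lambda>x. g x - g' s * x"
  have seg: "\<bar>x\<bar> \<le> n \<and> \<bar>x - s\<bar> \<le> \<bar>t - s\<bar>" if "x \<in> closed_segment s t" for x
    using that st by (auto simp: closed_segment_eq_real_ivl split: if_splits)
  have "norm (?k t - ?k s) \<le> L * \<bar>t - s\<bar> * norm (t - s)"
  proof (rule field_differentiable_bound[of "closed_segment s t" ?k "\<lambda>x. g' x - g' s"])
    fix x assume x: "x \<in> closed_segment s t"
    show "(?k has_real_derivative g' x - g' s) (at x within closed_segment s t)"
      by (auto intro!: derivative_eq_intros has_field_derivative_at_within[OF g(1)])
    have "\<bar>g' x - g' s\<bar> \<le> L * \<bar>x - s\<bar>"
      using seg[OF x] st by (intro abs_diff_le_of_deriv[OF g(2) b]) auto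
    also have "\<dots> \<le> L * \<bar>t - s\<bar>" using seg[OF x] L by (intro mult_left_mono) auto
    finally show "norm (g' x - g' s) \<le> L * \<bar>t - s\<bar>" by simp
  qed auto
  moreover have "?k t - ?k s = g t - g s - g' s * (t - s)" by (simp add: algebra_simps)
  moreover have "L * \<bar>t - s\<bar> * norm (t - s) = L * (t - s)\<^sup>2"
    by (simp add: mult.assoc power2_eq_square)
  ultimately show ?thesis by (simp only: real_norm_def)
qed

text \<open>Square roots are avoided by bounding \<open>exp K\<close> by
  \<open>exp K * exp K\<close> and the sum of squares at \<open>0\<close> by the square of the sum,
  using \<open>z 0 = 0\<close>.\<close>

lemma gronwall_linear:
  fixes w z r a :: "real \<Rightarrow> real"
  assumes w: "\<And>x. x \<in> {0..1} \<Longrightarrow> (w has_real_derivative z x / a x) (at x within {0..1})"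
    and z: "\<And>x. x \<in> {0..1} \<Longrightarrow> (z has_real_derivative r x) (at x within {0..1})"
    and r: "\<And>x. x \<in> {0..1} \<Longrightarrow> \<bar>r x\<bar> \<le> L * \<bar>w x\<bar> + \<epsilon>"
    and a: "\<And>x. x \<in> {0..1} \<Longrightarrow> \<bar>1 / a x\<bar> \<le> A"
    and nn: "0 \<le> L" "0 \<le> \<epsilon>" and z0: "z 0 = 0" and x: "x \<in> {0..1}"
  shows "\<bar>w x\<bar> \<le> exp (A + L + 1) * (\<bar>w 0\<bar> + \<epsilon>)" "\<bar>z x\<bar> \<le> exp (A + L + 1) * (\<bar>w 0\<bar> + \<epsilon>)"
proof -
  define K where "K = A + L + 1"
  have "0 \<le> A" using a[OF x] by linarith
  then have K: "0 \<le> K" using nn by (simp add: K_def)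
  have "(w x)\<^sup>2 + (z x)\<^sup>2 + \<epsilon>\<^sup>2 \<le> exp (K * \<bar>x - 0\<bar>) * ((w 0)\<^sup>2 + (z 0)\<^sup>2 + \<epsilon>\<^sup>2)"
    unfolding K_def
    by (rule gronwall_system[where s = 0 and t = 1 and a = a and r = r]) (use w z r a nn x in auto)
  also have "\<dots> \<le> (exp K * exp K) * (\<bar>w 0\<bar> + \<epsilon>)\<^sup>2"
  proof (rule mult_mono)
    have "K * \<bar>x - 0\<bar> \<le> K * 1" using K x by (intro mult_left_mono) auto
    then show "exp (K * \<bar>x - 0\<bar>) \<le> exp K * exp K" using K by (simp add: exp_add[symmetric])
    show "(w 0)\<^sup>2 + (z 0)\<^sup>2 + \<epsilon>\<^sup>2 \<le> (\<bar>w 0\<bar> + \<epsilon>)\<^sup>2" using z0 nn by (simp add: power2_sum)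
  qed auto
  also have "\<dots> = (exp K * (\<bar>w 0\<bar> + \<epsilon>))\<^sup>2" by (simp add: power2_eq_square)
  finally have *: "(w x)\<^sup>2 + (z x)\<^sup>2 + \<epsilon>\<^sup>2 \<le> (exp K * (\<bar>w 0\<bar> + \<epsilon>))\<^sup>2" .
  have "\<bar>w x\<bar>\<^sup>2 \<le> (exp K * (\<bar>w 0\<bar> + \<epsilon>))\<^sup>2" "\<bar>z x\<bar>\<^sup>2 \<le> (exp K * (\<bar>w 0\<bar> + \<epsilon>))\<^sup>2"
    using * zero_le_power2[of "w x"] zero_le_power2[of "z x"] zero_le_power2[of \<epsilon>] by (simp_all, linarith+)
  then show "\<bar>w x\<bar> \<le> exp (A + L + 1) * (\<bar>w 0\<bar> + \<epsilon>)" "\<bar>z x\<bar> \<le> exp (A + L + 1) * (\<bar>w 0\<bar> + \<epsilon>)"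
    unfolding K_def[symmetric] using nn by (auto intro: power2_le_imp_le)
qed

text \<open>The source \<open>g\<close> is a function of \<open>x\<close>, so that one notion covers
  equilibria, kernels of linearizations and Neumann eigenfunctions.\<close>

definition equilibrium_flux :: "(real \<Rightarrow> real) \<Rightarrow> (real \<Rightarrow> real) \<Rightarrow> (real \<Rightarrow> real) \<Rightarrow> (real \<Rightarrow> real) \<Rightarrow> bool" where
  "equilibrium_flux a g u v \<longleftrightarrow>
     (\<forall>x\<in>{0..1}. (u has_real_derivative v x / a x) (at x within {0..1})) \<and>
     (\<forall>x\<in>{0..1}. (v has_real_derivative - g x) (at x within {0..1})) \<and> v 0 = 0 \<and> v 1 = 0"

lemma equilibrium_fluxD:
  assumes "equilibrium_flux a g u v"
  shows "\<And>x. x \<in> {0..1} \<Longrightarrow> (u has_real_derivative v x / a x) (at x within {0..1})"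
    "\<And>x. x \<in> {0..1} \<Longrightarrow> (v has_real_derivative - g x) (at x within {0..1})" "v 0 = 0" "v 1 = 0"
    "continuous_on {0..1} u" "continuous_on {0..1} v"
  using assms unfolding equilibrium_flux_def by (auto intro: DERIV_continuous_on)

text \<open>The normalization \<open>\<phi> 0 = 1\<close> loses nothing: \<open>\<phi> 0 = 0\<close> and \<open>\<psi> 0 = 0\<close> would force \<open>\<phi> = 0\<close>.\<close>

definition degenerate_pair ::
    "(real \<Rightarrow> real) \<Rightarrow> (real \<Rightarrow> real) \<Rightarrow> real \<Rightarrow> (real \<Rightarrow> real) \<Rightarrow> (real \<Rightarrow> real) \<Rightarrow> (real \<Rightarrow> real) \<Rightarrow> (real \<Rightarrow> real) \<Rightarrow> bool" where
  "degenerate_pair a f n u v \<phi> \<psi> \<longleftrightarrow>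
     equilibrium_flux a (\<lambda>x. f (u x)) u v \<and> equilibrium_flux a (\<lambda>x. deriv f (u x) * \<phi> x) \<phi> \<psi> \<and>
     \<phi> 0 = 1 \<and> (\<forall>x\<in>{0..1}. \<bar>u x\<bar> \<le> n)"

lemma degenerate_pairD:
  assumes "degenerate_pair a f n u v \<phi> \<psi>"
  shows "equilibrium_flux a (\<lambda>x. f (u x)) u v" "equilibrium_flux a (\<lambda>x. deriv f (u x) * \<phi> x) \<phi> \<psi>"
    "\<phi> 0 = 1" "\<And>x. x \<in> {0..1} \<Longrightarrow> \<bar>u x\<bar> \<le> n"
  using assms unfolding degenerate_pair_def by auto

text \<open>As \<open>v 0 = 0\<close>, the value \<open>u 0\<close> determines the solution. It is
  the one real parameter on which compactness and counting act.\<close>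

definition degenerate_in :: "(real \<Rightarrow> real) \<Rightarrow> real \<Rightarrow> real set \<Rightarrow> (real \<Rightarrow> real) \<Rightarrow> bool" where
  "degenerate_in a n J f \<longleftrightarrow> (\<exists>u v \<phi> \<psi>. degenerate_pair a f n u v \<phi> \<psi> \<and> u 0 \<in> J)"

text \<open>Equilibria bounded by \<open>n\<close> and their linearizations only see the
  nonlinearity and its first derivative on \<open>{-n..n}\<close>.\<close>

definition C1_close :: "real \<Rightarrow> real \<Rightarrow> (real \<Rightarrow> real) \<Rightarrow> (real \<Rightarrow> real) \<Rightarrow> bool" where
  "C1_close n \<delta> f g \<longleftrightarrow> (\<forall>x. \<bar>x\<bar> \<le> n \<longrightarrow> \<bar>f x - g x\<bar> \<le> \<delta> \<and> \<bar>deriv f x - deriv g x\<bar> \<le> \<delta>)"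

lemma bounded_on_symmetric_interval:
  fixes g :: "real \<Rightarrow> real"
  assumes "continuous_on UNIV g"
  obtains B where "B > 0" "\<And>x. \<bar>x\<bar> \<le> n \<Longrightarrow> \<bar>g x\<bar> \<le> B"
proof -
  obtain B where "B > 0" "\<And>x. x \<in> {-n..n} \<Longrightarrow> \<bar>g x\<bar> \<le> B"
    using continuous_on_Icc_bounded[OF continuous_on_subset[OF assms]] by blast
  then show ?thesis by (intro that[of B]) (auto simp: abs_le_iff)
qed

lemma equilibrium_distance:
  assumes 1: "equilibrium_flux a (\<lambda>x. f (u1 x)) u1 v1" and 2: "equilibrium_flux a (\<lambda>x. g (u2 x)) u2 v2"
    and b: "\<And>x. x \<in> {0..1} \<Longrightarrow> \<bar>u1 x\<bar> \<le> n" "\<And>x. x \<in> {0..1} \<Longrightarrow> \<bar>u2 x\<bar> \<le> n"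
    and a: "\<And>x. x \<in> {0..1} \<Longrightarrow> \<bar>1 / a x\<bar> \<le> A"
    and f: "f \<in> C2S" "\<And>x. \<bar>x\<bar> \<le> n \<Longrightarrow> \<bar>deriv f x\<bar> \<le> L"
    and fg: "\<And>x. \<bar>x\<bar> \<le> n \<Longrightarrow> \<bar>f x - g x\<bar> \<le> \<epsilon>" and x: "x \<in> {0..1}"
  shows "\<bar>u1 x - u2 x\<bar> \<le> exp (A + L + 1) * (\<bar>u1 0 - u2 0\<bar> + \<epsilon>)"
    "\<bar>v1 x - v2 x\<bar> \<le> exp (A + L + 1) * (\<bar>u1 0 - u2 0\<bar> + \<epsilon>)"
proof -
  have nn: "0 \<le> L" "0 \<le> \<epsilon>" using f(2)[OF b(1)[OF x]] fg[OF b(1)[OF x]] by linarith+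
  have r: "\<bar>- f (u1 x) - - g (u2 x)\<bar> \<le> L * \<bar>u1 x - u2 x\<bar> + \<epsilon>" if x: "x \<in> {0..1}" for x
  proof -
    have "\<bar>f (u1 x) - f (u2 x)\<bar> \<le> L * \<bar>u1 x - u2 x\<bar>"
      by (rule abs_diff_le_of_deriv[OF C2S_derivs(1)[OF f(1)] f(2) b(1)[OF x] b(2)[OF x]])
    moreover have "\<bar>f (u2 x) - g (u2 x)\<bar> \<le> \<epsilon>" by (rule fg[OF b(2)[OF x]])
    ultimately show ?thesis by linarith
  qed
  have d: "((\<lambda>x. u1 x - u2 x) has_real_derivative (v1 x - v2 x) / a x) (at x within {0..1})"
    "((\<lambda>x. v1 x - v2 x) has_real_derivative - f (u1 x) - - g (u2 x)) (at x within {0..1})" if "x \<in> {0..1}" for x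
    using DERIV_diff[OF equilibrium_fluxD(1)[OF 1 that] equilibrium_fluxD(1)[OF 2 that]]
      DERIV_diff[OF equilibrium_fluxD(2)[OF 1 that] equilibrium_fluxD(2)[OF 2 that]]
    by (simp_all add: diff_divide_distrib)
  have z: "v1 0 - v2 0 = 0" using equilibrium_fluxD(3)[OF 1] equilibrium_fluxD(3)[OF 2] by simp
  note G = gronwall_linear[of "\<lambda>x. u1 x - u2 x" "\<lambda>x. v1 x - v2 x" a, OF d r a nn z x]
  show "\<bar>u1 x - u2 x\<bar> \<le> exp (A + L + 1) * (\<bar>u1 0 - u2 0\<bar> + \<epsilon>)"
    "\<bar>v1 x - v2 x\<bar> \<le> exp (A + L + 1) * (\<bar>u1 0 - u2 0\<bar> + \<epsilon>)"
    using G by auto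
qed

lemma kernel_bound:
  assumes 1: "equilibrium_flux a (\<lambda>x. c x * \<phi> x) \<phi> \<psi>" "\<phi> 0 = 1"
    and a: "\<And>x. x \<in> {0..1} \<Longrightarrow> \<bar>1 / a x\<bar> \<le> A" and c: "\<And>x. x \<in> {0..1} \<Longrightarrow> \<bar>c x\<bar> \<le> L" and x: "x \<in> {0..1}"
  shows "\<bar>\<phi> x\<bar> \<le> exp (A + L + 1)"
proof -
  have "0 \<le> L" using c[OF x] by linarith
  moreover have "\<bar>- (c x * \<phi> x)\<bar> \<le> L * \<bar>\<phi> x\<bar> + 0" if "x \<in> {0..1}" for x
    using c[OF that] by (simp add: abs_mult mult_right_mono)
  ultimately have "\<bar>\<phi> x\<bar> \<le> exp (A + L + 1) * (\<bar>\<phi> 0\<bar> + 0)"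
    using equilibrium_fluxD[OF 1(1)] a x by (intro gronwall_linear(1)[where z = \<psi> and a = a]) auto
  then show ?thesis using 1 by simp
qed

text \<open>The difference solves the equation with the extra source
  \<open>(c1 - c2) \<phi>2\<close>. Its bound costs one exponential factor and the Gronwall estimate
  another, hence the square.\<close>

lemma kernel_distance:
  assumes 1: "equilibrium_flux a (\<lambda>x. c1 x * \<phi>1 x) \<phi>1 \<psi>1" "\<phi>1 0 = 1"
    and 2: "equilibrium_flux a (\<lambda>x. c2 x * \<phi>2 x) \<phi>2 \<psi>2" "\<phi>2 0 = 1"
    and a: "\<And>x. x \<in> {0..1} \<Longrightarrow> \<bar>1 / a x\<bar> \<le> A"
    and c: "\<And>x. x \<in> {0..1} \<Longrightarrow> \<bar>c1 x\<bar> \<le> L" "\<And>x. x \<in> {0..1} \<Longrightarrow> \<bar>c2 x\<bar> \<le> L"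
      "\<And>x. x \<in> {0..1} \<Longrightarrow> \<bar>c1 x - c2 x\<bar> \<le> \<eta>"
    and x: "x \<in> {0..1}"
  shows "\<bar>\<phi>1 x - \<phi>2 x\<bar> \<le> (exp (A + L + 1))\<^sup>2 * \<eta>" "\<bar>\<psi>1 x - \<psi>2 x\<bar> \<le> (exp (A + L + 1))\<^sup>2 * \<eta>"
proof -
  define K where "K = exp (A + L + 1)"
  have nn: "0 \<le> L" "0 \<le> \<eta>" using c(1,3)[OF x] by linarith+
  have r: "\<bar>- (c1 x * \<phi>1 x) - - (c2 x * \<phi>2 x)\<bar> \<le> L * \<bar>\<phi>1 x - \<phi>2 x\<bar> + \<eta> * K" if x: "x \<in> {0..1}" for x
  proof -
    have "\<bar>\<phi>2 x\<bar> \<le> K" unfolding K_def by (rule kernel_bound[OF 2 a c(2) x])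
    then have "\<bar>c1 x - c2 x\<bar> * \<bar>\<phi>2 x\<bar> \<le> \<eta> * K" using c(3)[OF x] nn by (intro mult_mono) auto
    moreover have "\<bar>c1 x\<bar> * \<bar>\<phi>1 x - \<phi>2 x\<bar> \<le> L * \<bar>\<phi>1 x - \<phi>2 x\<bar>" using c(1)[OF x] by (rule mult_right_mono) simp
    moreover have "- (c1 x * \<phi>1 x) - - (c2 x * \<phi>2 x) = - (c1 x * (\<phi>1 x - \<phi>2 x)) - (c1 x - c2 x) * \<phi>2 x"
      by (simp add: algebra_simps)
    ultimately show ?thesis
      using abs_triangle_ineq4[of "- (c1 x * (\<phi>1 x - \<phi>2 x))" "(c1 x - c2 x) * \<phi>2 x"] by (simp add: abs_mult)
  qed
  have d: "((\<lambda>x. \<phi>1 x - \<phi>2 x) has_real_derivative (\<psi>1 x - \<psi>2 x) / a x) (at x within {0..1})"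
    "((\<lambda>x. \<psi>1 x - \<psi>2 x) has_real_derivative - (c1 x * \<phi>1 x) - - (c2 x * \<phi>2 x)) (at x within {0..1})"
    if "x \<in> {0..1}" for x
    using DERIV_diff[OF equilibrium_fluxD(1)[OF 1(1) that] equilibrium_fluxD(1)[OF 2(1) that]]
      DERIV_diff[OF equilibrium_fluxD(2)[OF 1(1) that] equilibrium_fluxD(2)[OF 2(1) that]]
    by (simp_all add: diff_divide_distrib)
  have z: "\<psi>1 0 - \<psi>2 0 = 0" using equilibrium_fluxD(3)[OF 1(1)] equilibrium_fluxD(3)[OF 2(1)] by simp
  have nn': "0 \<le> \<eta> * K" using nn by (simp add: K_def)
  note G = gronwall_linear[of "\<lambda>x. \<phi>1 x - \<phi>2 x" "\<lambda>x. \<psi>1 x - \<psi>2 x" a, OF d r a nn(1) nn' z x]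
  show "\<bar>\<phi>1 x - \<phi>2 x\<bar> \<le> (exp (A + L + 1))\<^sup>2 * \<eta>" "\<bar>\<psi>1 x - \<psi>2 x\<bar> \<le> (exp (A + L + 1))\<^sup>2 * \<eta>"
    using G 1 2 by (simp_all add: K_def power2_eq_square mult_ac)
qed

lemma derivative_of_limit:
  fixes h :: "nat \<Rightarrow> real \<Rightarrow> real"
  assumes d: "\<And>j x. x \<in> {0..1} \<Longrightarrow> (h j has_real_derivative h' j x) (at x within {0..1})"
    and c: "\<And>j x. x \<in> {0..1} \<Longrightarrow> \<bar>h j x - l x\<bar> \<le> M * s j" "\<And>j x. x \<in> {0..1} \<Longrightarrow> \<bar>h' j x - l' x\<bar> \<le> M' * s j"
    and s: "s \<longlonglongrightarrow> 0" and x: "x \<in> {0..1}"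
  shows "(l has_real_derivative l' x) (at x within {0..1})"
proof -
  have lim: "(\<lambda>j. h j x) \<longlonglongrightarrow> l x" if "x \<in> {0..1}" for x
  proof -
    have "(\<lambda>j. M * s j) \<longlonglongrightarrow> 0" using tendsto_mult[OF tendsto_const s, of M] by simp
    then have "(\<lambda>j. h j x - l x) \<longlonglongrightarrow> 0"
      by (rule Lim_null_comparison[rotated]) (use c(1)[OF that] in auto)
    then show ?thesis by (simp add: LIM_zero_iff)
  qed
  have "\<exists>g. \<forall>x\<in>{0..1}. (\<lambda>j. h j x) \<longlonglongrightarrow> g x \<and> (g has_derivative (\<lambda>k. l' x * k)) (at x within {0..1})"
  proof (rule has_derivative_sequence[where f' = "\<lambda>j x k. h' j x * k"])
    show "(h j has_derivative (\<lambda>k. h' j x * k)) (at x within {0..1})" if "x \<in> {0..1}" for j x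
      using d[OF that] unfolding has_field_derivative_def .
    fix e :: real assume e: "e > 0"
    have "(\<lambda>j. M' * s j) \<longlonglongrightarrow> 0" using tendsto_mult[OF tendsto_const s, of M'] by simp
    then have "\<forall>\<^sub>F j in sequentially. M' * s j < e" using e by (rule order_tendstoD)
    then show "\<forall>\<^sub>F j in sequentially. \<forall>x\<in>{0..1}. \<forall>k. norm (h' j x * k - l' x * k) \<le> e * norm k"
    proof eventually_elim
      case (elim j)
      show ?case
      proof (intro ballI allI)
        fix x k :: real assume "x \<in> {0..1}"
        then have "\<bar>h' j x - l' x\<bar> * \<bar>k\<bar> \<le> e * \<bar>k\<bar>" using c(2)[of x j] elim by (intro mult_right_mono) auto
        then show "norm (h' j x * k - l' x * k) \<le> e * norm k"
          by (simp add: left_diff_distrib[symmetric] abs_mult)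
      qed
    qed
  next
    show "(\<lambda>j. h j 0) \<longlonglongrightarrow> l 0" by (rule lim) simp
  qed auto
  then obtain g where g: "\<forall>x\<in>{0..1}. (\<lambda>j. h j x) \<longlonglongrightarrow> g x \<and> (g has_derivative (\<lambda>k. l' x * k)) (at x within {0..1})"
    by blast
  have gl: "g y = l y" if "y \<in> {0..1}" for y using g lim[OF that] that LIMSEQ_unique by blast
  have "(g has_real_derivative l' x) (at x within {0..1})" using g x by (simp add: has_field_derivative_def)
  then show ?thesis
    by (rule has_field_derivative_transform_within[OF _ zero_less_one x]) (use gl in auto)
qed

text \<open>Letting \<open>k\<close> tend to infinity in the Cauchy estimate keeps the rate
  \<open>M * s j\<close>, uniformly in \<open>x\<close>.\<close>

lemma limit_of_cauchy_bound:
  fixes h :: "nat \<Rightarrow> real \<Rightarrow> real"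
  assumes c: "\<And>j k x. x \<in> S \<Longrightarrow> \<bar>h j x - h k x\<bar> \<le> M * (s j + s k)" and s: "s \<longlonglongrightarrow> 0" and M: "M > 0"
  shows "\<exists>l. \<forall>x\<in>S. \<forall>j. \<bar>h j x - l x\<bar> \<le> M * s j"
proof -
  have "Cauchy (\<lambda>j. h j x)" if x: "x \<in> S" for x
  proof (rule metric_CauchyI)
    fix e :: real assume e: "e > 0"
    have "\<forall>\<^sub>F j in sequentially. s j < e / (2 * M)" using s e M by (intro order_tendstoD) auto
    then obtain N where N: "\<And>j. j \<ge> N \<Longrightarrow> s j < e / (2 * M)" by (auto simp: eventually_sequentially)
    show "\<exists>N. \<forall>m\<ge>N. \<forall>n\<ge>N. dist (h m x) (h n x) < e"
    proof (intro exI[of _ N] allI impI)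
      fix m k assume "m \<ge> N" "k \<ge> N"
      then have "s m + s k < e / M" using N[of m] N[of k] by simp
      then have "M * (s m + s k) < e" using M by (simp add: field_simps)
      then show "dist (h m x) (h k x) < e" using c[OF x, of m k] by (simp add: dist_real_def)
    qed
  qed
  then have "\<forall>x\<in>S. \<exists>y. (\<lambda>j. h j x) \<longlonglongrightarrow> y" by (simp add: Cauchy_convergent_iff convergent_def)
  then obtain l where l: "\<And>x. x \<in> S \<Longrightarrow> (\<lambda>j. h j x) \<longlonglongrightarrow> l x" by metis
  have "\<bar>h j x - l x\<bar> \<le> M * s j" if x: "x \<in> S" for x j
  proof (rule LIMSEQ_le)
    show "(\<lambda>k. \<bar>h j x - h k x\<bar>) \<longlonglongrightarrow> \<bar>h j x - l x\<bar>" by (intro tendsto_intros l x)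
    have "(\<lambda>k. M * (s j + s k)) \<longlonglongrightarrow> M * (s j + 0)" by (intro tendsto_intros s)
    then show "(\<lambda>k. M * (s j + s k)) \<longlonglongrightarrow> M * s j" by simp
    show "\<exists>N. \<forall>k\<ge>N. \<bar>h j x - h k x\<bar> \<le> M * (s j + s k)" using c[OF x] by blast
  qed
  then show ?thesis by blast
qed

lemma le_if_le_plus_vanishing:
  fixes p q M :: real
  assumes "\<And>j. p \<le> q + M * s j" "s \<longlonglongrightarrow> 0"
  shows "p \<le> q"
proof (rule LIMSEQ_le_const)
  have "(\<lambda>j. q + M * s j) \<longlonglongrightarrow> q + M * 0" by (intro tendsto_intros assms)
  then show "(\<lambda>j. q + M * s j) \<longlonglongrightarrow> q" by simp
qed (use assms in auto)

text \<open>\<open>N + 2\<close> parameters fall into \<open>N + 1\<close> bins of width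
  \<open>d / N\<close>. Two in a common bin would give \<eta>/(N + 3) \<le> C (d/N)^2, which fails
  for large N.\<close>

lemma pigeonhole_quadratic:
  fixes \<xi> :: "real \<Rightarrow> real"
  assumes \<eta>: "0 < \<eta>" and d: "0 < d" and range: "\<And>t. 0 < t \<Longrightarrow> t < \<eta> \<Longrightarrow> \<xi> t \<in> {b..b+d}"
    and quad: "\<And>s t. 0 < s \<Longrightarrow> s < \<eta> \<Longrightarrow> 0 < t \<Longrightarrow> t < \<eta> \<Longrightarrow> \<bar>s - t\<bar> \<le> C * (\<xi> s - \<xi> t)\<^sup>2"
  shows False
proof -
  obtain N0 :: nat where N0: "2 * \<bar>C\<bar> * d\<^sup>2 / \<eta> < real N0" using reals_Archimedean2 by blast
  define N where "N = max N0 3"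
  have "2 * \<bar>C\<bar> * d\<^sup>2 < real N0 * \<eta>" using N0 \<eta> by (simp add: field_simps)
  also have "\<dots> \<le> real N * \<eta>" using \<eta> by (intro mult_right_mono) (auto simp: N_def)
  finally have N: "N \<ge> 3" "2 * \<bar>C\<bar> * d\<^sup>2 < real N * \<eta>" by (auto simp: N_def)
  \<comment> \<open>The shift by \<open>1\<close> and the denominator \<open>N + 3\<close> keep all
    points with \<open>i \<le> N + 1\<close> strictly inside the interval. \<open>N \<ge> 3\<close>
    serves to replace \<open>N + 3\<close> by \<open>2 * N\<close> at the end.\<close>
  define t where "t i = \<eta> * (real i + 1) / (real N + 3)" for i :: nat
  have t: "0 < t i" "t i < \<eta>" if "i \<le> N + 1" for i
  proof -
    have "0 < (real i + 1) / (real N + 3)" "(real i + 1) / (real N + 3) < 1" using that by auto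
    then show "0 < t i" "t i < \<eta>"
      using \<eta> mult_strict_left_mono[of "(real i + 1) / (real N + 3)" 1 \<eta>]
      by (simp_all add: t_def times_divide_eq_right[symmetric] del: times_divide_eq_right)
  qed
  define bin where "bin i = nat \<lfloor>real N * (\<xi> (t i) - b) / d\<rfloor>" for i
  have bin: "bin i \<le> N" if "i \<le> N + 1" for i
  proof -
    have "\<xi> (t i) - b \<le> d" using range[OF t[OF that]] by auto
    then have "real N * (\<xi> (t i) - b) \<le> real N * d" by (intro mult_left_mono) auto
    then have "real N * (\<xi> (t i) - b) / d \<le> real N" using d by (simp add: field_simps)
    then show ?thesis by (simp add: bin_def nat_le_iff floor_le_iff)
  qed
  have "bin ` {..N+1} \<subseteq> {..N}" using bin by auto
  then have "card (bin ` {..N+1}) \<le> card {..N}" by (rule card_mono[rotated]) simp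
  then have "\<not> inj_on bin {..N+1}" by (intro pigeonhole) simp
  then obtain i j where ij: "i \<le> N + 1" "j \<le> N + 1" "i \<noteq> j" "bin i = bin j"
    by (auto simp: inj_on_def)
  define p where "p k = real N * (\<xi> (t k) - b) / d" for k
  have pp: "0 \<le> p k" if "k \<le> N + 1" for k
    using range[OF t[OF that]] d by (auto simp: p_def)
  have "\<lfloor>p i\<rfloor> = \<lfloor>p j\<rfloor>"
    using ij pp by (simp add: bin_def p_def[symmetric] eq_nat_nat_iff)
  then have "\<bar>p i - p j\<bar> < 1" by linarith
  moreover have "p i - p j = real N * (\<xi> (t i) - \<xi> (t j)) / d"
    by (simp add: p_def diff_divide_distrib[symmetric] algebra_simps)
  ultimately have "\<bar>real N * (\<xi> (t i) - \<xi> (t j))\<bar> < d"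
    using d by (simp add: abs_divide)
  then have "\<bar>real N * (\<xi> (t i) - \<xi> (t j))\<bar>\<^sup>2 \<le> d\<^sup>2" by (intro power_mono) auto
  then have sq: "(real N)\<^sup>2 * (\<xi> (t i) - \<xi> (t j))\<^sup>2 \<le> d\<^sup>2" by (simp add: power_mult_distrib)
  have "\<eta> / (real N + 3) \<le> \<bar>t i - t j\<bar>"
  proof -
    define q where "q = \<eta> / (real N + 3)"
    have "t k = q * (real k + 1)" for k by (simp add: t_def q_def)
    then have "t i - t j = \<eta> / (real N + 3) * (real i - real j)"
      unfolding q_def[symmetric] by (simp add: algebra_simps)
    moreover have "1 \<le> \<bar>real i - real j\<bar>" using ij(3) by linarith
    moreover have "0 < q" using \<eta> by (simp add: q_def)
    ultimately show ?thesis
      using mult_left_mono[of 1 "\<bar>real i - real j\<bar>" q] unfolding q_def[symmetric] by (simp add: abs_mult)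
  qed
  also have "\<dots> \<le> C * (\<xi> (t i) - \<xi> (t j))\<^sup>2" using t ij by (intro quad) auto
  also have "\<dots> \<le> \<bar>C\<bar> * (\<xi> (t i) - \<xi> (t j))\<^sup>2" by (intro mult_right_mono) auto
  finally have "(real N)\<^sup>2 * (\<eta> / (real N + 3)) \<le> (real N)\<^sup>2 * (\<bar>C\<bar> * (\<xi> (t i) - \<xi> (t j))\<^sup>2)"
    by (intro mult_left_mono) auto
  also have "\<dots> \<le> \<bar>C\<bar> * d\<^sup>2" using mult_left_mono[OF sq, of "\<bar>C\<bar>"] by (simp add: mult_ac)
  finally have "(real N)\<^sup>2 * \<eta> \<le> \<bar>C\<bar> * d\<^sup>2 * (real N + 3)" by (simp add: field_simps)
  also have "\<dots> \<le> \<bar>C\<bar> * d\<^sup>2 * (2 * real N)" using N by (intro mult_left_mono) auto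
  finally have "real N * (real N * \<eta>) \<le> real N * (2 * \<bar>C\<bar> * d\<^sup>2)" by (simp add: power2_eq_square mult_ac)
  then show False using N by simp
qed

section \<open>Limits of degenerate pairs and stability of nondegeneracy\<close>

locale diffusion =
  fixes a :: "real \<Rightarrow> real"
  assumes a_pos: "\<And>x. x \<in> {0..1} \<Longrightarrow> 0 < a x"
    and a_cont: "continuous_on {0..1} a"
begin

lemma inverse_bounded:
  obtains A where "A > 0" "\<And>x. x \<in> {0..1} \<Longrightarrow> \<bar>1 / a x\<bar> \<le> A"
proof -
  have c: "continuous_on {0..1} (\<lambda>x. 1 / a x)"
    using a_pos a_cont by (intro continuous_intros) force+
  have "\<exists>A>0. \<forall>x\<in>{0..1}. \<bar>1 / a x\<bar> \<le> A"
    by (rule continuous_on_Icc_bounded[OF c]) blast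
  then show ?thesis using that by blast
qed

text \<open>Each pair is determined by its data at \<open>0\<close>, so Gronwall estimates between
  any two members give a uniform Cauchy property directly, for functions and fluxes alike, and the
  equations pass to the limit.\<close>

lemma degenerate_limit:
  assumes f: "f \<in> C2S" and g: "\<And>j. g j \<in> C2S" "\<And>j. C1_close n (\<epsilon> j) f (g j)" "\<epsilon> \<longlonglongrightarrow> 0"
    and deg: "\<And>j. degenerate_pair a (g j) n (u j) (v j) (\<phi> j) (\<psi> j)"
    and \<xi>: "(\<lambda>j. u j 0) \<longlonglongrightarrow> \<xi>"
  shows "degenerate_in a n {\<xi>} f"
proof -
  obtain A where A: "A > 0" "\<And>x. x \<in> {0..1} \<Longrightarrow> \<bar>1 / a x\<bar> \<le> A" using inverse_bounded by blast
  note D = degenerate_pairD[OF deg]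
  have n: "0 \<le> n" using D(4)[of 0 0] by force
  have \<epsilon>0: "0 \<le> \<epsilon> j" for j
  proof -
    have "\<bar>f 0 - g j 0\<bar> \<le> \<epsilon> j" using g(2)[of j] n unfolding C1_close_def by simp
    then show ?thesis by linarith
  qed
  obtain B where B: "B > 0" "\<And>j. \<bar>\<epsilon> j\<bar> \<le> B"
    using convergent_imp_Bseq[of \<epsilon>] g(3) by (auto simp: convergent_def Bseq_def)
  obtain L1 where L1: "L1 > 0" "\<And>x. \<bar>x\<bar> \<le> n \<Longrightarrow> \<bar>deriv f x\<bar> \<le> L1"
    using bounded_on_symmetric_interval[OF C2S_derivs(4)[OF f]] by blast
  obtain L2 where L2: "L2 > 0" "\<And>x. \<bar>x\<bar> \<le> n \<Longrightarrow> \<bar>deriv (deriv f) x\<bar> \<le> L2"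
    using bounded_on_symmetric_interval[OF C2S_derivs(5)[OF f]] by blast
  define L where "L = L1 + B"
  define K where "K = exp (A + L + 1)"
  have K: "K > 0" by (simp add: K_def)
  have close: "\<bar>f x - g j x\<bar> \<le> \<epsilon> j" "\<bar>deriv f x - deriv (g j) x\<bar> \<le> \<epsilon> j" if "\<bar>x\<bar> \<le> n" for j x
    using g(2)[of j] that by (auto simp: C1_close_def)
  have Lg: "\<bar>deriv (g j) x\<bar> \<le> L" if "\<bar>x\<bar> \<le> n" for j x
    using close(2)[OF that, of j] L1(2)[OF that] B(2)[of j] by (auto simp: L_def)
  \<comment> \<open>The common rate of all four convergences: error of the initial value plus error
    of the nonlinearity.\<close>
  define s where "s j = \<bar>u j 0 - \<xi>\<bar> + \<epsilon> j" for j
  have s: "s \<longlonglongrightarrow> 0"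
  proof -
    have "(\<lambda>j. \<bar>u j 0 - \<xi>\<bar> + \<epsilon> j) \<longlonglongrightarrow> \<bar>\<xi> - \<xi>\<bar> + 0" by (intro tendsto_intros \<xi> g)
    then show ?thesis by (simp add: s_def[abs_def])
  qed
  have s0: "0 \<le> s j" "\<epsilon> j \<le> s j" for j using \<epsilon>0[of j] by (auto simp: s_def)
  have uv: "\<bar>u j x - u k x\<bar> \<le> K * (s j + s k)" "\<bar>v j x - v k x\<bar> \<le> K * (s j + s k)" if x: "x \<in> {0..1}" for j k x
  proof -
    have jk: "\<bar>g j y - g k y\<bar> \<le> \<epsilon> j + \<epsilon> k" if "\<bar>y\<bar> \<le> n" for y
      using close(1)[OF that, of j] close(1)[OF that, of k] by linarith
    have "\<bar>u j 0 - u k 0\<bar> + (\<epsilon> j + \<epsilon> k) \<le> s j + s k" by (simp add: s_def)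
    then have le: "K * (\<bar>u j 0 - u k 0\<bar> + (\<epsilon> j + \<epsilon> k)) \<le> K * (s j + s k)" using K by simp
    note E = equilibrium_distance[OF D(1)[of j] D(1)[of k] D(4)[of _ j] D(4)[of _ k] A(2) g(1)[of j] Lg jk x, folded K_def]
    show "\<bar>u j x - u k x\<bar> \<le> K * (s j + s k)" by (rule order_trans[OF E(1) le])
    show "\<bar>v j x - v k x\<bar> \<le> K * (s j + s k)" by (rule order_trans[OF E(2) le])
  qed
  define c where "c j x = deriv (g j) (u j x)" for j x
  have cL: "\<bar>c j x\<bar> \<le> L" if "x \<in> {0..1}" for j x unfolding c_def by (rule Lg[OF D(4)[OF that]])
  have fu: "\<bar>deriv f p - deriv f q\<bar> \<le> L2 * \<bar>p - q\<bar>" if "\<bar>p\<bar> \<le> n" "\<bar>q\<bar> \<le> n" for p q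
    by (rule abs_diff_le_of_deriv[OF C2S_derivs(2)[OF f] L2(2) that])
  define M1 where "M1 = 1 + L2 * K"
  define M2 where "M2 = K\<^sup>2 * M1"
  have M12: "M1 > 0" "M2 > 0" using L2(1) K by (auto simp: M1_def M2_def add_pos_pos)
  have cc: "\<bar>c j x - c k x\<bar> \<le> M1 * (s j + s k)" if x: "x \<in> {0..1}" for j k x
  proof -
    have "\<bar>deriv f (u j x) - deriv f (u k x)\<bar> \<le> L2 * (K * (s j + s k))"
      using fu[OF D(4)[OF x] D(4)[OF x], of j k] mult_left_mono[OF uv(1)[OF x, of j k], of L2] L2(1) by linarith
    then show ?thesis
      using close(2)[OF D(4)[OF x, of j], of j] close(2)[OF D(4)[OF x, of k], of k] s0(2)[of j] s0(2)[of k]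
      unfolding c_def M1_def by (simp add: algebra_simps)
  qed
  have \<phi>\<psi>: "\<bar>\<phi> j x - \<phi> k x\<bar> \<le> M2 * (s j + s k)" "\<bar>\<psi> j x - \<psi> k x\<bar> \<le> M2 * (s j + s k)"
    if x: "x \<in> {0..1}" for j k x
    using kernel_distance[OF D(2)[of j, folded c_def] D(3)[of j] D(2)[of k, folded c_def] D(3)[of k] A(2) cL[of _ j] cL[of _ k] cc[of _ j k] x]
    by (simp_all add: M2_def K_def mult.assoc)
  obtain U where U: "\<And>x j. x \<in> {0..1} \<Longrightarrow> \<bar>u j x - U x\<bar> \<le> K * s j"
    using limit_of_cauchy_bound[of "{0..1}" u, OF uv(1) s K] by blast
  obtain V where V: "\<And>x j. x \<in> {0..1} \<Longrightarrow> \<bar>v j x - V x\<bar> \<le> K * s j"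
    using limit_of_cauchy_bound[of "{0..1}" v, OF uv(2) s K] by blast
  obtain \<Phi> where \<Phi>: "\<And>x j. x \<in> {0..1} \<Longrightarrow> \<bar>\<phi> j x - \<Phi> x\<bar> \<le> M2 * s j"
    using limit_of_cauchy_bound[of "{0..1}" \<phi>, OF \<phi>\<psi>(1) s M12(2)] by blast
  obtain \<Psi> where \<Psi>: "\<And>x j. x \<in> {0..1} \<Longrightarrow> \<bar>\<psi> j x - \<Psi> x\<bar> \<le> M2 * s j"
    using limit_of_cauchy_bound[of "{0..1}" \<psi>, OF \<phi>\<psi>(2) s M12(2)] by blast
  have Un: "\<bar>U x\<bar> \<le> n" if x: "x \<in> {0..1}" for x
  proof (rule le_if_le_plus_vanishing[OF _ s])
    show "\<bar>U x\<bar> \<le> n + K * s j" for j using U[OF x, of j] D(4)[OF x, of j] by linarith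
  qed
  have eq: "p = q" if "\<And>j. \<bar>p - q\<bar> \<le> M * s j" for p q M :: real
  proof -
    have "\<bar>p - q\<bar> \<le> 0" by (rule le_if_le_plus_vanishing[OF _ s, where M = M]) (use that in auto)
    then show ?thesis by simp
  qed
  have "\<bar>0 - V 0\<bar> \<le> K * s j" "\<bar>0 - V 1\<bar> \<le> K * s j" "\<bar>0 - \<Psi> 0\<bar> \<le> M2 * s j" "\<bar>0 - \<Psi> 1\<bar> \<le> M2 * s j"
    "\<bar>1 - \<Phi> 0\<bar> \<le> M2 * s j" for j
    using V[of 0 j] V[of 1 j] \<Psi>[of 0 j] \<Psi>[of 1 j] \<Phi>[of 0 j] D(3)[of j]
      equilibrium_fluxD(3,4)[OF D(1)[of j]] equilibrium_fluxD(3,4)[OF D(2)[of j]] by auto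
  then have bdry: "V 0 = 0" "V 1 = 0" "\<Psi> 0 = 0" "\<Psi> 1 = 0" "\<Phi> 0 = 1" using eq by metis+
  have U0: "U 0 = \<xi>"
  proof (rule eq)
    fix j
    have "\<bar>u j 0 - \<xi>\<bar> \<le> s j" using \<epsilon>0[of j] by (simp add: s_def)
    then show "\<bar>U 0 - \<xi>\<bar> \<le> (K + 1) * s j" using U[of 0 j] by (simp add: algebra_simps)
  qed
  have quot: "\<bar>p / a x - q / a x\<bar> \<le> A * M * s j" if "\<bar>p - q\<bar> \<le> M * s j" "x \<in> {0..1}" for p q M j x
  proof -
    have "\<bar>p / a x - q / a x\<bar> = \<bar>1 / a x\<bar> * \<bar>p - q\<bar>" by (simp add: diff_divide_distrib[symmetric] abs_divide)
    also have "\<dots> \<le> A * (M * s j)" using A that by (intro mult_mono) auto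
    finally show ?thesis by simp
  qed
  have dU: "(U has_real_derivative V x / a x) (at x within {0..1})" if "x \<in> {0..1}" for x
    by (rule derivative_of_limit[OF equilibrium_fluxD(1)[OF D(1)] U quot[OF V] s that])
  have d\<Phi>: "(\<Phi> has_real_derivative \<Psi> x / a x) (at x within {0..1})" if "x \<in> {0..1}" for x
    by (rule derivative_of_limit[OF equilibrium_fluxD(1)[OF D(2)] \<Phi> quot[OF \<Psi>] s that])
  have dV: "(V has_real_derivative - f (U x)) (at x within {0..1})" if "x \<in> {0..1}" for x
  proof (rule derivative_of_limit[OF equilibrium_fluxD(2)[OF D(1)] V _ s that])
    fix j x assume x: "x \<in> {0::real..1}"
    have "\<bar>f (u j x) - f (U x)\<bar> \<le> L1 * \<bar>u j x - U x\<bar>"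
      by (rule abs_diff_le_of_deriv[OF C2S_derivs(1)[OF f] L1(2) D(4)[OF x] Un[OF x]])
    also have "\<dots> \<le> L1 * (K * s j)" using U[OF x, of j] L1(1) by (intro mult_left_mono) auto
    finally show "\<bar>- g j (u j x) - - f (U x)\<bar> \<le> (1 + L1 * K) * s j"
      using close(1)[OF D(4)[OF x, of j], of j] s0(2)[of j] by (simp add: algebra_simps)
  qed
  have d\<Psi>: "(\<Psi> has_real_derivative - (deriv f (U x) * \<Phi> x)) (at x within {0..1})" if "x \<in> {0..1}" for x
  proof (rule derivative_of_limit[OF equilibrium_fluxD(2)[OF D(2)[folded c_def]] \<Psi> _ s that])
    fix j x assume x: "x \<in> {0::real..1}"
    have "\<bar>deriv f (u j x) - deriv f (U x)\<bar> \<le> L2 * (K * s j)"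
      using fu[OF D(4)[OF x] Un[OF x], of j] mult_left_mono[OF U[OF x, of j], of L2] L2(1) by linarith
    then have "\<bar>c j x - deriv f (U x)\<bar> \<le> M1 * s j"
      using close(2)[OF D(4)[OF x, of j], of j] s0(2)[of j] unfolding c_def M1_def by (simp add: algebra_simps)
    moreover have "\<bar>\<phi> j x\<bar> \<le> K"
      unfolding K_def by (rule kernel_bound[OF D(2)[folded c_def] D(3) A(2) cL x])
    ultimately have 1: "\<bar>c j x - deriv f (U x)\<bar> * \<bar>\<phi> j x\<bar> \<le> M1 * s j * K" by (intro mult_mono) auto
    have "\<bar>deriv f (U x)\<bar> \<le> L1" by (rule L1(2)[OF Un[OF x]])
    then have 2: "\<bar>deriv f (U x)\<bar> * \<bar>\<phi> j x - \<Phi> x\<bar> \<le> L1 * (M2 * s j)"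
      using \<Phi>[OF x, of j] by (intro mult_mono) auto
    have "- (c j x * \<phi> j x) - - (deriv f (U x) * \<Phi> x)
        = - ((c j x - deriv f (U x)) * \<phi> j x) - deriv f (U x) * (\<phi> j x - \<Phi> x)" by (simp add: algebra_simps)
    then have "\<bar>- (c j x * \<phi> j x) - - (deriv f (U x) * \<Phi> x)\<bar>
        \<le> \<bar>c j x - deriv f (U x)\<bar> * \<bar>\<phi> j x\<bar> + \<bar>deriv f (U x)\<bar> * \<bar>\<phi> j x - \<Phi> x\<bar>"
      using abs_triangle_ineq4[of "- ((c j x - deriv f (U x)) * \<phi> j x)" "deriv f (U x) * (\<phi> j x - \<Phi> x)"]
      by (simp add: abs_mult)
    then show "\<bar>- (c j x * \<phi> j x) - - (deriv f (U x) * \<Phi> x)\<bar> \<le> (M1 * K + L1 * M2) * s j"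
      using 1 2 by (simp add: algebra_simps)
  qed
  have "degenerate_pair a f n U V \<Phi> \<Psi>"
    unfolding degenerate_pair_def equilibrium_flux_def using dU dV d\<Phi> d\<Psi> bdry Un by auto
  then show ?thesis using U0 unfolding degenerate_in_def by blast
qed

text \<open>Applied with \<open>T\<close> constantly \<open>J\<close>, and with \<open>T d\<close> an interval shrinking to the point \<open>J\<close>.\<close>

lemma nondegenerate_stable:
  assumes f: "f \<in> C2S" and nd: "\<not> degenerate_in a n J f"
    and J: "\<And>\<xi> \<xi>'. \<xi> \<longlonglongrightarrow> \<xi>' \<Longrightarrow> (\<And>j. \<xi> j \<in> T (1 / real (Suc j))) \<Longrightarrow> \<xi>' \<in> J"
    and mono: "\<And>d d'. d \<le> d' \<Longrightarrow> T d \<subseteq> T d'"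
  shows "\<exists>\<delta>>0. \<forall>g\<in>C2S. C1_close n \<delta> f g \<longrightarrow> \<not> degenerate_in a n (T \<delta>) g"
proof (rule ccontr)
  assume neg: "\<not> ?thesis"
  have "\<exists>g u v \<phi> \<psi>. g \<in> C2S \<and> C1_close n (1 / real (Suc j)) f g \<and>
      degenerate_pair a g n u v \<phi> \<psi> \<and> u 0 \<in> T (1 / real (Suc j))" for j
  proof -
    have "1 / real (Suc j) > 0" by simp
    then have "\<not> (\<forall>g\<in>C2S. C1_close n (1 / real (Suc j)) f g \<longrightarrow> \<not> degenerate_in a n (T (1 / real (Suc j))) g)"
      using neg by blast
    then show ?thesis unfolding degenerate_in_def by blast
  qed
  then obtain g u v \<phi> \<psi> where g: "\<And>j. g j \<in> C2S" "\<And>j. C1_close n (1 / real (Suc j)) f (g j)"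
    and deg: "\<And>j. degenerate_pair a (g j) n (u j) (v j) (\<phi> j) (\<psi> j)" and uT: "\<And>j. u j 0 \<in> T (1 / real (Suc j))"
    by metis
  have "u j 0 \<in> {-n..n}" for j using degenerate_pairD(4)[OF deg[of j], of 0] by (auto simp: abs_le_iff)
  then obtain r \<xi> where r: "strict_mono r" "(\<lambda>j. u (r j) 0) \<longlonglongrightarrow> \<xi>"
    using compact_Icc[of "-n" n, unfolded compact_def, rule_format, of "\<lambda>j. u j 0"] by (auto simp: o_def)
  have inv: "(\<lambda>j. 1 / real (Suc (r j))) \<longlonglongrightarrow> 0"
    using LIMSEQ_subseq_LIMSEQ[OF LIMSEQ_inverse_real_of_nat r(1)] by (simp add: o_def inverse_eq_divide)
  have "degenerate_in a n {\<xi>} f"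
    by (rule degenerate_limit[OF f g(1) g(2) inv deg r(2)])
  \<comment> \<open>The tolerance of the subsequence member \<open>r j\<close> is at most that of
    \<open>j\<close>, and \<open>T\<close> is monotone.\<close>
  moreover have "\<xi> \<in> J"
  proof (rule J[OF r(2)])
    fix j
    have "1 / real (Suc (r j)) \<le> 1 / real (Suc j)"
      using seq_suble[OF r(1), of j] by (simp add: field_simps)
    then show "u (r j) 0 \<in> T (1 / real (Suc j))" using mono uT by blast
  qed
  ultimately show False using nd unfolding degenerate_in_def by auto
qed

lemma nondegenerate_open:
  assumes "f \<in> C2S" "closed J" "\<not> degenerate_in a n J f"
  shows "\<exists>\<delta>>0. \<forall>g\<in>C2S. C1_close n \<delta> f g \<longrightarrow> \<not> degenerate_in a n J g"
  by (rule nondegenerate_stable[OF assms(1,3), where T = "\<lambda>_. J"])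
    (use assms(2) closed_sequentially in auto)

lemma nondegenerate_near:
  assumes "f \<in> C2S" "\<not> degenerate_in a n {\<xi>} f"
  shows "\<exists>\<delta>>0. \<forall>g\<in>C2S. C1_close n \<delta> f g \<longrightarrow> \<not> degenerate_in a n {\<xi>-\<delta>..\<xi>+\<delta>} g"
proof (rule nondegenerate_stable[OF assms, where T = "\<lambda>d. {\<xi>-d..\<xi>+d}"])
  fix \<zeta> :: "nat \<Rightarrow> real" and \<zeta>'
  assume \<zeta>: "\<zeta> \<longlonglongrightarrow> \<zeta>'" "\<And>j. \<zeta> j \<in> {\<xi> - 1 / real (Suc j)..\<xi> + 1 / real (Suc j)}"
  have "(\<lambda>j. \<zeta> j - \<xi>) \<longlonglongrightarrow> 0"
    by (rule Lim_null_comparison[OF _ LIMSEQ_inverse_real_of_nat])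
      (use \<zeta>(2) in \<open>auto simp: abs_le_iff inverse_eq_divide algebra_simps intro!: always_eventually\<close>)
  then have "\<zeta> \<longlonglongrightarrow> \<xi>" by (simp add: LIM_zero_iff)
  then show "\<zeta>' \<in> {\<xi>}" using \<zeta>(1) LIMSEQ_unique by blast
qed auto

end

section \<open>Perturbing in a transversal direction\<close>

lemma has_integral_abs_bound:
  fixes g :: "real \<Rightarrow> real"
  assumes "(g has_integral i) {0..1}" "\<And>x. x \<in> {0..1} \<Longrightarrow> \<bar>g x\<bar> \<le> B"
  shows "\<bar>i\<bar> \<le> B"
proof -
  have "0 \<le> B" using assms(2)[of 0] by force
  then have "norm i \<le> B * measure lborel (cbox 0 (1::real))"
    by (rule has_integral_bound) (use assms in auto)
  then show ?thesis by simp
qed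

context diffusion
begin

text \<open>The same \<open>\<delta>\<close> serves every \<open>g\<close> close to
  \<open>f\<close>. This uniformity allows perturbations for several values of \<open>u 0\<close> to
  be made one after the other.\<close>

lemma perturbation_escapes:
  assumes f: "f \<in> C2S" and D0: "degenerate_pair a f n u0 v0 \<phi>0 \<psi>0" and h: "h \<in> C2S"
    and I: "((\<lambda>x. h (u0 x) * \<phi>0 x) has_integral I) {0..1}" "I \<noteq> 0"
  shows "\<exists>\<delta>>0. \<forall>g\<in>C2S. C1_close n \<delta> f g \<longrightarrow>
    (\<forall>\<eta>>0. \<exists>t. 0 < t \<and> t < \<eta> \<and> \<not> degenerate_in a n {u0 0 - \<delta>..u0 0 + \<delta>} (\<lambda>x. g x + t * h x))"
proof -
  obtain A where A: "A > 0" "\<And>x. x \<in> {0..1} \<Longrightarrow> \<bar>1 / a x\<bar> \<le> A" using inverse_bounded by blast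
  note D0 = degenerate_pairD[OF D0]
  obtain L1 where L1: "L1 > 0" "\<And>x. \<bar>x\<bar> \<le> n \<Longrightarrow> \<bar>deriv f x\<bar> \<le> L1"
    using bounded_on_symmetric_interval[OF C2S_derivs(4)[OF f]] by blast
  obtain L2 where L2: "L2 > 0" "\<And>x. \<bar>x\<bar> \<le> n \<Longrightarrow> \<bar>deriv (deriv f) x\<bar> \<le> L2"
    using bounded_on_symmetric_interval[OF C2S_derivs(5)[OF f]] by blast
  obtain H0 where H0: "H0 > 0" "\<And>x. \<bar>x\<bar> \<le> n \<Longrightarrow> \<bar>h x\<bar> \<le> H0"
    using bounded_on_symmetric_interval[OF C2S_derivs(3)[OF h]] by blast
  obtain H1 where H1: "H1 > 0" "\<And>x. \<bar>x\<bar> \<le> n \<Longrightarrow> \<bar>deriv h x\<bar> \<le> H1"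
    using bounded_on_symmetric_interval[OF C2S_derivs(4)[OF h]] by blast
  obtain H2 where H2: "H2 > 0" "\<And>x. \<bar>x\<bar> \<le> n \<Longrightarrow> \<bar>deriv (deriv h) x\<bar> \<le> H2"
    using bounded_on_symmetric_interval[OF C2S_derivs(5)[OF h]] by blast
  define H where "H = H0 + H1 + H2"
  have Hpos: "H > 0" using H0(1) H1(1) H2(1) by (simp add: H_def)
  have Hx: "\<bar>h x\<bar> \<le> H" "\<bar>deriv h x\<bar> \<le> H" "\<bar>deriv (deriv h) x\<bar> \<le> H" if "\<bar>x\<bar> \<le> n" for x
    using H0(1) H1(1) H2(1) H0(2)[OF that] H1(2)[OF that] H2(2)[OF that] by (simp_all add: H_def)
  note H = Hpos Hx
  \<comment> \<open>Bounds the derivative on \<open>{-n..n}\<close> of \<open>f\<close> and of every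
    perturbation \<open>g + t h\<close> with \<open>t < \<delta> \<le> 1\<close>. Below,
    \<open>c1\<close>, \<open>c2\<close> and \<open>c3\<close> bound, per unit of
    \<open>\<delta>\<close>, the changes of \<open>u\<close>, of \<open>\<phi>\<close> and of the
    integral of \<open>h(u) \<phi>\<close>.\<close>
  define L where "L = L1 + 1 + H"
  define K where "K = exp (A + L + 1)"
  define c1 where "c1 = K * (2 + H)"
  define c2 where "c2 = K\<^sup>2 * ((1 + H) + L2 * c1)"
  define c3 where "c3 = H * c1 * K + H * c2"
  have K: "K > 0" by (simp add: K_def)
  have c: "c1 > 0" "c2 > 0" "c3 > 0"
  proof -
    show c1: "c1 > 0" using K H by (simp add: c1_def)
    show c2: "c2 > 0" using K H L2 c1 by (simp add: c2_def add_pos_pos)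
    show "c3 > 0" using K H c1 c2 by (simp add: c3_def add_pos_pos)
  qed
  define \<delta> where "\<delta> = min 1 (\<bar>I\<bar> / (2 * c3))"
  have \<delta>: "0 < \<delta>" "\<delta> \<le> 1" "c3 * \<delta> \<le> \<bar>I\<bar> / 2"
  proof -
    show "0 < \<delta>" "\<delta> \<le> 1" using I(2) c by (auto simp: \<delta>_def)
    have "c3 * \<delta> \<le> c3 * (\<bar>I\<bar> / (2 * c3))" using c by (intro mult_left_mono) (auto simp: \<delta>_def)
    then show "c3 * \<delta> \<le> \<bar>I\<bar> / 2" using c by simp
  qed
  show ?thesis
  proof (rule exI[of _ \<delta>], intro conjI \<delta>(1) ballI impI allI)
    fix g :: "real \<Rightarrow> real" and \<eta> :: real
    assume g: "g \<in> C2S" and close: "C1_close n \<delta> f g" and \<eta>: "0 < \<eta>"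
    define gt where "gt t = (\<lambda>x. g x + t * h x)" for t
    note gt_facts = C2S_add_scaled[OF g h, folded gt_def]
    obtain G2 where G2: "G2 > 0" "\<And>x. \<bar>x\<bar> \<le> n \<Longrightarrow> \<bar>deriv (deriv g) x\<bar> \<le> G2"
      using bounded_on_symmetric_interval[OF C2S_derivs(5)[OF g]] by blast
    define G where "G = G2 + H"
    have th: "\<bar>t * h x\<bar> \<le> \<delta> * H" "\<bar>t * deriv h x\<bar> \<le> \<delta> * H" "\<bar>t * deriv (deriv h) x\<bar> \<le> H"
      if "0 < t" "t < \<delta>" "\<bar>x\<bar> \<le> n" for t x
    proof -
      show "\<bar>t * h x\<bar> \<le> \<delta> * H" "\<bar>t * deriv h x\<bar> \<le> \<delta> * H"
        using that H unfolding abs_mult by (intro mult_mono; simp)+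
      have "\<bar>t * deriv (deriv h) x\<bar> \<le> 1 * H"
        using that \<delta> H(4)[OF that(3)] unfolding abs_mult by (intro mult_mono) auto
      then show "\<bar>t * deriv (deriv h) x\<bar> \<le> H" by simp
    qed
    have fgt: "\<bar>f x - gt t x\<bar> \<le> \<delta> * (1 + H)" "\<bar>deriv f x - deriv (gt t) x\<bar> \<le> \<delta> * (1 + H)"
      "\<bar>deriv (gt t) x\<bar> \<le> L" "\<bar>deriv (deriv (gt t)) x\<bar> \<le> G"
      if t: "0 < t" "t < \<delta>" and x: "\<bar>x\<bar> \<le> n" for t x
    proof -
      have cl: "\<bar>f x - g x\<bar> \<le> \<delta>" "\<bar>deriv f x - deriv g x\<bar> \<le> \<delta>" using close x by (auto simp: C1_close_def)
      have e: "\<delta> * (1 + H) = \<delta> + \<delta> * H" by (simp add: algebra_simps)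
      have e1: "f x - gt t x = (f x - g x) - t * h x" by (simp add: gt_def)
      have e2: "deriv f x - deriv (gt t) x = (deriv f x - deriv g x) - t * deriv h x" by (simp add: gt_facts)
      show "\<bar>f x - gt t x\<bar> \<le> \<delta> * (1 + H)" unfolding e e1 using cl(1) th(1)[OF t x] by linarith
      show *: "\<bar>deriv f x - deriv (gt t) x\<bar> \<le> \<delta> * (1 + H)" unfolding e e2 using cl(2) th(2)[OF t x] by linarith
      have "\<delta> * (1 + H) \<le> 1 * (1 + H)" using \<delta> H by (intro mult_right_mono) auto
      then show "\<bar>deriv (gt t) x\<bar> \<le> L" using * L1(2)[OF x] by (simp add: L_def abs_le_iff)
      show "\<bar>deriv (deriv (gt t)) x\<bar> \<le> G"
        using G2(2)[OF x] th(3)[OF t x] unfolding gt_facts(3) G_def by linarith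
    qed
    have fL: "\<bar>deriv f x\<bar> \<le> L" if "\<bar>x\<bar> \<le> n" for x using L1(2)[OF that] H by (simp add: L_def)
    have near: "\<bar>u0 x - u x\<bar> \<le> c1 * \<delta> \<and> \<bar>\<phi>0 x - \<phi> x\<bar> \<le> c2 * \<delta> \<and> \<bar>\<phi> x\<bar> \<le> K"
      if t: "0 < t" "t < \<delta>" and D: "degenerate_pair a (gt t) n u v \<phi> \<psi>"
        and u: "u 0 \<in> {u0 0 - \<delta>..u0 0 + \<delta>}" and x: "x \<in> {0..1}" for t u v \<phi> \<psi> x
    proof -
      note D = degenerate_pairD[OF D]
      have ux: "\<bar>u0 x - u x\<bar> \<le> c1 * \<delta>" if x: "x \<in> {0..1}" for x
      proof -
        have "\<bar>u0 x - u x\<bar> \<le> K * (\<bar>u0 0 - u 0\<bar> + \<delta> * (1 + H))"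
          unfolding K_def by (rule equilibrium_distance(1)[OF D0(1) D(1) D0(4) D(4) A(2) f fL fgt(1)[OF t] x])
        also have "\<dots> \<le> K * (\<delta> + \<delta> * (1 + H))" using K u by (intro mult_left_mono add_right_mono) auto
        finally show ?thesis by (simp add: c1_def algebra_simps)
      qed
      have cx: "\<bar>deriv f (u0 x) - deriv (gt t) (u x)\<bar> \<le> \<delta> * ((1 + H) + L2 * c1)" if x: "x \<in> {0..1}" for x
      proof -
        have "\<bar>deriv f (u0 x) - deriv f (u x)\<bar> \<le> L2 * \<bar>u0 x - u x\<bar>"
          by (rule abs_diff_le_of_deriv[OF C2S_derivs(2)[OF f] L2(2) D0(4)[OF x] D(4)[OF x]])
        also have "\<dots> \<le> L2 * (c1 * \<delta>)" using ux[OF x] L2 by (intro mult_left_mono) auto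
        finally show ?thesis using fgt(2)[OF t D(4)[OF x]] by (simp add: algebra_simps abs_le_iff)
      qed
      have "\<bar>\<phi>0 x - \<phi> x\<bar> \<le> K\<^sup>2 * (\<delta> * ((1 + H) + L2 * c1))"
        unfolding K_def
        by (rule kernel_distance(1)[OF D0(2,3) D(2,3) A(2) fL[OF D0(4)] fgt(3)[OF t D(4)] cx x])
      moreover have "\<bar>\<phi> x\<bar> \<le> K"
        unfolding K_def by (rule kernel_bound[OF D(2,3) A(2) fgt(3)[OF t D(4)] x])
      ultimately show ?thesis using ux[OF x] by (simp add: c2_def algebra_simps)
    qed
    define \<kappa> where "\<kappa> = \<bar>I\<bar> / 2"
    have \<kappa>: "\<kappa> > 0" using I(2) by (simp add: \<kappa>_def)
    define C1 where "C1 = 2 * K ^ 3 * G"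
    have G: "G > 0" using G2 H by (simp add: G_def)
    then have C1: "C1 > 0" using K by (simp add: C1_def)
    \<comment> \<open>The equation of \<open>u2 - u1\<close> tested with \<open>\<phi>1\<close> has
      no linear term, because \<open>\<phi>1\<close> is in the kernel at \<open>u1\<close>. What
      remains is a Taylor remainder, quadratic in \<open>u2 - u1\<close>, and \<open>t2 - t1\<close>
      times an integral \<open>J\<close> close to \<open>I\<close>.\<close>
    have quad: "\<kappa> * \<bar>t2 - t1\<bar> \<le> C1 * ((u2 0 - u1 0)\<^sup>2 + (t2 - t1)\<^sup>2 * H\<^sup>2)"
      if t1: "0 < t1" "t1 < \<delta>" and t2: "0 < t2" "t2 < \<delta>"
        and P1: "degenerate_pair a (gt t1) n u1 v1 \<phi>1 \<psi>1" and P2: "degenerate_pair a (gt t2) n u2 v2 \<phi>2 \<psi>2"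
        and u: "u1 0 \<in> {u0 0 - \<delta>..u0 0 + \<delta>}" "u2 0 \<in> {u0 0 - \<delta>..u0 0 + \<delta>}"
      for t1 t2 u1 u2 v1 v2 \<phi>1 \<phi>2 \<psi>1 \<psi>2
    proof -
      note D1 = degenerate_pairD[OF P1] and D2 = degenerate_pairD[OF P2]
      note N1 = near[OF t1 P1 u(1)] and N2 = near[OF t2 P2 u(2)]
      have "continuous_on {0..1} (\<lambda>x. h (u2 x) * \<phi>1 x)"
        by (intro continuous_on_mult continuous_on_compose2[OF C2S_derivs(3)[OF h, of UNIV]]
            equilibrium_fluxD(5)[OF D2(1)] equilibrium_fluxD(5)[OF D1(2)]) auto
      then obtain J where J: "((\<lambda>x. h (u2 x) * \<phi>1 x) has_integral J) {0..1}"
        using integrable_continuous_real integrable_on_def by blast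
      have "\<bar>I - J\<bar> \<le> c3 * \<delta>"
      proof (rule has_integral_abs_bound[OF has_integral_diff[OF I(1) J]])
        fix x assume x: "x \<in> {0::real..1}"
        have "\<bar>h (u0 x) - h (u2 x)\<bar> \<le> H * \<bar>u0 x - u2 x\<bar>"
          by (rule abs_diff_le_of_deriv[OF C2S_derivs(1)[OF h] H(3) D0(4)[OF x] D2(4)[OF x]])
        also have "\<dots> \<le> H * (c1 * \<delta>)" using N2[OF x] H by (intro mult_left_mono) auto
        finally have 1: "\<bar>h (u0 x) - h (u2 x)\<bar> * \<bar>\<phi>1 x\<bar> \<le> H * (c1 * \<delta>) * K"
          using N1[OF x] by (intro mult_mono) auto
        have 2: "\<bar>h (u0 x)\<bar> * \<bar>\<phi>0 x - \<phi>1 x\<bar> \<le> H * (c2 * \<delta>)"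
          using H(2)[OF D0(4)[OF x]] N1[OF x] by (intro mult_mono) auto
        have "h (u0 x) * \<phi>0 x - h (u2 x) * \<phi>1 x
            = (h (u0 x) - h (u2 x)) * \<phi>1 x + h (u0 x) * (\<phi>0 x - \<phi>1 x)" by (simp add: algebra_simps)
        then have "\<bar>h (u0 x) * \<phi>0 x - h (u2 x) * \<phi>1 x\<bar>
            \<le> \<bar>h (u0 x) - h (u2 x)\<bar> * \<bar>\<phi>1 x\<bar> + \<bar>h (u0 x)\<bar> * \<bar>\<phi>0 x - \<phi>1 x\<bar>"
          using abs_triangle_ineq[of "(h (u0 x) - h (u2 x)) * \<phi>1 x" "h (u0 x) * (\<phi>0 x - \<phi>1 x)"]
          by (simp add: abs_mult)
        also have "\<dots> \<le> c3 * \<delta>" using 1 2 by (simp add: c3_def algebra_simps)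
        finally show "\<bar>h (u0 x) * \<phi>0 x - h (u2 x) * \<phi>1 x\<bar> \<le> c3 * \<delta>" .
      qed
      then have J\<kappa>: "\<kappa> \<le> \<bar>J\<bar>" using \<delta>(3) by (simp add: \<kappa>_def)
      define R where "R x = \<phi>1 x * (gt t1 (u2 x) - gt t1 (u1 x) - deriv (gt t1) (u1 x) * (u2 x - u1 x))" for x
      \<comment> \<open>The Wronskian of \<open>u2 - u1\<close> and \<open>\<phi>1\<close>, zero at
        both ends. Integrating its derivative is the integration by parts in the test.\<close>
      define W where "W x = \<psi>1 x * (u2 x - u1 x) - \<phi>1 x * (v2 x - v1 x)" for x
      have "((\<lambda>x. R x + (t2 - t1) * (h (u2 x) * \<phi>1 x)) has_integral (W 1 - W 0)) {0..1}"
      proof (rule fundamental_theorem_of_calculus)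
        fix x assume x: "x \<in> {0::real..1}"
        have "(W has_real_derivative \<phi>1 x * (gt t2 (u2 x) - gt t1 (u1 x) - deriv (gt t1) (u1 x) * (u2 x - u1 x)))
            (at x within {0..1})"
          unfolding W_def
          by (auto intro!: derivative_eq_intros equilibrium_fluxD(1,2)[OF D1(1) x] equilibrium_fluxD(1,2)[OF D2(1) x]
              equilibrium_fluxD(1,2)[OF D1(2) x] simp: algebra_simps diff_divide_distrib)
        moreover have "gt t2 (u2 x) = gt t1 (u2 x) + (t2 - t1) * h (u2 x)" by (simp add: gt_def algebra_simps)
        then have "\<phi>1 x * (gt t2 (u2 x) - gt t1 (u1 x) - deriv (gt t1) (u1 x) * (u2 x - u1 x))
            = R x + (t2 - t1) * (h (u2 x) * \<phi>1 x)"
          unfolding R_def by (simp only:) (simp add: algebra_simps)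
        ultimately have "(W has_real_derivative R x + (t2 - t1) * (h (u2 x) * \<phi>1 x)) (at x within {0..1})"
          by (simp only:)
        then show "(W has_vector_derivative R x + (t2 - t1) * (h (u2 x) * \<phi>1 x)) (at x within {0..1})"
          by (simp add: has_real_derivative_iff_has_vector_derivative)
      qed simp
      moreover have "W 1 = 0" "W 0 = 0"
        using equilibrium_fluxD(3,4)[OF D1(1)] equilibrium_fluxD(3,4)[OF D2(1)] equilibrium_fluxD(3,4)[OF D1(2)]
        by (simp_all add: W_def)
      ultimately have "((\<lambda>x. R x + (t2 - t1) * (h (u2 x) * \<phi>1 x)) has_integral 0) {0..1}" by simp
      from has_integral_diff[OF this has_integral_mult_right[OF J, of "t2 - t1"]]
      have RJ: "(R has_integral - ((t2 - t1) * J)) {0..1}" by simp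
      have "\<bar>- ((t2 - t1) * J)\<bar> \<le> C1 * ((u2 0 - u1 0)\<^sup>2 + (t2 - t1)\<^sup>2 * H\<^sup>2)"
      proof (rule has_integral_abs_bound[OF RJ])
        fix x assume x: "x \<in> {0::real..1}"
        have gg: "\<bar>gt t1 y - gt t2 y\<bar> \<le> \<bar>t2 - t1\<bar> * H" if y: "\<bar>y\<bar> \<le> n" for y
        proof -
          have "gt t1 y - gt t2 y = (t1 - t2) * h y" by (simp add: gt_def algebra_simps)
          then show ?thesis using H(2)[OF y] by (simp add: abs_mult abs_minus_commute mult_left_mono)
        qed
        have "\<bar>u1 x - u2 x\<bar> \<le> K * (\<bar>u1 0 - u2 0\<bar> + \<bar>t2 - t1\<bar> * H)"
          unfolding K_def
          by (rule equilibrium_distance(1)[OF D1(1) D2(1) D1(4) D2(4) A(2) gt_facts(1) fgt(3)[OF t1] gg x])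
        then have "\<bar>u1 x - u2 x\<bar>\<^sup>2 \<le> (K * (\<bar>u1 0 - u2 0\<bar> + \<bar>t2 - t1\<bar> * H))\<^sup>2" by (intro power_mono) auto
        also have "\<dots> = K\<^sup>2 * (\<bar>u1 0 - u2 0\<bar> + \<bar>t2 - t1\<bar> * H)\<^sup>2" by (simp add: power_mult_distrib)
        also have "\<dots> \<le> K\<^sup>2 * (2 * ((u2 0 - u1 0)\<^sup>2 + (t2 - t1)\<^sup>2 * H\<^sup>2))"
        proof (rule mult_left_mono)
          have "(p + q)\<^sup>2 \<le> 2 * (p\<^sup>2 + q\<^sup>2)" for p q :: real
            using sum_squares_bound[of p q] by (simp add: power2_sum)
          from this[of "\<bar>u1 0 - u2 0\<bar>" "\<bar>t2 - t1\<bar> * H"]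
          show "(\<bar>u1 0 - u2 0\<bar> + \<bar>t2 - t1\<bar> * H)\<^sup>2 \<le> 2 * ((u2 0 - u1 0)\<^sup>2 + (t2 - t1)\<^sup>2 * H\<^sup>2)"
            by (simp add: power_mult_distrib power2_commute)
        qed simp
        finally have w: "(u2 x - u1 x)\<^sup>2 \<le> K\<^sup>2 * (2 * ((u2 0 - u1 0)\<^sup>2 + (t2 - t1)\<^sup>2 * H\<^sup>2))"
          by (simp add: power2_commute)
        have "\<bar>gt t1 (u2 x) - gt t1 (u1 x) - deriv (gt t1) (u1 x) * (u2 x - u1 x)\<bar> \<le> G * (u2 x - u1 x)\<^sup>2"
          by (rule quadratic_taylor_bound[OF C2S_derivs(1)[OF gt_facts(1)] C2S_derivs(2)[OF gt_facts(1)]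
              fgt(4)[OF t1] D1(4)[OF x] D2(4)[OF x]])
        also have "\<dots> \<le> G * (K\<^sup>2 * (2 * ((u2 0 - u1 0)\<^sup>2 + (t2 - t1)\<^sup>2 * H\<^sup>2)))"
          using w G by (intro mult_left_mono) auto
        finally have "\<bar>R x\<bar> \<le> K * (G * (K\<^sup>2 * (2 * ((u2 0 - u1 0)\<^sup>2 + (t2 - t1)\<^sup>2 * H\<^sup>2))))"
          unfolding R_def abs_mult using N1[OF x] K by (intro mult_mono) auto
        then show "\<bar>R x\<bar> \<le> C1 * ((u2 0 - u1 0)\<^sup>2 + (t2 - t1)\<^sup>2 * H\<^sup>2)"
          by (simp add: C1_def power2_eq_square power3_eq_cube mult_ac)
      qed
      then have "\<bar>t2 - t1\<bar> * \<bar>J\<bar> \<le> C1 * ((u2 0 - u1 0)\<^sup>2 + (t2 - t1)\<^sup>2 * H\<^sup>2)" by (simp add: abs_mult)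
      moreover have "\<kappa> * \<bar>t2 - t1\<bar> \<le> \<bar>t2 - t1\<bar> * \<bar>J\<bar>"
        using mult_right_mono[OF J\<kappa>, of "\<bar>t2 - t1\<bar>"] by (simp add: mult.commute)
      ultimately show ?thesis by linarith
    qed
    \<comment> \<open>For parameters closer than \<open>\<tau>\<close>, half of the left side of
      \<open>quad\<close> absorbs the term with \<open>(t2 - t1)\<^sup>2\<close>.\<close>
    define \<tau> where "\<tau> = \<kappa> / (2 * (C1 * H\<^sup>2))"
    have \<tau>: "\<tau> > 0" using \<kappa> C1 H by (simp add: \<tau>_def)
    define \<eta>' where "\<eta>' = min \<eta> (min \<delta> \<tau>)"
    have \<eta>': "0 < \<eta>'" using \<eta> \<delta> \<tau> by (simp add: \<eta>'_def)
    show "\<exists>t. 0 < t \<and> t < \<eta> \<and> \<not> degenerate_in a n {u0 0 - \<delta>..u0 0 + \<delta>} (\<lambda>x. g x + t * h x)"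
    proof (rule ccontr)
      assume neg: "\<not> ?thesis"
      have "\<exists>u v \<phi> \<psi>. 0 < t \<and> t < \<eta>' \<longrightarrow> degenerate_pair a (gt t) n u v \<phi> \<psi> \<and> u 0 \<in> {u0 0 - \<delta>..u0 0 + \<delta>}" for t
        using neg unfolding degenerate_in_def gt_def \<eta>'_def by (metis min_less_iff_conj)
      then obtain u v \<phi> \<psi> where U: "\<And>t. 0 < t \<Longrightarrow> t < \<eta>' \<Longrightarrow> degenerate_pair a (gt t) n (u t) (v t) (\<phi> t) (\<psi> t)"
        "\<And>t. 0 < t \<Longrightarrow> t < \<eta>' \<Longrightarrow> u t 0 \<in> {u0 0 - \<delta>..u0 0 + \<delta>}" by metis
      show False
      proof (rule pigeonhole_quadratic[OF \<eta>', where \<xi> = "\<lambda>t. u t 0" and b = "u0 0 - \<delta>" and d = "2 * \<delta>"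
            and C = "2 * C1 / \<kappa>"])
        show "u t 0 \<in> {u0 0 - \<delta>..u0 0 - \<delta> + 2 * \<delta>}" if "0 < t" "t < \<eta>'" for t
          using U(2)[OF that] by auto
        fix s t assume s: "0 < s" "s < \<eta>'" and t: "0 < t" "t < \<eta>'"
        have "\<kappa> * \<bar>s - t\<bar> \<le> C1 * ((u s 0 - u t 0)\<^sup>2 + (s - t)\<^sup>2 * H\<^sup>2)"
          using s t by (intro quad[OF _ _ _ _ U(1)[OF t] U(1)[OF s]] U(2)) (auto simp: \<eta>'_def)
        moreover have "C1 * ((s - t)\<^sup>2 * H\<^sup>2) \<le> \<kappa> / 2 * \<bar>s - t\<bar>"
        proof -
          have "\<bar>s - t\<bar> \<le> \<tau>" using s t by (auto simp: \<eta>'_def)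
          then have "C1 * H\<^sup>2 * \<bar>s - t\<bar> \<le> C1 * H\<^sup>2 * \<tau>" using C1 by (intro mult_left_mono) auto
          also have "\<dots> = \<kappa> / 2" using C1 H by (simp add: \<tau>_def)
          finally have "C1 * H\<^sup>2 * \<bar>s - t\<bar> * \<bar>s - t\<bar> \<le> \<kappa> / 2 * \<bar>s - t\<bar>" by (intro mult_right_mono) auto
          moreover have "C1 * H\<^sup>2 * \<bar>s - t\<bar> * \<bar>s - t\<bar> = C1 * ((s - t)\<^sup>2 * H\<^sup>2)"
            by (simp add: power2_eq_square mult.assoc mult.left_commute)
          ultimately show ?thesis by (simp only:)
        qed
        ultimately have "\<kappa> * \<bar>s - t\<bar> \<le> 2 * (C1 * (u s 0 - u t 0)\<^sup>2)" by (simp add: distrib_left)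
        then show "\<bar>s - t\<bar> \<le> 2 * C1 / \<kappa> * (u s 0 - u t 0)\<^sup>2" using \<kappa> by (simp add: field_simps)
      qed (use \<delta> in auto)
    qed
  qed
qed

end

section \<open>Test functions\<close>

text \<open>\<open>C2S\<close> without the condition at \<open>0\<close>, so that the closure rules
  apply to building blocks such as cutoffs.\<close>

definition C2_function :: "(real \<Rightarrow> real) \<Rightarrow> bool" where
  "C2_function f \<longleftrightarrow> (\<exists>f' f''. (\<forall>x. (f has_real_derivative f' x) (at x)) \<and>
     (\<forall>x. (f' has_real_derivative f'' x) (at x)) \<and> continuous_on UNIV f'')"

lemma C2_functionI:
  assumes "\<And>x. (f has_real_derivative f' x) (at x)" "\<And>x. (f' has_real_derivative f'' x) (at x)"
    "continuous_on UNIV f''"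
  shows "C2_function f"
  using assms unfolding C2_function_def by blast

lemma C2_functionE:
  assumes "C2_function f"
  obtains f' f'' where "\<And>x. (f has_real_derivative f' x) (at x)" "\<And>x. (f' has_real_derivative f'' x) (at x)"
    "continuous_on UNIV f''" "continuous_on UNIV f'" "continuous_on UNIV f"
proof -
  obtain f' f'' where f: "\<And>x. (f has_real_derivative f' x) (at x)" "\<And>x. (f' has_real_derivative f'' x) (at x)"
    "continuous_on UNIV f''" using assms unfolding C2_function_def by blast
  have "continuous_on UNIV f'" "continuous_on UNIV f"
    using f(1,2) by (meson DERIV_isCont continuous_at_imp_continuous_on)+
  with f show ?thesis using that by blast
qed

lemma C2S_eq: "f \<in> C2S \<longleftrightarrow> f 0 = 0 \<and> C2_function f"
  by (simp add: C2S_iff C2_function_def)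

lemma C2_affine: "C2_function (\<lambda>x. k + l * x)"
  by (rule C2_functionI[of _ "\<lambda>_. l" "\<lambda>_. 0"]) (auto intro!: derivative_eq_intros)

lemma C2_diff:
  assumes "C2_function f" "C2_function g"
  shows "C2_function (\<lambda>x. f x - g x)"
proof -
  obtain f' f'' where f: "\<And>x. (f has_real_derivative f' x) (at x)" "\<And>x. (f' has_real_derivative f'' x) (at x)"
    "continuous_on UNIV f''" using assms(1) C2_functionE by metis
  obtain g' g'' where g: "\<And>x. (g has_real_derivative g' x) (at x)" "\<And>x. (g' has_real_derivative g'' x) (at x)"
    "continuous_on UNIV g''" using assms(2) C2_functionE by metis
  show ?thesis
    by (rule C2_functionI[of _ "\<lambda>x. f' x - g' x" "\<lambda>x. f'' x - g'' x"]) (intro DERIV_diff continuous_on_diff f g)+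
qed

lemma C2_mult:
  assumes "C2_function f" "C2_function g"
  shows "C2_function (\<lambda>x. f x * g x)"
proof -
  obtain f' f'' where f: "\<And>x. (f has_real_derivative f' x) (at x)" "\<And>x. (f' has_real_derivative f'' x) (at x)"
    "continuous_on UNIV f''" "continuous_on UNIV f'" "continuous_on UNIV f" using assms(1) C2_functionE by metis
  obtain g' g'' where g: "\<And>x. (g has_real_derivative g' x) (at x)" "\<And>x. (g' has_real_derivative g'' x) (at x)"
    "continuous_on UNIV g''" "continuous_on UNIV g'" "continuous_on UNIV g" using assms(2) C2_functionE by metis
  show ?thesis
  proof (rule C2_functionI)
    show "((\<lambda>x. f x * g x) has_real_derivative f' x * g x + f x * g' x) (at x)" for x
      by (auto intro!: derivative_eq_intros f g)
    show "((\<lambda>x. f' x * g x + f x * g' x) has_real_derivative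
        (f'' x * g x + f' x * g' x) + (f' x * g' x + f x * g'' x)) (at x)" for x
      by (auto intro!: derivative_eq_intros f g simp: algebra_simps)
    show "continuous_on UNIV (\<lambda>x. (f'' x * g x + f' x * g' x) + (f' x * g' x + f x * g'' x))"
      by (intro continuous_intros f g)
  qed
qed

lemma C2_compose:
  assumes "C2_function f" "C2_function g"
  shows "C2_function (\<lambda>x. f (g x))"
proof -
  obtain f' f'' where f: "\<And>x. (f has_real_derivative f' x) (at x)" "\<And>x. (f' has_real_derivative f'' x) (at x)"
    "continuous_on UNIV f''" "continuous_on UNIV f'" "continuous_on UNIV f" using assms(1) C2_functionE by metis
  obtain g' g'' where g: "\<And>x. (g has_real_derivative g' x) (at x)" "\<And>x. (g' has_real_derivative g'' x) (at x)"
    "continuous_on UNIV g''" "continuous_on UNIV g'" "continuous_on UNIV g" using assms(2) C2_functionE by metis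
  show ?thesis
  proof (rule C2_functionI)
    show "((\<lambda>x. f (g x)) has_real_derivative f' (g x) * g' x) (at x)" for x
      by (rule DERIV_chain2[OF f(1) g(1)])
    show "((\<lambda>x. f' (g x) * g' x) has_real_derivative f'' (g x) * g' x * g' x + f' (g x) * g'' x) (at x)" for x
      by (auto intro!: derivative_eq_intros DERIV_chain2[OF f(2) g(1)] g)
    show "continuous_on UNIV (\<lambda>x. f'' (g x) * g' x * g' x + f' (g x) * g'' x)"
      by (intro continuous_intros g continuous_on_compose2[OF f(3) g(5)] continuous_on_compose2[OF f(4) g(5)]) auto
  qed
qed

lemma has_derivative_positive_part_power:
  "((\<lambda>s::real. (max 0 s) ^ Suc (Suc k)) has_real_derivative real (Suc (Suc k)) * (max 0 s) ^ Suc k) (at s)"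
proof (cases s "0::real" rule: linorder_cases)
  case less
  have "((\<lambda>s::real. 0) has_real_derivative 0) (at s)" by simp
  then have "((\<lambda>s::real. (max 0 s) ^ Suc (Suc k)) has_real_derivative 0) (at s)"
    by (rule has_field_derivative_transform_within_open[where S = "{..<0}"]) (use less in auto)
  then show ?thesis using less by simp
next
  case greater
  have "((\<lambda>s::real. s ^ Suc (Suc k)) has_real_derivative real (Suc (Suc k)) * s ^ Suc k) (at s)"
    using DERIV_pow[of "Suc (Suc k)" s] by simp
  then have "((\<lambda>s::real. (max 0 s) ^ Suc (Suc k)) has_real_derivative real (Suc (Suc k)) * s ^ Suc k) (at s)"
    by (rule has_field_derivative_transform_within_open[where S = "{0<..}"]) (use greater in \<open>auto simp: max_def\<close>)
  then show ?thesis using greater by (simp add: max_def)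
next
  case equal
  have "((\<lambda>y::real. (max 0 y) ^ Suc k) \<longlongrightarrow> (max 0 0) ^ Suc k) (at 0)"
    by (intro tendsto_intros)
  then have "((\<lambda>y::real. (max 0 y) ^ Suc k) \<longlongrightarrow> 0) (at 0)" by simp
  moreover have "eventually (\<lambda>y::real. (max 0 y) ^ Suc k = ((max 0 y) ^ Suc (Suc k) - (max 0 0) ^ Suc (Suc k)) / (y - 0)) (at 0)"
    by (auto simp: eventually_at_filter max_def)
  ultimately have "((\<lambda>y::real. ((max 0 y) ^ Suc (Suc k) - (max 0 0) ^ Suc (Suc k)) / (y - 0)) \<longlongrightarrow> 0) (at 0)"
    by (rule Lim_transform_eventually)
  then show ?thesis using equal by (simp add: has_field_derivative_iff)
qed

lemma C2_positive_part_cube: "C2_function (\<lambda>s. (max 0 s) ^ 3)"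
proof (rule C2_functionI)
  show "((\<lambda>s. (max 0 s) ^ 3) has_real_derivative 3 * (max 0 s) ^ 2) (at s)" for s :: real
    using has_derivative_positive_part_power[of 1 s] by (simp add: numeral_3_eq_3 numeral_2_eq_2)
  show "((\<lambda>s. 3 * (max 0 s) ^ 2) has_real_derivative 3 * (2 * max 0 s)) (at s)" for s :: real
    using DERIV_cmult[OF has_derivative_positive_part_power[of 0 s], of 3] by (simp add: numeral_2_eq_2)
  show "continuous_on UNIV (\<lambda>s::real. 3 * (2 * max 0 s))" by (intro continuous_intros)
qed

text \<open>On \<open>{0..1}\<close> this is \<open>1 - (1 - s ^ 3) ^ 3\<close>; the inner cube
  makes the junction at \<open>0\<close> twice continuously differentiable, the outer cube the one
  at \<open>1\<close>.\<close>

definition smooth_step :: "real \<Rightarrow> real" where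
  "smooth_step s = 1 - (max 0 (1 - (max 0 s) ^ 3)) ^ 3"

lemma smooth_step: "s \<le> 0 \<Longrightarrow> smooth_step s = 0" "1 \<le> s \<Longrightarrow> smooth_step s = 1"
  "0 \<le> smooth_step s" "smooth_step s \<le> 1"
proof -
  show "s \<le> 0 \<Longrightarrow> smooth_step s = 0" by (simp add: smooth_step_def max_def)
  show "smooth_step s = 1" if s: "1 \<le> s"
  proof -
    have "1 \<le> (max 0 s) ^ 3" using s by (simp add: max_def one_le_power)
    then show ?thesis by (simp add: smooth_step_def max_def)
  qed
  have "(max 0 (1 - (max 0 s) ^ 3)) ^ 3 \<le> 1" by (rule power_le_one) auto
  then show "0 \<le> smooth_step s" by (simp add: smooth_step_def)
  show "smooth_step s \<le> 1" by (simp add: smooth_step_def)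
qed

lemma C2_smooth_step: "C2_function smooth_step"
proof -
  have 1: "C2_function (\<lambda>s. 1 - (max 0 s) ^ 3)"
    using C2_diff[OF C2_affine[of 1 0] C2_positive_part_cube] by simp
  show ?thesis
    using C2_diff[OF C2_affine[of 1 0] C2_compose[OF C2_positive_part_cube 1]]
    by (simp add: smooth_step_def[abs_def])
qed

text \<open>As \<open>m\<close> tends to infinity, this converges to the indicator function of \<open>{c<..<d}\<close>.\<close>

definition window :: "real \<Rightarrow> real \<Rightarrow> real \<Rightarrow> real \<Rightarrow> real" where
  "window m c d s = smooth_step (m * (s - c)) * smooth_step (m * (d - s))"

lemma C2_window: "C2_function (window m c d)"
proof -
  have "C2_function (\<lambda>s. smooth_step (- (m * c) + m * s) * smooth_step (m * d + (- m) * s))"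
    by (intro C2_mult C2_compose[OF C2_smooth_step] C2_affine)
  then show ?thesis by (simp add: window_def[abs_def] algebra_simps)
qed

lemma window_range: "0 \<le> window m c d s" "window m c d s \<le> 1"
  by (auto simp: window_def smooth_step intro: mult_le_one)

lemma window_eq_0: "0 < m \<Longrightarrow> s \<le> c \<or> d \<le> s \<Longrightarrow> window m c d s = 0"
  using smooth_step(1)[of "m * (s - c)"] smooth_step(1)[of "m * (d - s)"]
  by (auto simp: window_def mult_nonneg_nonpos)

lemma window_eq_1: "1 \<le> m * (s - c) \<Longrightarrow> 1 \<le> m * (d - s) \<Longrightarrow> window m c d s = 1"
  by (simp add: window_def smooth_step)

text \<open>A Whitney tolerance may decay at infinity but has a positive minimum on a compact
  interval. For perturbations supported there, uniform smallness suffices.\<close>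

definition supported_C2S :: "real \<Rightarrow> (real \<Rightarrow> real) \<Rightarrow> bool" where
  "supported_C2S n h \<longleftrightarrow> h \<in> C2S \<and> (\<forall>x. n < \<bar>x\<bar> \<longrightarrow> h x = 0)"

definition C2_small :: "real \<Rightarrow> (real \<Rightarrow> real) \<Rightarrow> bool" where
  "C2_small \<eta> h \<longleftrightarrow> (\<forall>x. \<bar>h x\<bar> < \<eta> \<and> \<bar>deriv h x\<bar> < \<eta> \<and> \<bar>deriv (deriv h) x\<bar> < \<eta>)"

lemma zero_in_C2S: "(\<lambda>_. 0) \<in> C2S" "deriv (\<lambda>_. 0) = (\<lambda>_. 0::real)"
  using C2_affine[of 0 0] by (auto simp: C2S_eq)

lemma C2S_scaled:
  assumes "h \<in> C2S"
  shows "(\<lambda>x. t * h x) \<in> C2S" "deriv (\<lambda>x. t * h x) = (\<lambda>x. t * deriv h x)"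
    "deriv (deriv (\<lambda>x. t * h x)) = (\<lambda>x. t * deriv (deriv h) x)"
  using C2S_add_scaled[OF zero_in_C2S(1) assms, of t] zero_in_C2S(2) by simp_all

lemma C2S_add:
  assumes "f \<in> C2S" "h \<in> C2S"
  shows "(\<lambda>x. f x + h x) \<in> C2S" "deriv (\<lambda>x. f x + h x) = (\<lambda>x. deriv f x + deriv h x)"
    "deriv (deriv (\<lambda>x. f x + h x)) = (\<lambda>x. deriv (deriv f) x + deriv (deriv h) x)"
  using C2S_add_scaled[OF assms, of 1] by simp_all

lemma supported_C2S_derivs:
  assumes h: "supported_C2S n h" and x: "n < \<bar>x\<bar>"
  shows "h x = 0" "deriv h x = 0" "deriv (deriv h) x = 0"
proof -
  have hC: "h \<in> C2S" and h0: "\<And>y. n < \<bar>y\<bar> \<Longrightarrow> h y = 0" using h by (auto simp: supported_C2S_def)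
  show "h x = 0" by (rule h0[OF x])
  have op: "open {y. n < \<bar>y\<bar>}" by (intro open_Collect_less continuous_intros)
  have d: "deriv h y = 0" if y: "n < \<bar>y\<bar>" for y
  proof -
    have "(h has_real_derivative 0) (at y)"
      by (rule has_field_derivative_transform_within_open[OF DERIV_const[of 0] op]) (use y h0 in auto)
    then show ?thesis by (rule DERIV_imp_deriv)
  qed
  show "deriv h x = 0" by (rule d[OF x])
  have "(deriv h has_real_derivative 0) (at x)"
    by (rule has_field_derivative_transform_within_open[OF DERIV_const[of 0] op]) (use x d in auto)
  then show "deriv (deriv h) x = 0" by (rule DERIV_imp_deriv)
qed

lemma supported_C2S_add: "supported_C2S n h \<Longrightarrow> supported_C2S n k \<Longrightarrow> supported_C2S n (\<lambda>x. h x + k x)"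
  by (auto simp: supported_C2S_def C2S_add)

lemma C2_small_add:
  assumes "h \<in> C2S" "k \<in> C2S" "C2_small \<eta> h" "C2_small \<eta>' k"
  shows "C2_small (\<eta> + \<eta>') (\<lambda>x. h x + k x)"
  unfolding C2_small_def C2S_add(3)[OF assms(1,2)] unfolding C2S_add(2)[OF assms(1,2)]
proof (intro allI conjI)
  fix x
  have "\<bar>h x\<bar> < \<eta>" "\<bar>deriv h x\<bar> < \<eta>" "\<bar>deriv (deriv h) x\<bar> < \<eta>"
    "\<bar>k x\<bar> < \<eta>'" "\<bar>deriv k x\<bar> < \<eta>'" "\<bar>deriv (deriv k) x\<bar> < \<eta>'"
    using assms(3,4) by (auto simp: C2_small_def)
  then show "\<bar>h x + k x\<bar> < \<eta> + \<eta>'" "\<bar>deriv h x + deriv k x\<bar> < \<eta> + \<eta>'"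
    "\<bar>deriv (deriv h) x + deriv (deriv k) x\<bar> < \<eta> + \<eta>'" by linarith+
qed

lemma C2_small_mono: "C2_small \<eta> h \<Longrightarrow> \<eta> \<le> \<eta>' \<Longrightarrow> C2_small \<eta>' h"
  unfolding C2_small_def by (meson less_le_trans)

lemma small_multiples:
  assumes h: "supported_C2S n h" and \<eta>: "0 < \<eta>"
  obtains t0 where "0 < t0" "\<And>t. \<bar>t\<bar> < t0 \<Longrightarrow> supported_C2S n (\<lambda>x. t * h x) \<and> C2_small \<eta> (\<lambda>x. t * h x)"
proof -
  have hC: "h \<in> C2S" using h by (simp add: supported_C2S_def)
  obtain B0 where B0: "B0 > 0" "\<And>x. \<bar>x\<bar> \<le> n \<Longrightarrow> \<bar>h x\<bar> \<le> B0"
    using bounded_on_symmetric_interval[OF C2S_derivs(3)[OF hC]] by blast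
  obtain B1 where B1: "B1 > 0" "\<And>x. \<bar>x\<bar> \<le> n \<Longrightarrow> \<bar>deriv h x\<bar> \<le> B1"
    using bounded_on_symmetric_interval[OF C2S_derivs(4)[OF hC]] by blast
  obtain B2 where B2: "B2 > 0" "\<And>x. \<bar>x\<bar> \<le> n \<Longrightarrow> \<bar>deriv (deriv h) x\<bar> \<le> B2"
    using bounded_on_symmetric_interval[OF C2S_derivs(5)[OF hC]] by blast
  define B where "B = B0 + B1 + B2"
  have B: "B > 0" using B0(1) B1(1) B2(1) by (simp add: B_def)
  have hB: "\<bar>h x\<bar> \<le> B" "\<bar>deriv h x\<bar> \<le> B" "\<bar>deriv (deriv h) x\<bar> \<le> B" for x
    using supported_C2S_derivs[OF h, of x] B0(2)[of x] B1(2)[of x] B2(2)[of x] B0(1) B1(1) B2(1)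
    by (cases "n < \<bar>x\<bar>"; simp add: B_def)+
  show ?thesis
  proof (rule that[of "\<eta> / B"])
    show "0 < \<eta> / B" using \<eta> B by simp
    fix t assume t: "\<bar>t\<bar> < \<eta> / B"
    have le: "\<bar>t * y\<bar> < \<eta>" if "\<bar>y\<bar> \<le> B" for y
    proof -
      have "\<bar>t * y\<bar> \<le> \<bar>t\<bar> * B" unfolding abs_mult using that by (intro mult_left_mono) auto
      also have "\<dots> < \<eta>" using t B by (simp add: field_simps)
      finally show ?thesis .
    qed
    have "supported_C2S n (\<lambda>x. t * h x)" using h C2S_scaled(1)[OF hC] by (simp add: supported_C2S_def)
    moreover have "C2_small \<eta> (\<lambda>x. t * h x)"
      unfolding C2_small_def C2S_scaled(3)[OF hC] unfolding C2S_scaled(2)[OF hC] using le hB by blast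
    ultimately show "supported_C2S n (\<lambda>x. t * h x) \<and> C2_small \<eta> (\<lambda>x. t * h x)" by simp
  qed
qed

lemma C1_close_add:
  assumes "f \<in> C2S" "p \<in> C2S" "C2_small \<eta> p"
  shows "C1_close n \<eta> f (\<lambda>x. f x + p x)"
  unfolding C1_close_def C2S_add[OF assms(1,2)] using assms(3) by (auto simp: C2_small_def less_imp_le)

text \<open>If all test integrals vanished, dominated convergence along the windows about
  \<open>C\<close> would give the orthogonality relations. The conditions
  \<open>r < \<bar>C\<bar>\<close> and \<open>r < 1\<close> make these windows vanish at
  \<open>0\<close> and outside \<open>{-(n+1)..n+1}\<close>.\<close>

lemma test_function_exists:
  assumes cont: "continuous_on {0..1} u" "continuous_on {0..1} \<phi>" and bound: "\<And>x. x \<in> {0..1} \<Longrightarrow> \<bar>u x\<bar> \<le> n"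
    and no: "\<not> orthogonal_to_levels u \<phi>"
  shows "\<exists>h I. supported_C2S (n + 1) h \<and> ((\<lambda>x. h (u x) * \<phi> x) has_integral I) {0..1} \<and> I \<noteq> 0"
proof (rule ccontr)
  assume neg: "\<not> ?thesis"
  have "orthogonal_to_levels u \<phi>"
    unfolding orthogonal_to_levels_def
  proof safe
    fix x0 r :: real assume x0: "x0 \<in> {0..1}" and r: "0 < r" "r < \<bar>u x0\<bar>" "r < 1"
    define C where "C = u x0"
    define h where "h j = window (real (Suc j)) (C - r) (C + r)" for j
    have supp: "supported_C2S (n + 1) (h j)" for j
    proof -
      have "h j 0 = 0" using r by (auto simp: h_def C_def abs_if split: if_splits intro!: window_eq_0)
      moreover have "h j x = 0" if "n + 1 < \<bar>x\<bar>" for x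
        using that bound[OF x0] r by (auto simp: h_def C_def abs_if split: if_splits intro!: window_eq_0)
      ultimately show ?thesis using C2_window by (auto simp: supported_C2S_def C2S_eq h_def)
    qed
    have int: "((\<lambda>x. h j (u x) * \<phi> x) has_integral 0) {0..1}" for j
    proof -
      have "continuous_on {0..1} (\<lambda>x. h j (u x) * \<phi> x)"
        using supp[of j] unfolding supported_C2S_def
        by (intro continuous_on_mult cont continuous_on_compose2[OF C2S_derivs(3)[of "h j" UNIV] cont(1)]) auto
      then obtain I where I: "((\<lambda>x. h j (u x) * \<phi> x) has_integral I) {0..1}"
        using integrable_continuous_real integrable_on_def by blast
      then have "I = 0" using neg supp[of j] by blast
      then show ?thesis using I by simp
    qed
    have "((\<lambda>x. if \<bar>u x - C\<bar> < r then \<phi> x else 0) has_integral 0) {0..1}"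
    proof (rule has_integral_dominated_convergence[OF int])
      show "(\<lambda>x. \<bar>\<phi> x\<bar>) integrable_on {0..1}"
        by (intro integrable_continuous_real continuous_intros cont)
      show "\<forall>x\<in>{0..1}. norm (h j (u x) * \<phi> x) \<le> \<bar>\<phi> x\<bar>" for j
      proof
        fix x
        have "\<bar>h j (u x)\<bar> \<le> 1" using window_range by (simp add: h_def)
        then have "\<bar>h j (u x)\<bar> * \<bar>\<phi> x\<bar> \<le> 1 * \<bar>\<phi> x\<bar>" by (rule mult_right_mono) simp
        then show "norm (h j (u x) * \<phi> x) \<le> \<bar>\<phi> x\<bar>" by (simp add: abs_mult)
      qed
      show "\<forall>x\<in>{0..1}. (\<lambda>j. h j (u x) * \<phi> x) \<longlonglongrightarrow> (if \<bar>u x - C\<bar> < r then \<phi> x else 0)"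
      proof
        fix x :: real
        show "(\<lambda>j. h j (u x) * \<phi> x) \<longlonglongrightarrow> (if \<bar>u x - C\<bar> < r then \<phi> x else 0)"
        proof (cases "\<bar>u x - C\<bar> < r")
          case True
          define g where "g = r - \<bar>u x - C\<bar>"
          have g: "g > 0" using True by (simp add: g_def)
          obtain N :: nat where N: "1 / g < real N" using reals_Archimedean2 by blast
          have "h j (u x) * \<phi> x = \<phi> x" if j: "j \<ge> N" for j
          proof -
            have "1 \<le> real N * g" using N g by (simp add: field_simps)
            also have "\<dots> \<le> real (Suc j) * g" using j g by (intro mult_right_mono) auto
            finally have "1 \<le> real (Suc j) * g" .
            moreover have "real (Suc j) * g \<le> real (Suc j) * (u x - (C - r))" "real (Suc j) * g \<le> real (Suc j) * (C + r - u x)"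
              by (intro mult_left_mono; simp add: g_def)+
            ultimately have "h j (u x) = 1" unfolding h_def by (intro window_eq_1) linarith+
            then show ?thesis by simp
          qed
          then have "eventually (\<lambda>j. h j (u x) * \<phi> x = \<phi> x) sequentially"
            by (auto simp: eventually_sequentially)
          then show ?thesis using True by (simp add: tendsto_eventually)
        next
          case False
          then have "h j (u x) = 0" for j unfolding h_def by (intro window_eq_0) auto
          then show ?thesis using False by simp
        qed
      qed
    qed auto
    then show "((\<lambda>x. if \<bar>u x - u x0\<bar> < r then \<phi> x else 0) has_integral 0) {0..1}" by (simp add: C_def)
  qed
  then show False using no by blast
qed

text \<open>Each point is singled out by an interval with rational end points, which injects
  \<open>S\<close> into pairs of rationals.\<close>

lemma countable_if_isolated:
  fixes S :: "real set"
  assumes "\<And>x. x \<in> S \<Longrightarrow> \<exists>\<delta>>0. \<forall>y\<in>S. \<bar>y - x\<bar> < \<delta> \<longrightarrow> y = x"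
  shows "countable S"
proof -
  have "\<exists>q1 q2. q1 \<in> \<rat> \<and> q2 \<in> \<rat> \<and> (\<forall>y\<in>S. q1 < y \<and> y < q2 \<longleftrightarrow> y = x)" if x: "x \<in> S" for x
  proof -
    obtain \<delta> where \<delta>: "\<delta> > 0" "\<forall>y\<in>S. \<bar>y - x\<bar> < \<delta> \<longrightarrow> y = x" using assms[OF x] by blast
    obtain q1 where q1: "q1 \<in> \<rat>" "x - \<delta> < q1" "q1 < x" using Rats_dense_in_real[of "x - \<delta>" x] \<delta>(1) by auto
    obtain q2 where q2: "q2 \<in> \<rat>" "x < q2" "q2 < x + \<delta>" using Rats_dense_in_real[of x "x + \<delta>"] \<delta>(1) by auto
    show ?thesis
    proof (rule exI[of _ q1], rule exI[of _ q2], intro conjI q1(1) q2(1) ballI iffI)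
      fix y assume "y \<in> S" "q1 < y \<and> y < q2"
      then show "y = x" using \<delta>(2) q1 q2 by auto
    qed (use q1 q2 in auto)
  qed
  then obtain q1 q2 where q: "\<And>x. x \<in> S \<Longrightarrow> q1 x \<in> \<rat>" "\<And>x. x \<in> S \<Longrightarrow> q2 x \<in> \<rat>"
    "\<And>x y. x \<in> S \<Longrightarrow> y \<in> S \<Longrightarrow> q1 x < y \<and> y < q2 x \<longleftrightarrow> y = x" by metis
  have "inj_on (\<lambda>x. (q1 x, q2 x)) S"
    using q(3) by (auto simp: inj_on_def) metis
  moreover have "countable ((\<lambda>x. (q1 x, q2 x)) ` S)"
    by (rule countable_subset[of _ "\<rat> \<times> \<rat>"]) (use q countable_rat in auto)
  ultimately show ?thesis by (rule countable_image_inj_on[rotated])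
qed

section \<open>Genericity\<close>

text \<open>The eigenvalues of \<open>- (a \<phi>\<^sub>x)\<^sub>x\<close>. A constant equilibrium
  \<open>c\<close> is degenerate exactly when the slope of \<open>f\<close> at \<open>c\<close> is
  one of them.\<close>

definition neumann_spectrum :: "(real \<Rightarrow> real) \<Rightarrow> real set" where
  "neumann_spectrum a = {\<mu>. \<exists>\<phi> \<psi>. equilibrium_flux a (\<lambda>x. \<mu> * \<phi> x) \<phi> \<psi> \<and> \<phi> 0 = 1}"

text \<open>Slope \<open>0\<close> always belongs to the spectrum, with constant eigenfunction, and
  cannot be moved by rescaling. It is tolerated at \<open>c \<noteq> 0\<close>, where a window about
  \<open>c\<close> detects the kernel, but not at \<open>c = 0\<close>, where test functions
  vanish.\<close>

definition tame_constants :: "(real \<Rightarrow> real) \<Rightarrow> real \<Rightarrow> (real \<Rightarrow> real) \<Rightarrow> bool" where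
  "tame_constants a n g \<longleftrightarrow>
     (\<forall>c. \<bar>c\<bar> \<le> n \<and> g c = 0 \<and> deriv g c \<in> neumann_spectrum a \<longrightarrow> c \<noteq> 0 \<and> deriv g c = 0)"

context diffusion
begin

text \<open>Eigenfunctions of different eigenvalues are orthogonal. With value \<open>1\<close> at
  \<open>0\<close> they depend continuously on the eigenvalue, so for a close eigenvalue the inner
  product would be near the positive number \<open>Q\<close>.\<close>

lemma neumann_spectrum_isolated:
  assumes \<mu>: "\<mu> \<in> neumann_spectrum a"
  shows "\<exists>\<delta>>0. \<forall>\<nu>\<in>neumann_spectrum a. \<bar>\<nu> - \<mu>\<bar> < \<delta> \<longrightarrow> \<nu> = \<mu>"
proof -
  obtain A where A: "A > 0" "\<And>x. x \<in> {0..1} \<Longrightarrow> \<bar>1 / a x\<bar> \<le> A" using inverse_bounded by blast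
  obtain \<phi> \<psi> where \<phi>: "equilibrium_flux a (\<lambda>x. \<mu> * \<phi> x) \<phi> \<psi>" "\<phi> 0 = 1"
    using \<mu> unfolding neumann_spectrum_def by blast
  define L where "L = \<bar>\<mu>\<bar> + 1"
  define K where "K = exp (A + L + 1)"
  have K: "K > 0" by (simp add: K_def)
  note \<phi>_cont = equilibrium_fluxD(5)[OF \<phi>(1)]
  have "continuous_on {0..1} (\<lambda>x. \<phi> x * \<phi> x)" by (intro continuous_on_mult \<phi>_cont)
  then obtain Q where Q: "((\<lambda>x. \<phi> x * \<phi> x) has_integral Q) {0..1}"
    using integrable_continuous_real integrable_on_def by blast
  have "Q \<ge> 0" by (rule has_integral_nonneg[OF Q]) auto
  moreover have "Q \<noteq> 0"
  proof
    assume "Q = 0"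
    then have "((\<lambda>x. \<phi> x * \<phi> x) has_integral 0) (cbox 0 1)" using Q by simp
    then have "\<phi> 0 * \<phi> 0 = 0"
      by (rule has_integral_0_cbox_imp_0[rotated 2]) (auto intro!: continuous_on_mult \<phi>_cont)
    then show False using \<phi>(2) by simp
  qed
  ultimately have Qpos: "Q > 0" by simp
  define \<delta> where "\<delta> = min 1 (Q / (2 * K ^ 3))"
  have \<delta>: "\<delta> > 0" "\<delta> \<le> 1" "K ^ 3 * \<delta> \<le> Q / 2"
  proof -
    show "\<delta> > 0" "\<delta> \<le> 1" using Qpos K by (auto simp: \<delta>_def)
    have "K ^ 3 * \<delta> \<le> K ^ 3 * (Q / (2 * K ^ 3))" using K by (intro mult_left_mono) (auto simp: \<delta>_def)
    then show "K ^ 3 * \<delta> \<le> Q / 2" using K by simp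
  qed
  have "\<nu> = \<mu>" if \<nu>: "\<nu> \<in> neumann_spectrum a" "\<bar>\<nu> - \<mu>\<bar> < \<delta>" for \<nu>
  proof (rule ccontr)
    assume ne: "\<nu> \<noteq> \<mu>"
    obtain \<theta> \<omega> where \<theta>: "equilibrium_flux a (\<lambda>x. \<nu> * \<theta> x) \<theta> \<omega>" "\<theta> 0 = 1"
      using \<nu>(1) unfolding neumann_spectrum_def by blast
    define W where "W x = \<phi> x * \<omega> x - \<theta> x * \<psi> x" for x
    have "((\<lambda>x. (\<mu> - \<nu>) * (\<phi> x * \<theta> x)) has_integral (W 1 - W 0)) {0..1}"
    proof (rule fundamental_theorem_of_calculus)
      fix x assume x: "x \<in> {0::real..1}"
      have "(W has_real_derivative (\<mu> - \<nu>) * (\<phi> x * \<theta> x)) (at x within {0..1})"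
        unfolding W_def
        by (auto intro!: derivative_eq_intros equilibrium_fluxD(1,2)[OF \<phi>(1) x] equilibrium_fluxD(1,2)[OF \<theta>(1) x]
            simp: algebra_simps)
      then show "(W has_vector_derivative (\<mu> - \<nu>) * (\<phi> x * \<theta> x)) (at x within {0..1})"
        by (simp add: has_real_derivative_iff_has_vector_derivative)
    qed simp
    moreover have "W 1 = 0" "W 0 = 0"
      using equilibrium_fluxD(3,4)[OF \<phi>(1)] equilibrium_fluxD(3,4)[OF \<theta>(1)] by (simp_all add: W_def)
    ultimately have "((\<lambda>x. (\<mu> - \<nu>) * (\<phi> x * \<theta> x)) has_integral 0) {0..1}" by simp
    from has_integral_mult_right[OF this, of "1 / (\<mu> - \<nu>)"]
    have orth: "((\<lambda>x. \<phi> x * \<theta> x) has_integral 0) {0..1}" using ne by simp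
    have "\<bar>Q - 0\<bar> \<le> K ^ 3 * \<delta>"
    proof (rule has_integral_abs_bound[OF has_integral_diff[OF Q orth]])
      fix x assume x: "x \<in> {0::real..1}"
      have \<mu>L: "\<bar>\<mu>\<bar> \<le> L" "\<bar>\<nu>\<bar> \<le> L" "\<bar>\<mu> - \<nu>\<bar> \<le> \<delta>" using \<nu>(2) \<delta>(2) by (auto simp: L_def)
      have "\<bar>\<phi> x - \<theta> x\<bar> \<le> K\<^sup>2 * \<delta>"
        unfolding K_def by (rule kernel_distance(1)[OF \<phi> \<theta> A(2) \<mu>L x])
      moreover have "\<bar>\<phi> x\<bar> \<le> K" unfolding K_def by (rule kernel_bound[OF \<phi> A(2) \<mu>L(1) x])
      ultimately have "\<bar>\<phi> x\<bar> * \<bar>\<phi> x - \<theta> x\<bar> \<le> K * (K\<^sup>2 * \<delta>)" by (intro mult_mono) auto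
      then show "\<bar>\<phi> x * \<phi> x - \<phi> x * \<theta> x\<bar> \<le> K ^ 3 * \<delta>"
        by (simp add: right_diff_distrib[symmetric] abs_mult power2_eq_square power3_eq_cube mult_ac)
    qed
    then show False using \<delta>(3) Qpos by simp
  qed
  then show ?thesis using \<delta>(1) by blast
qed

lemma countable_neumann_spectrum: "countable (neumann_spectrum a)"
  by (rule countable_if_isolated[OF neumann_spectrum_isolated])

text \<open>A first perturbation makes the slope at \<open>0\<close> nonzero. Multiplying by \<open>1 + s\<close> keeps the zeros and
  scales the nonzero slopes there.\<close>

lemma tame_constants_dense:
  assumes f: "f \<in> C2S" and n: "0 < n" and \<eta>: "0 < \<eta>"
  shows "\<exists>p. supported_C2S (n + 1) p \<and> C2_small \<eta> p \<and> tame_constants a n (\<lambda>x. f x + p x)"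
proof -
  define \<theta> where "\<theta> = window 1 (- (n + 1)) (n + 1)"
  have \<theta>1: "\<theta> x = 1" if "\<bar>x\<bar> \<le> n" for x using that unfolding \<theta>_def by (intro window_eq_1) auto
  have \<theta>0: "\<theta> x = 0" if "n + 1 < \<bar>x\<bar>" for x using that unfolding \<theta>_def by (intro window_eq_0) auto
  have \<theta>C: "C2_function \<theta>" unfolding \<theta>_def by (rule C2_window)
  have cut: "supported_C2S (n + 1) (\<lambda>x. \<theta> x * g x)" if "C2_function g" "g 0 = 0" for g
    using C2_mult[OF \<theta>C that(1)] that(2) \<theta>0 by (auto simp: supported_C2S_def C2S_eq)
  have \<eta>2: "0 < \<eta> / 2" using \<eta> by simp
  \<comment> \<open>A cut-off identity, which changes the slope at \<open>0\<close> by exactly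
    \<open>t\<close>.\<close>
  define k where "k x = \<theta> x * x" for x
  have k: "supported_C2S (n + 1) k" unfolding k_def using cut[of "\<lambda>x. x"] C2_affine[of 0 1] by simp
  have kC: "k \<in> C2S" using k by (simp add: supported_C2S_def)
  have "((\<lambda>x. x) has_real_derivative 1) (at 0)" by simp
  then have "(k has_real_derivative 1) (at 0)"
    by (rule has_field_derivative_transform_within_open[where S = "{-n<..<n}"]) (use n \<theta>1 in \<open>auto simp: k_def\<close>)
  then have k0: "deriv k 0 = 1" by (rule DERIV_imp_deriv)
  obtain t0 where t0: "0 < t0" "\<And>t. \<bar>t\<bar> < t0 \<Longrightarrow> supported_C2S (n + 1) (\<lambda>x. t * k x) \<and> C2_small (\<eta> / 2) (\<lambda>x. t * k x)"
    using small_multiples[OF k \<eta>2] by metis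
  obtain t where t: "\<bar>t\<bar> < t0" "deriv f 0 + t \<noteq> 0"
  proof (cases "deriv f 0 + t0 / 2 = 0")
    case True
    then show ?thesis using t0(1) by (intro that[of "t0 / 3"]) auto
  next
    case False
    then show ?thesis using t0(1) by (intro that[of "t0 / 2"]) auto
  qed
  define f1 where "f1 = (\<lambda>x. f x + t * k x)"
  note f1 = C2S_add_scaled[OF f kC, of t, folded f1_def]
  have f10: "deriv f1 0 \<noteq> 0" using t(2) by (simp add: f1(2) k0)
  \<comment> \<open>On \<open>{-n..n}\<close>, adding \<open>s * q\<close> multiplies
    \<open>f1\<close> by \<open>1 + s\<close>. The slopes at zeros follow, since the derivative of
    the cutoff is multiplied by \<open>f1 c = 0\<close>.\<close>
  define q where "q x = \<theta> x * f1 x" for x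
  have q: "supported_C2S (n + 1) q" unfolding q_def using cut[of f1] f1(1) by (simp add: C2S_eq)
  have qC: "q \<in> C2S" using q by (simp add: supported_C2S_def)
  have dq: "deriv q c = deriv f1 c" if c: "\<bar>c\<bar> \<le> n" "f1 c = 0" for c
  proof -
    obtain \<theta>' where \<theta>': "\<And>x. (\<theta> has_real_derivative \<theta>' x) (at x)" using \<theta>C C2_functionE by metis
    have "(q has_real_derivative \<theta>' c * f1 c + deriv f1 c * \<theta> c) (at c)"
      unfolding q_def by (rule DERIV_mult[OF \<theta>' C2S_derivs(1)[OF f1(1)]])
    then show ?thesis using c \<theta>1 by (simp add: DERIV_imp_deriv)
  qed
  obtain s0 where s0: "0 < s0" "\<And>s. \<bar>s\<bar> < s0 \<Longrightarrow> supported_C2S (n + 1) (\<lambda>x. s * q x) \<and> C2_small (\<eta> / 2) (\<lambda>x. s * q x)"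
    using small_multiples[OF q \<eta>2] by metis
  define Z where "Z = {c. f1 c = 0 \<and> deriv f1 c \<noteq> 0}"
  have "countable Z"
  proof (rule countable_if_isolated)
    fix c assume c: "c \<in> Z"
    have "eventually (\<lambda>y. f1 y \<noteq> 0) (at c)"
      using c by (intro eventually_nonzero_near[OF C2S_derivs(1)[OF f1(1)]]) (simp add: Z_def)
    then obtain d where "d > 0" "\<And>y. y \<noteq> c \<Longrightarrow> dist y c < d \<Longrightarrow> f1 y \<noteq> 0"
      unfolding eventually_at by auto
    then show "\<exists>\<delta>>0. \<forall>y\<in>Z. \<bar>y - c\<bar> < \<delta> \<longrightarrow> y = c"
      by (intro exI[of _ d]) (auto simp: Z_def dist_real_def)
  qed
  \<comment> \<open>The parameters \<open>s\<close> for which some scaled slope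
    \<open>(1 + s) * deriv f1 c\<close> lies in the spectrum.\<close>
  then have "countable (\<Union>c\<in>Z. (\<lambda>\<mu>. \<mu> / deriv f1 c - 1) ` neumann_spectrum a)"
    using countable_neumann_spectrum by (intro countable_UN countable_image) auto
  moreover have "uncountable {0<..<s0}" using s0(1) by (simp add: uncountable_open_interval)
  ultimately obtain s where s: "0 < s" "s < s0"
    "s \<notin> (\<Union>c\<in>Z. (\<lambda>\<mu>. \<mu> / deriv f1 c - 1) ` neumann_spectrum a)"
    by (meson countable_subset greaterThanLessThan_iff subsetI)
  define p where "p x = t * k x + s * q x" for x
  have tk: "supported_C2S (n + 1) (\<lambda>x. t * k x)" "C2_small (\<eta> / 2) (\<lambda>x. t * k x)" using t0(2)[OF t(1)] by auto
  have sq: "supported_C2S (n + 1) (\<lambda>x. s * q x)" "C2_small (\<eta> / 2) (\<lambda>x. s * q x)" using s0(2)[of s] s by auto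
  have "supported_C2S (n + 1) p" unfolding p_def by (rule supported_C2S_add[OF tk(1) sq(1)])
  moreover have "C2_small \<eta> p"
    using C2_small_add[OF _ _ tk(2) sq(2)] tk(1) sq(1) unfolding p_def supported_C2S_def by simp
  moreover have "tame_constants a n (\<lambda>x. f x + p x)"
  proof -
    have fp: "(\<lambda>x. f x + p x) = (\<lambda>x. f1 x + s * q x)" by (simp add: p_def f1_def add.assoc)
    show ?thesis unfolding fp tame_constants_def
    proof (intro allI impI)
      fix c assume "\<bar>c\<bar> \<le> n \<and> f1 c + s * q c = 0 \<and> deriv (\<lambda>x. f1 x + s * q x) c \<in> neumann_spectrum a"
      then have c: "\<bar>c\<bar> \<le> n" "f1 c + s * q c = 0" "deriv (\<lambda>x. f1 x + s * q x) c \<in> neumann_spectrum a" by auto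
      have "(1 + s) * f1 c = 0" using c(2) \<theta>1[OF c(1)] by (simp add: q_def algebra_simps)
      then have f1c: "f1 c = 0" using s(1) by simp
      have d: "deriv (\<lambda>x. f1 x + s * q x) c = (1 + s) * deriv f1 c"
        using dq[OF c(1) f1c] by (simp add: C2S_add_scaled(2)[OF f1(1) qC] algebra_simps)
      have "deriv f1 c = 0"
      proof (rule ccontr)
        assume ne: "deriv f1 c \<noteq> 0"
        then have "c \<in> Z" using f1c by (simp add: Z_def)
        moreover have "s = deriv (\<lambda>x. f1 x + s * q x) c / deriv f1 c - 1" unfolding d using ne by simp
        ultimately show False using s(3) c(3) by blast
      qed
      then show "c \<noteq> 0 \<and> deriv (\<lambda>x. f1 x + s * q x) c = 0" using d f10 by auto
    qed
  qed
  ultimately show ?thesis by blast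
qed

text \<open>Tameness leaves only slope \<open>0\<close> at some \<open>c \<noteq> 0\<close>. The
  kernel is then the constant \<open>1\<close>, while every window about \<open>c\<close> contains
  all of \<open>{0..1}\<close> and gives integral \<open>1\<close>.\<close>

lemma constant_degenerate_not_orthogonal:
  assumes tame: "tame_constants a n g" and D: "degenerate_pair a g n u v \<phi> \<psi>"
    and const: "\<And>x. x \<in> {0..1} \<Longrightarrow> u x = c"
  shows "\<not> orthogonal_to_levels u \<phi>"
proof
  assume orth: "orthogonal_to_levels u \<phi>"
  note D = degenerate_pairD[OF D]
  obtain A where A: "A > 0" "\<And>x. x \<in> {0..1} \<Longrightarrow> \<bar>1 / a x\<bar> \<le> A" using inverse_bounded by blast
  have cn: "\<bar>c\<bar> \<le> n" using D(4)[of 0] const[of 0] by simp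
  have "((\<lambda>x::real. - g c) has_integral (v 1 - v 0)) {0..1}"
  proof (rule fundamental_theorem_of_calculus)
    fix x assume x: "x \<in> {0::real..1}"
    show "(v has_vector_derivative - g c) (at x within {0..1})"
      using equilibrium_fluxD(2)[OF D(1) x] const[OF x] by (simp add: has_real_derivative_iff_has_vector_derivative)
  qed simp
  moreover have "((\<lambda>x::real. - g c) has_integral - g c) {0..1}" using has_integral_const_real[of "- g c" 0 1] by simp
  ultimately have "v 1 - v 0 = - g c" by (rule has_integral_unique)
  then have gc: "g c = 0" using equilibrium_fluxD(3,4)[OF D(1)] by simp
  have flux: "equilibrium_flux a (\<lambda>x. deriv g c * \<phi> x) \<phi> \<psi>"
    using D(2) const unfolding equilibrium_flux_def by simp
  then have "deriv g c \<in> neumann_spectrum a" unfolding neumann_spectrum_def using D(3) by blast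
  then have c: "c \<noteq> 0" "deriv g c = 0" using tame gc cn unfolding tame_constants_def by auto
  have one: "equilibrium_flux a (\<lambda>x. 0 * 1) (\<lambda>_. 1) (\<lambda>_. 0)" by (simp add: equilibrium_flux_def)
  have \<phi>1: "\<phi> x = 1" if x: "x \<in> {0..1}" for x
  proof -
    have "\<bar>\<phi> x - 1\<bar> \<le> (exp (A + 0 + 1))\<^sup>2 * 0"
      by (rule kernel_distance(1)[OF flux[unfolded c(2)] D(3) one _ A(2) _ _ _ x]) auto
    then show ?thesis by simp
  qed
  define r where "r = min \<bar>c\<bar> 1 / 2"
  have r: "0 < r" "r < \<bar>c\<bar>" "r < 1" using c(1) by (auto simp: r_def min_def)
  have "c \<in> u ` {0..1}" using const[of 0] by (metis atLeastAtMost_iff image_eqI order_refl zero_le_one)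
  then have int0: "((\<lambda>x. if \<bar>u x - c\<bar> < r then \<phi> x else 0) has_integral 0) {0..1}"
    using orth r unfolding orthogonal_to_levels_def by blast
  have "((\<lambda>x. if \<bar>u x - c\<bar> < r then \<phi> x else 0) has_integral 1) {0..1}"
    by (rule has_integral_eq[of _ "\<lambda>_. 1"]) (use const \<phi>1 r has_integral_const_real[of "1::real" 0 1] in auto)
  then have "(1::real) = 0" using int0 has_integral_unique by blast
  then show False by simp
qed

section \<open>Open dense sets, given transversality at nonconstant equilibria\<close>

context
  fixes n :: real
  assumes not_orthogonal: "\<And>g u v \<phi> \<psi>. g \<in> C2S \<Longrightarrow> degenerate_pair a g n u v \<phi> \<psi> \<Longrightarrow>
      \<exists>x\<in>{0..1}. \<exists>y\<in>{0..1}. u x \<noteq> u y \<Longrightarrow> \<not> orthogonal_to_levels u \<phi>"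
begin

text \<open>If no degenerate pair starts at \<open>\<xi>\<close>, stability lets
  \<open>p = 0\<close> do. Otherwise one such pair provides a test function \<open>h\<close>, and
  small multiples of \<open>h\<close> serve as \<open>p\<close>.\<close>

lemma locally_dense:
  assumes f: "f \<in> C2S" "tame_constants a n f"
  shows "\<exists>\<delta>>0. \<forall>g\<in>C2S. C1_close n \<delta> f g \<longrightarrow> (\<forall>\<eta>>0. \<exists>p. supported_C2S (n + 1) p \<and> C2_small \<eta> p \<and>
     \<not> degenerate_in a n {\<xi> - \<delta>..\<xi> + \<delta>} (\<lambda>x. g x + p x))"
proof (cases "degenerate_in a n {\<xi>} f")
  case False
  obtain \<delta> where \<delta>: "\<delta> > 0" "\<And>g. g \<in> C2S \<Longrightarrow> C1_close n \<delta> f g \<Longrightarrow> \<not> degenerate_in a n {\<xi> - \<delta>..\<xi> + \<delta>} g"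
    using nondegenerate_near[OF f(1) False] by blast
  have "supported_C2S (n + 1) (\<lambda>_. 0)" using zero_in_C2S by (simp add: supported_C2S_def)
  moreover have "C2_small \<eta> (\<lambda>_. 0)" if "\<eta> > 0" for \<eta> using that zero_in_C2S(2) by (simp add: C2_small_def)
  ultimately show ?thesis using \<delta> by (intro exI[of _ \<delta>] conjI ballI impI allI) (auto intro!: exI[of _ "\<lambda>_. 0"])
next
  case True
  then obtain u v \<phi> \<psi> where D: "degenerate_pair a f n u v \<phi> \<psi>" "u 0 = \<xi>" unfolding degenerate_in_def by auto
  note D' = degenerate_pairD[OF D(1)]
  have no: "\<not> orthogonal_to_levels u \<phi>"
  proof (cases "\<exists>x\<in>{0..1}. \<exists>y\<in>{0..1}. u x \<noteq> u y")
    case True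
    then show ?thesis by (rule not_orthogonal[OF f(1) D(1)])
  next
    case False
    moreover have "(0::real) \<in> {0..1}" by simp
    ultimately have "u x = u 0" if "x \<in> {0..1}" for x using that by blast
    then show ?thesis by (rule constant_degenerate_not_orthogonal[OF f(2) D(1)])
  qed
  obtain h I where h: "supported_C2S (n + 1) h" "((\<lambda>x. h (u x) * \<phi> x) has_integral I) {0..1}" "I \<noteq> 0"
    using test_function_exists[OF equilibrium_fluxD(5)[OF D'(1)] equilibrium_fluxD(5)[OF D'(2)] D'(4) no] by blast
  have hC: "h \<in> C2S" using h(1) by (simp add: supported_C2S_def)
  obtain \<delta> where \<delta>: "\<delta> > 0" "\<And>g \<eta>. g \<in> C2S \<Longrightarrow> C1_close n \<delta> f g \<Longrightarrow> \<eta> > 0 \<Longrightarrow>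
      \<exists>t. 0 < t \<and> t < \<eta> \<and> \<not> degenerate_in a n {\<xi> - \<delta>..\<xi> + \<delta>} (\<lambda>x. g x + t * h x)"
    using perturbation_escapes[OF f(1) D(1) hC h(2,3)] D(2) by blast
  show ?thesis
  proof (rule exI[of _ \<delta>], intro conjI \<delta>(1) ballI impI allI)
    fix g \<eta> assume g: "g \<in> C2S" "C1_close n \<delta> f g" and \<eta>: "0 < (\<eta>::real)"
    obtain t0 where t0: "0 < t0" "\<And>t. \<bar>t\<bar> < t0 \<Longrightarrow> supported_C2S (n + 1) (\<lambda>x. t * h x) \<and> C2_small \<eta> (\<lambda>x. t * h x)"
      using small_multiples[OF h(1) \<eta>] by metis
    obtain t where t: "0 < t" "t < t0" "\<not> degenerate_in a n {\<xi> - \<delta>..\<xi> + \<delta>} (\<lambda>x. g x + t * h x)"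
      using \<delta>(2)[OF g t0(1)] by blast
    then show "\<exists>p. supported_C2S (n + 1) p \<and> C2_small \<eta> p \<and> \<not> degenerate_in a n {\<xi> - \<delta>..\<xi> + \<delta>} (\<lambda>x. g x + p x)"
      using t0(2)[of t] by (intro exI[of _ "\<lambda>x. t * h x"]) auto
  qed
qed

text \<open>Finitely many intervals of values of \<open>u 0\<close> cover \<open>{-n..n}\<close>.
  They are cleared one by one, each new perturbation being so small that the intervals already
  cleared stay clear.\<close>

lemma nondegenerate_dense:
  assumes f: "f \<in> C2S" and n: "0 < n" and \<eta>: "0 < \<eta>"
  shows "\<exists>p. supported_C2S (n + 1) p \<and> C2_small \<eta> p \<and> \<not> degenerate_in a n UNIV (\<lambda>x. f x + p x)"
proof -
  have \<eta>2: "0 < \<eta> / 2" using \<eta> by simp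
  obtain p1 where p1: "supported_C2S (n + 1) p1" "C2_small (\<eta> / 2) p1" "tame_constants a n (\<lambda>x. f x + p1 x)"
    using tame_constants_dense[OF f n \<eta>2] by blast
  have p1C: "p1 \<in> C2S" using p1(1) by (simp add: supported_C2S_def)
  define f1 where "f1 = (\<lambda>x. f x + p1 x)"
  have f1: "f1 \<in> C2S" "tame_constants a n f1" using C2S_add(1)[OF f p1C] p1(3) by (auto simp: f1_def)
  obtain \<delta> where \<delta>: "\<And>\<xi>. \<delta> \<xi> > 0" "\<And>\<xi> g \<eta>. g \<in> C2S \<Longrightarrow> C1_close n (\<delta> \<xi>) f1 g \<Longrightarrow> \<eta> > 0 \<Longrightarrow>
      \<exists>p. supported_C2S (n + 1) p \<and> C2_small \<eta> p \<and> \<not> degenerate_in a n {\<xi> - \<delta> \<xi>..\<xi> + \<delta> \<xi>} (\<lambda>x. g x + p x)"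
    using locally_dense[OF f1] by metis
  have step: "\<exists>p. supported_C2S (n + 1) p \<and> C2_small \<eta> p \<and>
      (\<forall>\<xi>\<in>T. \<not> degenerate_in a n {\<xi> - \<delta> \<xi>..\<xi> + \<delta> \<xi>} (\<lambda>x. f1 x + p x))" if "finite T" "\<eta> > 0" for T \<eta>
    using that
  proof (induction T arbitrary: \<eta> rule: finite_induct)
    case empty
    have "supported_C2S (n + 1) (\<lambda>_. 0)" "C2_small \<eta> (\<lambda>_. 0)"
      using zero_in_C2S empty by (simp_all add: supported_C2S_def C2_small_def)
    then show ?case by blast
  next
    case (insert \<zeta> T)
    \<comment> \<open>Half of the budget is left for the perturbation at \<open>\<zeta>\<close>, and
      the perturbed function stays within the range \<open>\<delta> \<zeta>\<close> of
      \<open>f1\<close> in which that perturbation is available.\<close>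
    define \<epsilon> where "\<epsilon> = min (\<eta> / 2) (\<delta> \<zeta>)"
    have \<epsilon>: "\<epsilon> > 0" "\<epsilon> \<le> \<eta> / 2" "\<epsilon> \<le> \<delta> \<zeta>" using insert.prems \<delta>(1)[of \<zeta>] by (auto simp: \<epsilon>_def)
    obtain p where p: "supported_C2S (n + 1) p" "C2_small \<epsilon> p"
      "\<And>\<xi>. \<xi> \<in> T \<Longrightarrow> \<not> degenerate_in a n {\<xi> - \<delta> \<xi>..\<xi> + \<delta> \<xi>} (\<lambda>x. f1 x + p x)"
      using insert.IH[OF \<epsilon>(1)] by blast
    have pC: "p \<in> C2S" using p(1) by (simp add: supported_C2S_def)
    define g where "g = (\<lambda>x. f1 x + p x)"
    have g: "g \<in> C2S" unfolding g_def by (rule C2S_add(1)[OF f1(1) pC])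
    have "C1_close n (\<delta> \<zeta>) f1 g"
      unfolding g_def by (rule C1_close_add[OF f1(1) pC C2_small_mono[OF p(2) \<epsilon>(3)]])
    note near = \<delta>(2)[OF g this]
    have "\<exists>d>0. \<forall>g'\<in>C2S. C1_close n d g g' \<longrightarrow> (\<forall>\<xi>\<in>T. \<not> degenerate_in a n {\<xi> - \<delta> \<xi>..\<xi> + \<delta> \<xi>} g')"
    proof -
      have "\<exists>d>0. \<forall>g'\<in>C2S. C1_close n d g g' \<longrightarrow> \<not> degenerate_in a n {\<xi> - \<delta> \<xi>..\<xi> + \<delta> \<xi>} g'" if "\<xi> \<in> T" for \<xi>
        using p(3)[OF that] by (intro nondegenerate_open[OF g]) (auto simp: g_def)
      then obtain d where d: "\<And>\<xi>. \<xi> \<in> T \<Longrightarrow> d \<xi> > 0 \<and> (\<forall>g'\<in>C2S. C1_close n (d \<xi>) g g' \<longrightarrow>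
          \<not> degenerate_in a n {\<xi> - \<delta> \<xi>..\<xi> + \<delta> \<xi>} g')" by metis
      \<comment> \<open>The value \<open>1\<close> makes the minimum positive also for empty
        \<open>T\<close>.\<close>
      define m where "m = Min (insert 1 (d ` T))"
      have m: "m > 0" "\<And>\<xi>. \<xi> \<in> T \<Longrightarrow> m \<le> d \<xi>"
        using insert.hyps(1) d by (auto simp: m_def)
      have "C1_close n (d \<xi>) g g'" if "C1_close n m g g'" "\<xi> \<in> T" for g' \<xi>
        using that m(2)[OF that(2)] unfolding C1_close_def by (meson order_trans)
      then show ?thesis using m(1) d by blast
    qed
    then obtain d where d: "d > 0" "\<And>g' \<xi>. g' \<in> C2S \<Longrightarrow> C1_close n d g g' \<Longrightarrow> \<xi> \<in> T \<Longrightarrow>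
        \<not> degenerate_in a n {\<xi> - \<delta> \<xi>..\<xi> + \<delta> \<xi>} g'" by blast
    have "min (\<eta> / 2) d > 0" using insert.prems d(1) by simp
    then obtain p' where p': "supported_C2S (n + 1) p'" "C2_small (min (\<eta> / 2) d) p'"
      "\<not> degenerate_in a n {\<zeta> - \<delta> \<zeta>..\<zeta> + \<delta> \<zeta>} (\<lambda>x. g x + p' x)"
      using near by blast
    have p'C: "p' \<in> C2S" using p'(1) by (simp add: supported_C2S_def)
    have eq: "(\<lambda>x. f1 x + (p x + p' x)) = (\<lambda>x. g x + p' x)" by (simp add: g_def add.assoc)
    have close: "C1_close n d g (\<lambda>x. g x + p' x)"
      by (rule C1_close_add[OF g p'C C2_small_mono[OF p'(2)]]) simp
    have "C2_small \<eta> (\<lambda>x. p x + p' x)"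
      by (rule C2_small_mono[OF C2_small_add[OF pC p'C p(2) p'(2)]]) (use \<epsilon>(2) in auto)
    moreover have "supported_C2S (n + 1) (\<lambda>x. p x + p' x)" by (rule supported_C2S_add[OF p(1) p'(1)])
    moreover have "\<forall>\<xi>\<in>insert \<zeta> T. \<not> degenerate_in a n {\<xi> - \<delta> \<xi>..\<xi> + \<delta> \<xi>} (\<lambda>x. f1 x + (p x + p' x))"
      unfolding eq using p'(3) d(2)[OF C2S_add(1)[OF g p'C] close] by blast
    ultimately show ?case by blast
  qed
  have "{-n..n} \<subseteq> (\<Union>\<xi>\<in>{-n..n}. ball \<xi> (\<delta> \<xi>))" using \<delta>(1) by force
  then obtain T where T: "finite T" "{-n..n} \<subseteq> (\<Union>\<xi>\<in>T. ball \<xi> (\<delta> \<xi>))"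
    using compactE_image[of "{-n..n}" "{-n..n}" "\<lambda>\<xi>. ball \<xi> (\<delta> \<xi>)"] by (metis compact_Icc open_ball)
  obtain p where p: "supported_C2S (n + 1) p" "C2_small (\<eta> / 2) p"
    "\<And>\<xi>. \<xi> \<in> T \<Longrightarrow> \<not> degenerate_in a n {\<xi> - \<delta> \<xi>..\<xi> + \<delta> \<xi>} (\<lambda>x. f1 x + p x)"
    using step[OF T(1) \<eta>2] by blast
  have pC: "p \<in> C2S" using p(1) by (simp add: supported_C2S_def)
  have eq: "(\<lambda>x. f x + (p1 x + p x)) = (\<lambda>x. f1 x + p x)" by (simp add: f1_def add.assoc)
  have "\<not> degenerate_in a n UNIV (\<lambda>x. f x + (p1 x + p x))"
    unfolding eq
  proof
    assume "degenerate_in a n UNIV (\<lambda>x. f1 x + p x)"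
    then obtain u v \<phi> \<psi> where D: "degenerate_pair a (\<lambda>x. f1 x + p x) n u v \<phi> \<psi>" unfolding degenerate_in_def by blast
    have "u 0 \<in> {-n..n}" using degenerate_pairD(4)[OF D, of 0] by (auto simp: abs_le_iff)
    then obtain \<xi> where \<xi>: "\<xi> \<in> T" "u 0 \<in> ball \<xi> (\<delta> \<xi>)" using T(2) by blast
    then have "u 0 \<in> {\<xi> - \<delta> \<xi>..\<xi> + \<delta> \<xi>}" by (auto simp: dist_real_def)
    then show False using p(3)[OF \<xi>(1)] D unfolding degenerate_in_def by blast
  qed
  moreover have "C2_small \<eta> (\<lambda>x. p1 x + p x)"
    using C2_small_add[OF p1C pC p1(2) p(2)] by simp
  moreover have "supported_C2S (n + 1) (\<lambda>x. p1 x + p x)" by (rule supported_C2S_add[OF p1(1) p(1)])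
  ultimately show ?thesis by (intro exI[of _ "\<lambda>x. p1 x + p x"] conjI)
qed

lemma nondegenerate_open_dense:
  assumes n: "0 < n"
  defines "G \<equiv> {f \<in> C2S. \<not> degenerate_in a n UNIV f}"
  shows "openin whitney_C2S G" "whitney_C2S closure_of G = topspace whitney_C2S"
proof -
  show "openin whitney_C2S G"
    unfolding openin_whitney_C2S_iff
  proof (intro conjI ballI)
    show "G \<subseteq> C2S" by (auto simp: G_def)
    fix f assume "f \<in> G"
    then have f: "f \<in> C2S" "\<not> degenerate_in a n UNIV f" by (auto simp: G_def)
    obtain \<delta> where \<delta>: "\<delta> > 0" "\<And>g. g \<in> C2S \<Longrightarrow> C1_close n \<delta> f g \<Longrightarrow> \<not> degenerate_in a n UNIV g"
      using nondegenerate_open[OF f(1) closed_UNIV f(2)] by blast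
    have "whitney_nbhd f (\<lambda>_. \<delta>) \<subseteq> G"
    proof
      fix g assume g: "g \<in> whitney_nbhd f (\<lambda>_. \<delta>)"
      then have gC: "g \<in> C2S" and "\<And>x k. k \<le> 2 \<Longrightarrow> \<bar>(deriv ^^ k) g x - (deriv ^^ k) f x\<bar> < \<delta>"
        by (auto simp: whitney_nbhd_def)
      from this(2)[of 0] this(2)[of 1] have "C1_close n \<delta> f g"
        unfolding C1_close_def by (auto simp: abs_minus_commute less_imp_le)
      then show "g \<in> G" using \<delta>(2) gC by (auto simp: G_def)
    qed
    then show "\<exists>\<epsilon>. continuous_on UNIV \<epsilon> \<and> (\<forall>x. 0 < \<epsilon> x) \<and> whitney_nbhd f \<epsilon> \<subseteq> G"
      using \<delta>(1) by (intro exI[of _ "\<lambda>_. \<delta>"]) auto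
  qed
  have "f \<in> whitney_C2S closure_of G" if f: "f \<in> C2S" for f
    unfolding in_closure_of
  proof (intro conjI allI impI)
    show "f \<in> topspace whitney_C2S" using f by simp
    fix T assume T: "f \<in> T \<and> openin whitney_C2S T"
    then obtain \<epsilon> where \<epsilon>: "continuous_on UNIV \<epsilon>" "\<And>x. 0 < \<epsilon> x" "whitney_nbhd f \<epsilon> \<subseteq> T"
      unfolding openin_whitney_C2S_iff by blast
    \<comment> \<open>The minimum of the Whitney tolerance over the support of the perturbations is
      the uniform size allowed to them.\<close>
    have "\<exists>y\<in>{-(n+1)..n+1}. \<forall>x\<in>{-(n+1)..n+1}. \<epsilon> y \<le> \<epsilon> x"
      by (rule continuous_attains_inf) (use n \<epsilon>(1) continuous_on_subset in auto)
    then obtain y where y: "\<And>x. x \<in> {-(n+1)..n+1} \<Longrightarrow> \<epsilon> y \<le> \<epsilon> x" by blast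
    obtain p where p: "supported_C2S (n + 1) p" "C2_small (\<epsilon> y) p" "\<not> degenerate_in a n UNIV (\<lambda>x. f x + p x)"
      using nondegenerate_dense[OF f n \<epsilon>(2)] by blast
    have pC: "p \<in> C2S" using p(1) by (simp add: supported_C2S_def)
    note fp = C2S_add[OF f pC]
    have small: "\<bar>p x\<bar> < \<epsilon> x \<and> \<bar>deriv p x\<bar> < \<epsilon> x \<and> \<bar>deriv (deriv p) x\<bar> < \<epsilon> x" for x
    proof (cases "n + 1 < \<bar>x\<bar>")
      case True
      then show ?thesis using supported_C2S_derivs[OF p(1) True] \<epsilon>(2) by simp
    next
      case False
      then have "\<epsilon> y \<le> \<epsilon> x" by (intro y) auto
      then show ?thesis using p(2) unfolding C2_small_def by (meson less_le_trans)
    qed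
    have "(\<lambda>x. f x + p x) \<in> whitney_nbhd f \<epsilon>"
      unfolding whitney_nbhd_def
    proof (intro CollectI conjI allI impI fp(1))
      fix x :: real and k :: nat assume "k \<le> 2"
      then consider "k = 0" | "k = 1" | "k = 2" by linarith
      then show "\<bar>(deriv ^^ k) (\<lambda>x. f x + p x) x - (deriv ^^ k) f x\<bar> < \<epsilon> x"
      proof cases
        case 1
        then show ?thesis using small[of x] by simp
      next
        case 2
        then show ?thesis using small[of x] by (simp add: fp(2))
      next
        case 3
        have two: "(deriv ^^ 2) g = deriv (deriv g)" for g :: "real \<Rightarrow> real" by (simp add: numeral_2_eq_2)
        show ?thesis unfolding 3 two fp(3) using small[of x] by simp
      qed
    qed
    then show "\<exists>g. g \<in> G \<and> g \<in> T" using \<epsilon>(3) p(3) fp(1) unfolding G_def by blast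
  qed
  then show "whitney_C2S closure_of G = topspace whitney_C2S"
    using closure_of_subset_topspace[of whitney_C2S G] by auto
qed

end

text \<open>An eigenfunction does not vanish at \<open>0\<close> by uniqueness and can be divided by
  \<open>w 0\<close>; boundedness of \<open>u\<close> supplies the index.\<close>

lemma nonhyperbolic_imp_degenerate:
  assumes f: "f \<in> C2S" and eq: "equilibrium a f u" and nh: "\<not> hyperbolic a f u"
  shows "\<exists>N::nat. degenerate_in a (real (Suc N)) UNIV f"
proof -
  obtain u' where u': "\<And>x. x \<in> {0..1} \<Longrightarrow> (u has_real_derivative u' x) (at x within {0..1})"
    "\<And>x. x \<in> {0..1} \<Longrightarrow> ((\<lambda>y. a y * u' y) has_real_derivative - f (u x)) (at x within {0..1})"
    "u' 0 = 0" "u' 1 = 0"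
    using eq unfolding equilibrium_def neumann_solution_def by blast
  obtain w x0 w' where x0: "x0 \<in> {0..1}" "w x0 \<noteq> 0" and
    w': "\<And>x. x \<in> {0..1} \<Longrightarrow> (w has_real_derivative w' x) (at x within {0..1})"
    "\<And>x. x \<in> {0..1} \<Longrightarrow> ((\<lambda>y. a y * w' y) has_real_derivative 0 * w x - deriv f (u x) * w x) (at x within {0..1})"
    "w' 0 = 0" "w' 1 = 0"
    using nh unfolding hyperbolic_def linearized_eigenvalue_def neumann_solution_def by blast
  have an: "a x \<noteq> 0" if "x \<in> {0..1}" for x using a_pos[OF that] by simp
  have ucont: "continuous_on {0..1} u" by (rule DERIV_continuous_on[OF u'(1)])
  obtain B where B: "B > 0" "\<And>x. x \<in> {0..1} \<Longrightarrow> \<bar>u x\<bar> \<le> B" using continuous_on_Icc_bounded[OF ucont] by blast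
  obtain N :: nat where N: "B < real N" using reals_Archimedean2 by blast
  obtain L where L: "L > 0" "\<And>s. \<bar>s\<bar> \<le> B \<Longrightarrow> \<bar>deriv f s\<bar> \<le> L"
    using bounded_on_symmetric_interval[OF C2S_derivs(4)[OF f]] by blast
  have w0: "w 0 \<noteq> 0"
  proof
    assume "w 0 = 0"
    have "w x0 = 0 \<and> a x0 * w' x0 = 0"
    proof (rule uniqueness_system[where w = w and z = "\<lambda>y. a y * w' y" and s = 0 and t = 1 and a = a and L = L
          and x = 0 and r = "\<lambda>x. 0 * w x - deriv f (u x) * w x"])
      show "(w has_real_derivative a x * w' x / a x) (at x within {0..1})" if "x \<in> {0..1}" for x
        using w'(1)[OF that] an[OF that] by simp
      show "\<bar>0 * w x - deriv f (u x) * w x\<bar> \<le> L * \<bar>w x\<bar>" if "x \<in> {0..1}" for x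
        using L(2)[OF B(2)[OF that]] by (simp add: abs_mult mult_right_mono)
    qed (use w' a_pos a_cont L(1) x0(1) \<open>w 0 = 0\<close> in auto)
    then show False using x0(2) by simp
  qed
  have "degenerate_pair a f (real (Suc N)) u (\<lambda>y. a y * u' y) (\<lambda>x. w x / w 0) (\<lambda>y. a y * w' y / w 0)"
    unfolding degenerate_pair_def equilibrium_flux_def
  proof (intro conjI ballI)
    fix x :: real assume x: "x \<in> {0..1}"
    show "(u has_real_derivative a x * u' x / a x) (at x within {0..1})" using u'(1)[OF x] an[OF x] by simp
    show "((\<lambda>y. a y * u' y) has_real_derivative - f (u x)) (at x within {0..1})" by (rule u'(2)[OF x])
    show "((\<lambda>x. w x / w 0) has_real_derivative a x * w' x / w 0 / a x) (at x within {0..1})"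
      using DERIV_cdivide[OF w'(1)[OF x], of "w 0"] an[OF x] by simp
    show "((\<lambda>y. a y * w' y / w 0) has_real_derivative - (deriv f (u x) * (w x / w 0))) (at x within {0..1})"
      using DERIV_cdivide[OF w'(2)[OF x], of "w 0"] by simp
    show "\<bar>u x\<bar> \<le> real (Suc N)" using B(2)[OF x] N by simp
  qed (use u' w' w0 in auto)
  then show ?thesis unfolding degenerate_in_def by blast
qed

end

theorem corollary1:
  fixes a :: "real \<Rightarrow> real"
  assumes "real_analytic_on a {0..1}"
    and "\<forall>x\<in>{0..1}. a x > 0"
    and "has_intervals_of_monotonicity a 2"
    and "\<not> even_about_half a"
  shows "\<exists>F. residual_in whitney_C2S F \<and>
             (\<forall>f\<in>F. \<forall>u. equilibrium a f u \<longrightarrow> hyperbolic a f u)"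
proof -
  obtain a' p where a': "\<And>x. x \<in> {0..1} \<Longrightarrow> (a has_real_derivative a' x) (at x within {0..1})"
    and p: "p (0::nat) = 0" "p 2 = 1" "\<And>i. i < 2 \<Longrightarrow> p i < p (Suc i)"
      "\<And>i. i < 2 \<Longrightarrow> (\<forall>x\<in>{p i<..<p (Suc i)}. a' x > 0) \<or> (\<forall>x\<in>{p i<..<p (Suc i)}. a' x < 0)"
    using assms(3) unfolding has_intervals_of_monotonicity_def by blast
  define c where "c = p 1"
  have c: "0 < c" "c < 1" using p(1,2) p(3)[of 0] p(3)[of 1] by (auto simp: c_def numeral_2_eq_2)
  have left: "(\<forall>x\<in>{0<..<c}. a' x > 0) \<or> (\<forall>x\<in>{0<..<c}. a' x < 0)"
    using p(1) p(4)[of 0] by (simp add: c_def)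
  have right: "(\<forall>x\<in>{c<..<1}. a' x > 0) \<or> (\<forall>x\<in>{c<..<1}. a' x < 0)"
    using p(2) p(4)[of 1] by (simp add: c_def numeral_2_eq_2)
  interpret diffusion a
    by unfold_locales (use assms(2) DERIV_continuous_on[OF a'] in auto)
  have not_orth: "\<not> orthogonal_to_levels u \<phi>"
    if g: "g \<in> C2S" and D: "degenerate_pair a g n u v \<phi> \<psi>"
      and nc: "\<exists>x\<in>{0..1}. \<exists>y\<in>{0..1}. u x \<noteq> u y" for g n u v \<phi> \<psi>
  proof
    assume orth: "orthogonal_to_levels u \<phi>"
    note D = degenerate_pairD[OF D]
    interpret kernel_pair a a' g "deriv g" u v \<phi> \<psi>
    proof
      show "\<exists>x\<in>{0..1}. \<phi> x \<noteq> 0" using D(3) by (intro bexI[of _ 0]) auto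
    qed (use assms(2) a' C2S_derivs[OF g] equilibrium_fluxD[OF D(1)] equilibrium_fluxD[OF D(2)] nc orth in auto)
    show False by (rule no_orthogonal_kernel[OF c assms(1,4) left right])
  qed
  \<comment> \<open>The successor keeps the bound on \<open>\<bar>u\<bar>\<close> positive, as the
    density argument requires. Every equilibrium obeys one of these bounds.\<close>
  define G where "G N = {f \<in> C2S. \<not> degenerate_in a (real (Suc N)) UNIV f}" for N :: nat
  have G: "openin whitney_C2S (G N)" "whitney_C2S closure_of G N = topspace whitney_C2S" for N
    unfolding G_def by (intro nondegenerate_open_dense; use not_orth in auto)+
  show ?thesis
  proof (intro exI[of _ "\<Inter>N. G N"] conjI ballI allI impI)
    show "residual_in whitney_C2S (\<Inter>N. G N)"
      unfolding residual_in_def using G by (intro conjI exI[of _ G]) (auto simp: G_def)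
    fix f u assume f: "f \<in> (\<Inter>N. G N)" and "equilibrium a f u"
    then show "hyperbolic a f u"
      using nonhyperbolic_imp_degenerate[of f u] by (auto simp: G_def)
  qed
qed

end
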